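(* Let $h<1$ and let $g$ be a probability density on $\mathbb{R}$ such that, for some $\delta>0$, $g$ has an analytic continuation to the strip $S(\delta)=\{z\in\mathbb{C}: 0\le\mathrm{Im}(z)\le\delta\}$, and there is a constant $C>0$ with $|g(z)|\le \dfrac{C}{1+|z|^2}$ for all $z\in S(\delta)$. Let $K_c=\dfrac{2}{\pi g(y_c)}$, where $y_c\in\mathbb{R}$ is a root of $H[g](y)=0$ at which $g$ attains its supremum over all roots of $H[g](y)=0$. Then for $0<K<K_c$ the incoherent state of the continuous Kuramoto-Daido model with coupling function $f(\theta)=\sin\theta+h\sin2\theta$ and coupling strength $K$ is linearly asymptotically stable in the weak sense.
   Context: Model. Let $g$ be a probability density on $\mathbb{R}$, $K>0$, $h\in\mathbb{R}$, $i=\sqrt{-1}$. Write $f(\theta)=\sin\theta+h\sin2\theta=\sum_{l}f_le^{il\theta}$, so $f_1=1/(2i)$, $f_2=h/(2i)$, $f_{-l}=\overline{f_l}$ and $f_l=0$ for $|l|\neq 1,2$. The continuous Kuramoto-Daido model is the evolution equation for a family of probability measures $\rho_t(\theta,\omega)$ on $[0,2\pi)$ (parameterized by $t,\omega$): $\partial_t\rho_t+\partial_\theta(\rho_t v)=0$, $v=\omega+K\sum_l f_l\eta_l(t)e^{-il\theta}$, $\eta_l(t)=\int_{\mathbb{R}}\int_0^{2\pi}e^{il\theta}\rho_t(\theta,\omega)g(\omega)\,d\theta\,d\omega$. The incoherent state is the trivial solution $\rho_t\equiv 1/(2\pi)$. Linearization. With $Z_j(t,\omega)=\int_0^{2\pi}e^{ij\theta}\rho_t(\theta,\omega)\,d\theta$,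 the model is $\frac{dZ_j}{dt}=ij\omega Z_j+ijKf_j\eta_j+ijK\sum_{l\ne j}f_l\eta_lZ_{j-l}$, with $Z_0\equiv1$; the incoherent state corresponds to $Z_j\equiv0$ for $j\ne0$. Its linearization is $\frac{dZ_j}{dt}=T_jZ_j$, $j=1,2,\dots$, where $T_j=ij\omega+ijKf_j\mathcal{P}$ acts on $L^2(\mathbb{R},g(\omega)d\omega)$, $\omega$ denotes multiplication by $\omega$, and $(\mathcal{P}\phi)(\omega)=\int_{\mathbb{R}}\phi(\omega')g(\omega')\,d\omega'$ (a constant function). The inner product is $(\phi,\psi)=\int_{\mathbb{R}}\phi(\omega)\overline{\psi(\omega)}g(\omega)\,d\omega$. Hilbert transform: $H[g](y)=-\frac1\pi\,\mathrm{p.v.}\int_{\mathbb{R}}\frac1\omega g(\omega+y)\,d\omega$. If $y_1,y_2,\dots$ are the roots of $H[g](y)=0$, it is supposed that $y_c$ is a root with $g(y_c)=\sup_j g(y_j)$. Weak stability. $H_+$ is the set of bounded holomorphic functions on the real axis and the upper half plane, a dense subspace of $L^2(\mathbb{R},g(\omega)d\omega)$. For $\psi\in H_+$, $\psi^*(z)=\overline{\psi(\overline z)}$. A family $f_t\in L^2(\mathbb{R},g(\omega)d\omega)$ converges to zero in the weak sense if $(f_t,\psi^* )\to0$ as $t\to\infty$ for every $\psi\in H_+$. The incoherent state is linearly asymptotically stable in the weak sense if $e^{T_jt}\phi$ converges to zero in the weak sense as $t\to\infty$ for every $j=1,2,\dots$ and every $\phi\in H_+$. *)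

theory Defs
  imports "HOL-Complex_Analysis.Complex_Analysis"
begin

definition daido_coupling :: "real \<Rightarrow> real \<Rightarrow> real" where
  "daido_coupling h \<theta> = sin \<theta> + h * sin (2 * \<theta>)"

definition fourier_coeff :: "(real \<Rightarrow> real) \<Rightarrow> int \<Rightarrow> complex" where
  "fourier_coeff f l =
     integral {0..2 * pi} (\<lambda>\<theta>. of_real (f \<theta>) * exp (- (\<i> * of_int l * of_real \<theta>))) / of_real (2 * pi)"

definition prob_density :: "(real \<Rightarrow> real) \<Rightarrow> bool" where
  "prob_density g \<longleftrightarrow>
     (\<forall>\<omega>. 0 \<le> g \<omega>) \<and> integrable lborel g \<and> (LINT \<omega>|lborel. g \<omega>) = 1"

text \<open>The principal value is taken at the singularity \<open>\<omega> = 0\<close>.\<close>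

definition hilbert_transform :: "(real \<Rightarrow> real) \<Rightarrow> real \<Rightarrow> real" where
  "hilbert_transform g y =
     - (1 / pi) * Lim (at_right 0) (\<lambda>\<epsilon>. LINT \<omega>:{\<omega>. \<epsilon> < \<bar>\<omega>\<bar>}|lborel. g (\<omega> + y) / \<omega>)"

text \<open>Analyticity on the closed strip means holomorphy on a neighbourhood of it (\<open>analytic_on\<close>).\<close>

definition strip :: "real \<Rightarrow> complex set" where
  "strip \<delta> = {z. 0 \<le> Im z \<and> Im z \<le> \<delta>}"

definition analytic_continuation :: "(real \<Rightarrow> real) \<Rightarrow> (complex \<Rightarrow> complex) \<Rightarrow> complex set \<Rightarrow> bool" where
  "analytic_continuation g G S \<longleftrightarrow>
     G analytic_on S \<and> (\<forall>x. of_real x \<in> S \<longrightarrow> G (of_real x) = of_real (g x))"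

text \<open>The elements of the space \<open>L\<^sup>2(M)\<close> are represented by square integrable functions;
  equality of elements is equality almost everywhere.\<close>

definition weighted :: "(real \<Rightarrow> real) \<Rightarrow> real measure" where
  "weighted g = density lborel (\<lambda>\<omega>. ennreal (g \<omega>))"

definition L2 :: "'a measure \<Rightarrow> ('a \<Rightarrow> complex) set" where
  "L2 M = {\<phi> \<in> borel_measurable M. integrable M (\<lambda>x. (cmod (\<phi> x))\<^sup>2)}"

definition L2_norm :: "'a measure \<Rightarrow> ('a \<Rightarrow> complex) \<Rightarrow> real" where
  "L2_norm M \<phi> = sqrt (LINT x|M. (cmod (\<phi> x))\<^sup>2)"

definition L2_inner :: "'a measure \<Rightarrow> ('a \<Rightarrow> complex) \<Rightarrow> ('a \<Rightarrow> complex) \<Rightarrow> complex" where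
  "L2_inner M \<phi> \<psi> = (LINT x|M. \<phi> x * cnj (\<psi> x))"

text \<open>Strongly continuous semigroups of bounded linear operators on \<open>L\<^sup>2(M)\<close>. Boundedness and linearity
  make each \<open>S t\<close> compatible with equality almost everywhere.\<close>

definition C0_semigroup :: "'a measure \<Rightarrow> (real \<Rightarrow> ('a \<Rightarrow> complex) \<Rightarrow> ('a \<Rightarrow> complex)) \<Rightarrow> bool" where
  "C0_semigroup M S \<longleftrightarrow>
     (\<forall>t\<ge>0. \<forall>\<phi>\<in>L2 M. S t \<phi> \<in> L2 M) \<and>
     (\<forall>t\<ge>0. \<forall>a b. \<forall>\<phi>\<in>L2 M. \<forall>\<psi>\<in>L2 M.
        AE x in M. S t (\<lambda>x. a * \<phi> x + b * \<psi> x) x = a * S t \<phi> x + b * S t \<psi> x) \<and>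
     (\<forall>t\<ge>0. \<exists>B. \<forall>\<phi>\<in>L2 M. L2_norm M (S t \<phi>) \<le> B * L2_norm M \<phi>) \<and>
     (\<forall>\<phi>\<in>L2 M. AE x in M. S 0 \<phi> x = \<phi> x) \<and>
     (\<forall>s\<ge>0. \<forall>t\<ge>0. \<forall>\<phi>\<in>L2 M. AE x in M. S (s + t) \<phi> x = S s (S t \<phi>) x) \<and>
     (\<forall>\<phi>\<in>L2 M. ((\<lambda>t. L2_norm M (\<lambda>x. S t \<phi> x - \<phi> x)) \<longlongrightarrow> 0) (at_right 0))"

text \<open>\<open>generates M D A S\<close>: the infinitesimal generator of \<open>S\<close> is exactly the (in general unbounded)
  operator \<open>A\<close> with domain \<open>D\<close>. A \<open>C\<^sub>0\<close>-semigroup is determined by its generator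
  up to equality almost everywhere, so such an \<open>S\<close> is the operator exponential \<open>exp (t A)\<close>.\<close>

definition generates ::
  "'a measure \<Rightarrow> ('a \<Rightarrow> complex) set \<Rightarrow> (('a \<Rightarrow> complex) \<Rightarrow> ('a \<Rightarrow> complex)) \<Rightarrow>
   (real \<Rightarrow> ('a \<Rightarrow> complex) \<Rightarrow> ('a \<Rightarrow> complex)) \<Rightarrow> bool" where
  "generates M D A S \<longleftrightarrow>
     C0_semigroup M S \<and>
     (\<forall>\<phi>\<in>L2 M. \<forall>\<psi>\<in>L2 M.
        ((\<lambda>t. L2_norm M (\<lambda>x. (S t \<phi> x - \<phi> x) / of_real t - \<psi> x)) \<longlongrightarrow> 0) (at_right 0) \<longleftrightarrow>
        \<phi> \<in> D \<and> (AE x in M. \<psi> x = A \<phi> x))"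

text \<open>\<open>lin_op K f g j\<close> is \<open>T\<^sub>j = i j \<omega> + i j K f\<^sub>j P\<close>, the linearization of the \<open>j\<close>-th Fourier mode
  about the incoherent state; its domain is the maximal domain of multiplication by \<open>\<omega>\<close>.\<close>

definition lin_op_domain :: "(real \<Rightarrow> real) \<Rightarrow> (real \<Rightarrow> complex) set" where
  "lin_op_domain g = {\<phi> \<in> L2 (weighted g). (\<lambda>\<omega>. of_real \<omega> * \<phi> \<omega>) \<in> L2 (weighted g)}"

definition lin_op ::
  "real \<Rightarrow> (real \<Rightarrow> real) \<Rightarrow> (real \<Rightarrow> real) \<Rightarrow> nat \<Rightarrow> (real \<Rightarrow> complex) \<Rightarrow> (real \<Rightarrow> complex)" where
  "lin_op K f g j \<phi> \<omega> =
     \<i> * of_nat j * of_real \<omega> * \<phi> \<omega> +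
     \<i> * of_nat j * of_real K * fourier_coeff f (int j) * (LINT \<omega>'|weighted g. \<phi> \<omega>')"

definition H_plus :: "(complex \<Rightarrow> complex) set" where
  "H_plus = {\<phi>. \<phi> analytic_on {z. 0 \<le> Im z} \<and> bounded (\<phi> ` {z. 0 \<le> Im z})}"

definition star :: "(complex \<Rightarrow> complex) \<Rightarrow> complex \<Rightarrow> complex" where
  "star \<psi> z = cnj (\<psi> (cnj z))"

definition weakly_to_zero :: "(real \<Rightarrow> real) \<Rightarrow> (real \<Rightarrow> real \<Rightarrow> complex) \<Rightarrow> bool" where
  "weakly_to_zero g F \<longleftrightarrow>
     (\<forall>\<psi>\<in>H_plus.
        ((\<lambda>t. L2_inner (weighted g) (F t) (\<lambda>\<omega>. star \<psi> (of_real \<omega>))) \<longlongrightarrow> 0) at_top)"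

text \<open>The witness \<open>S\<close> is \<open>exp (t T\<^sub>j)\<close>; stating its existence includes that \<open>T\<^sub>j\<close> is a generator.
  Functions in \<open>H_plus\<close> are viewed as elements of \<open>L\<^sup>2\<close> by restriction to the real axis.\<close>

definition incoherent_state_weakly_stable ::
  "real \<Rightarrow> (real \<Rightarrow> real) \<Rightarrow> (real \<Rightarrow> real) \<Rightarrow> bool" where
  "incoherent_state_weakly_stable K f g \<longleftrightarrow>
     (\<forall>j\<ge>1. \<exists>S. generates (weighted g) (lin_op_domain g) (lin_op K f g j) S \<and>
        (\<forall>\<phi>\<in>H_plus. weakly_to_zero g (\<lambda>t. S t (\<lambda>\<omega>. \<phi> (of_real \<omega>)))))"

lemma integral_exp_int:
  "((\<lambda>\<theta>. exp (\<i> * of_int k * of_real \<theta>)) has_integral (if k = 0 then of_real (2 * pi) else 0)) {0..2 * pi}"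
proof (cases "k = 0")
  case True
  then show ?thesis
    using has_integral_const_real[of "1::complex" 0 "2 * pi"] by (simp add: scaleR_conv_of_real)
next
  case False
  have "((\<lambda>\<theta>. exp (\<i> * of_int k * of_real \<theta>)) has_integral
      (exp (\<i> * of_int k * of_real (2 * pi)) / (\<i> * of_int k) - exp (\<i> * of_int k * of_real 0) / (\<i> * of_int k)))
      {0..2 * pi}"
    by (rule fundamental_theorem_of_calculus)
      (use False in \<open>auto intro!: derivative_eq_intros has_vector_derivative_real_field\<close>)
  moreover have "exp (\<i> * of_int k * of_real (2 * pi)) = 1"
    using exp_two_pi_i exp_eq_1 by (auto simp: exp_eq_1)
  ultimately show ?thesis
    using False by simp
qed

lemma fourier_coeff_daido:
  "fourier_coeff (daido_coupling h) l =
     (if l = 1 then 1 / (2 * \<i>) else if l = - 1 then - 1 / (2 * \<i>)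
      else if l = 2 then of_real h / (2 * \<i>) else if l = - 2 then - of_real h / (2 * \<i>) else 0)"
proof -
  let ?e = "\<lambda>k \<theta>. exp (\<i> * of_int k * of_real \<theta>) :: complex"
  let ?d = "\<lambda>k::int. (if k = 0 then of_real (2 * pi) else 0 :: complex)"
  have eq: "of_real (daido_coupling h \<theta>) * exp (- (\<i> * of_int l * of_real \<theta>)) =
      1 / (2 * \<i>) * (?e (1 - l) \<theta> - ?e (- 1 - l) \<theta>) + of_real h / (2 * \<i>) * (?e (2 - l) \<theta> - ?e (- 2 - l) \<theta>)"
    for \<theta>
  proof -
    have s1: "of_real (sin \<theta>) = (exp (\<i> * of_real \<theta>) - exp (- (\<i> * of_real \<theta>))) / (2 * \<i>)"
      by (simp add: sin_exp_eq flip: sin_of_real)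
    have s2: "of_real (sin (2 * \<theta>)) =
        (exp (\<i> * (2 * of_real \<theta>)) - exp (- (\<i> * (2 * of_real \<theta>)))) / (2 * \<i>)"
      using sin_exp_eq[of "2 * complex_of_real \<theta>"]
      by (metis of_real_mult of_real_numeral sin_of_real)
    have m: "?e (a - l) \<theta> = exp (\<i> * (of_int a * of_real \<theta>)) * exp (- (\<i> * of_int l * of_real \<theta>))" for a
      by (simp add: algebra_simps flip: exp_add)
    show ?thesis
      unfolding daido_coupling_def of_real_add of_real_mult s1 s2 m
      by (simp add: field_simps)
  qed
  have "((\<lambda>\<theta>. of_real (daido_coupling h \<theta>) * exp (- (\<i> * of_int l * of_real \<theta>))) has_integral
      1 / (2 * \<i>) * (?d (1 - l) - ?d (- 1 - l)) + of_real h / (2 * \<i>) * (?d (2 - l) - ?d (- 2 - l))) {0..2 * pi}"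
    unfolding eq
    by (intro has_integral_add has_integral_mult_right has_integral_diff integral_exp_int)
  then show ?thesis
    unfolding fourier_coeff_def by (auto dest!: integral_unique simp: field_simps)
qed

end

theory Submission imports Defs "HOL-Probability.Probability" begin

text \<open>
  Put \<open>\<kappa>\<^sub>j = i K f\<^sub>j\<close>. Then \<open>T\<^sub>j = j (i \<omega> + \<kappa>\<^sub>j P)\<close>, and for the coupling \<open>sin \<theta> + h sin 2\<theta>\<close> the number
  \<open>\<kappa>\<^sub>j\<close> is real: it is \<open>K / 2\<close>, \<open>h K / 2\<close> or \<open>0\<close>. Because \<open>h < 1\<close> and \<open>K > 0\<close>, all of them are at most \<open>K / 2\<close>. After
  rescaling time by \<open>j\<close> (\<open>generates_time_scaled\<close>) it remains to study \<open>T = i \<omega> + \<kappa> P\<close> for one real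
  \<open>\<kappa> \<le> K / 2\<close>.

  The perturbation has rank one, so the flow of \<open>T\<close> is explicit up to one scalar function. By Duhamel's
  formula \<open>exp(t T) \<phi> = exp(i \<omega> t) \<phi> + \<kappa> \<integral>\<^sub>0\<^sup>t exp(i \<omega> (t - s)) \<eta>(s) ds\<close>, and the order parameter \<open>\<eta>(t) = P exp(t T) \<phi>\<close>
  solves the Volterra equation \<open>\<eta> = a + \<kappa> k * \<eta>\<close>, where \<open>a(t) = \<integral> exp(i \<omega> t) \<phi> g d\<omega>\<close> and \<open>k\<close> is the
  characteristic function of \<open>g\<close>. Uniqueness for this equation gives the semigroup law, and dominated
  convergence identifies the generator together with its domain (\<open>generates_flow\<close>).

  Testing against \<open>\<psi>\<close> gives \<open>\<integral> exp(i \<omega> t) \<phi> \<psi> g d\<omega> + \<kappa> (b * \<eta>)(t)\<close> with \<open>b(t) = \<integral> exp(i \<omega> t) \<psi> g d\<omega>\<close>. The functions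
  \<open>g\<close>, \<open>\<phi>\<close>, \<open>\<psi>\<close> are holomorphic in the strip, so the line of integration can be raised to height \<open>\<delta>\<close>, and
  all these Fourier integrals decay like \<open>exp(-\<delta> t)\<close> (\<open>fourier_eq_decaying_kernel\<close>). This phase mixing settles the
  first term. Let \<open>D\<close> be the Laplace transform of \<open>k\<close>. On the right half-plane it is
  \<open>D(\<zeta>) = \<integral> g(\<omega>) / (\<zeta> - i \<omega>) d\<omega>\<close>, and the decay of \<open>k\<close> continues it to \<open>Re \<zeta> > -\<delta>\<close>. The transform of
  \<open>b * \<eta>\<close> is the product of the transforms of \<open>a\<close> and \<open>b\<close> divided by \<open>1 - \<kappa> D\<close>. It is of order
  \<open>1 / |\<zeta>|\<^sup>2\<close> on vertical lines. If \<open>1 - \<kappa> D\<close> has no zero with \<open>Re \<zeta> \<ge> 0\<close>, then the inversion integral can be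
  moved from a line far to the right to a line \<open>Re \<zeta> = -\<epsilon>\<close>, which makes \<open>b * \<eta>\<close> decay exponentially
  (\<open>volterra_weak_decay\<close>).

  The equation \<open>\<kappa> D(\<zeta>) = 1\<close> indeed has no solution with \<open>Re \<zeta> \<ge> 0\<close> (\<open>no_eigenvalue_right_half_plane\<close>). For
  \<open>\<kappa> \<le> 0\<close> this holds because \<open>Re D \<ge> 0\<close>. For \<open>\<kappa> > 0\<close> consider the points of the closed half-plane at which
  \<open>D\<close> is real and at least \<open>1 / \<kappa>\<close>. As \<open>D\<close> vanishes at infinity, they form a compact set; if it is not empty,
  \<open>D\<close> is largest at one of them, and the open mapping theorem forces that point onto the imaginary axis.
  There \<open>D(i y) = \<pi> g(y) - i \<pi> H[g](y)\<close>, so \<open>H[g](y) = 0\<close> and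
  \<open>D(i y) = \<pi> g(y) \<le> \<pi> g(y\<^sub>c) < 2 / K \<le> 1 / \<kappa>\<close>, a contradiction. This is the role of the critical coupling
  \<open>K\<^sub>c = 2 / (\<pi> g(y\<^sub>c))\<close>.
\<close>

section \<open>Volterra equations on the half-line\<close>

text \<open>Convolution of two functions on the half-line: both arguments are evaluated at nonnegative
  times only, so the lemmas below ask for continuity on \<open>{0..}\<close>.\<close>

definition conv :: "(real \<Rightarrow> complex) \<Rightarrow> (real \<Rightarrow> complex) \<Rightarrow> real \<Rightarrow> complex" where
  "conv b u t = integral {0..t} (\<lambda>s. b (t - s) * u s)"

lemma conv_0 [simp]: "conv b u 0 = 0"
  by (simp add: conv_def)

lemma continuous_on_conv_integrand:
  fixes b u :: "real \<Rightarrow> complex"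
  assumes "continuous_on {0..} b" "continuous_on {0..} u"
  shows "continuous_on {0..t} (\<lambda>s. b (t - s) * u s)"
proof -
  have "continuous_on {0..t} (\<lambda>s. b (t - s))"
    by (rule continuous_on_compose2[OF assms(1)]) (auto intro!: continuous_intros)
  moreover have "continuous_on {0..t} u"
    using assms(2) by (rule continuous_on_subset) auto
  ultimately show ?thesis by (intro continuous_intros)
qed

lemma conv_integrand_integrable:
  fixes b u :: "real \<Rightarrow> complex"
  assumes "continuous_on {0..} b" "continuous_on {0..} u"
  shows "(\<lambda>s. b (t - s) * u s) integrable_on {0..t}"
  by (intro integrable_continuous_real continuous_on_conv_integrand assms)

text \<open>Scaling the interval of integration to \<open>[0, 1]\<close> moves \<open>t\<close> into the integrand. Continuity in
  \<open>t\<close>, and later the difference quotient at \<open>t = 0\<close>, then follow from continuity of parameter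
  integrals.\<close>

lemma conv_rescaled:
  assumes "t \<ge> 0"
  shows "conv b u t = of_real t * integral {0..1} (\<lambda>x. b (t - t * x) * u (t * x))"
proof (cases "t = 0")
  case False
  have "(\<lambda>x. x / t) ` {0..t} = {0..1}"
    using assms False by (auto simp: image_iff intro!: bexI[of _ "t * _"] mult_left_le)
  then show ?thesis
    using integral_stretch_real[of t 0 t "\<lambda>s. b (t - s) * u s"] assms False
    by (simp add: conv_def scaleR_conv_of_real)
qed simp

lemma continuous_on_conv:
  assumes b: "continuous_on {0..} b" and u: "continuous_on {0..} u"
  shows "continuous_on {0..} (conv b u)"
proof -
  have "continuous_on ({0..} \<times> cbox 0 (1::real)) (\<lambda>(t, x). b (t - t * x) * u (t * x))"
    unfolding case_prod_beta
    by (intro continuous_intros continuous_on_compose2[OF b] continuous_on_compose2[OF u])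
       (auto simp: mult_left_le)
  from integral_continuous_on_param[OF this]
  have "continuous_on {0..} (\<lambda>t. of_real t * integral {0..1} (\<lambda>x. b (t - t * x) * u (t * x)))"
    by (intro continuous_intros) auto
  then show ?thesis
    by (rule continuous_on_cong[THEN iffD1, rotated 2]) (auto simp: conv_rescaled)
qed

lemma conv_cong:
  assumes "\<And>s. 0 \<le> s \<Longrightarrow> s \<le> t \<Longrightarrow> b s = b' s" "\<And>s. 0 \<le> s \<Longrightarrow> s \<le> t \<Longrightarrow> u s = u' s"
  shows "conv b u t = conv b' u' t"
  unfolding conv_def using assms by (intro integral_cong) auto

lemma conv_linear:
  assumes "continuous_on {0..} b" "continuous_on {0..} u" "continuous_on {0..} v"
  shows "conv b (\<lambda>s. p * u s + q * v s) t = p * conv b u t + q * conv b v t"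
proof -
  have "conv b (\<lambda>s. p * u s + q * v s) t =
      integral {0..t} (\<lambda>s. p * (b (t - s) * u s) + q * (b (t - s) * v s))"
    unfolding conv_def by (intro integral_cong) (simp add: algebra_simps)
  also have "\<dots> = p * conv b u t + q * conv b v t"
    unfolding conv_def
    by (subst integral_add)
       (auto intro!: integrable_on_mult_right conv_integrand_integrable assms)
  finally show ?thesis .
qed

text \<open>Integrating \<open>exp(c s)\<close> gains a factor \<open>1 / c\<close>. Hence convolution is a contraction in the
  norm \<open>sup exp(-c t) |u(t)|\<close> once \<open>c\<close> is large.\<close>

lemma conv_exp_bound:
  assumes b: "continuous_on {0..} b" and u: "continuous_on {0..} u"
    and b\<beta>: "\<And>s. s \<ge> 0 \<Longrightarrow> cmod (b s) \<le> \<beta>"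
    and um: "\<And>s. 0 \<le> s \<Longrightarrow> s \<le> t \<Longrightarrow> cmod (u s) \<le> m * exp (c * s)"
    and "c > 0" "m \<ge> 0" "t \<ge> 0"
  shows "cmod (conv b u t) \<le> \<beta> * (m * exp (c * t) / c)"
proof -
  have \<beta>: "\<beta> \<ge> 0" using order_trans[OF norm_ge_zero b\<beta>[of 0]] by simp
  have int: "((\<lambda>s. \<beta> * (m * exp (c * s))) has_integral
      (\<beta> * (m * exp (c * t) / c) - \<beta> * (m * exp (c * 0) / c))) {0..t}"
    by (intro fundamental_theorem_of_calculus)
       (use \<open>c > 0\<close> \<open>t \<ge> 0\<close> in \<open>auto intro!: derivative_eq_intros
          simp: has_real_derivative_iff_has_vector_derivative[symmetric]\<close>)
  have "cmod (conv b u t) \<le> integral {0..t} (\<lambda>s. \<beta> * (m * exp (c * s)))"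
    unfolding conv_def
  proof (rule integral_norm_bound_integral)
    fix s assume s: "s \<in> {0..t}"
    have "cmod (b (t - s)) * cmod (u s) \<le> \<beta> * (m * exp (c * s))"
      using s \<beta> by (intro mult_mono b\<beta> um) auto
    then show "cmod (b (t - s) * u s) \<le> \<beta> * (m * exp (c * s))"
      by (simp add: norm_mult)
  qed (use int in \<open>auto intro!: conv_integrand_integrable b u simp: has_integral_iff\<close>)
  also have "\<dots> = \<beta> * (m * exp (c * t) / c) - \<beta> * (m / c)"
    using int by (simp add: has_integral_iff)
  also have "\<dots> \<le> \<beta> * (m * exp (c * t) / c)"
    using \<open>m \<ge> 0\<close> \<open>c > 0\<close> \<beta> by simp
  finally show ?thesis .
qed

text \<open>With the rate \<open>c = 2 |\<kappa>| + 1\<close> the convolution term costs at most half of the weighted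
  supremum of \<open>u\<close>, which can be absorbed on the left. The case \<open>A = 0\<close> is uniqueness.\<close>

lemma volterra_bound:
  fixes \<kappa> :: complex
  assumes k: "continuous_on {0..} k" and k1: "\<And>s. s \<ge> 0 \<Longrightarrow> cmod (k s) \<le> 1"
    and u: "continuous_on {0..} u"
    and A: "\<And>s. 0 \<le> s \<Longrightarrow> s \<le> t \<Longrightarrow> cmod (u s - \<kappa> * conv k u s) \<le> A"
    and t: "t \<ge> 0"
  shows "cmod (u t) \<le> 2 * A * exp ((2 * cmod \<kappa> + 1) * t)"
proof -
  define c where "c = 2 * cmod \<kappa> + 1"
  have c: "c > 0" and c2: "cmod \<kappa> / c \<le> 1 / 2"
    by (auto simp: c_def field_simps add_pos_nonneg)
  have "continuous_on {0..t} u"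
    using u by (rule continuous_on_subset) auto
  \<comment> \<open>The maximum of the weighted modulus on \<open>[0, t]\<close> is attained at some \<open>x\<close>; the
    equation is then read at \<open>x\<close>.\<close>
  then have "continuous_on {0..t} (\<lambda>s. exp (- c * s) * cmod (u s))"
    by (intro continuous_intros)
  from continuous_attains_sup[OF _ _ this] t
  obtain x where x: "x \<in> {0..t}"
    and max: "\<And>s. s \<in> {0..t} \<Longrightarrow> exp (- c * s) * cmod (u s) \<le> exp (- c * x) * cmod (u x)"
    by auto
  define m where "m = exp (- c * x) * cmod (u x)"
  have um: "cmod (u s) \<le> m * exp (c * s)" if "0 \<le> s" "s \<le> t" for s
    using max[of s] that by (simp add: m_def exp_minus field_simps)
  have "cmod (conv k u x) \<le> m * exp (c * x) / c"
    using x um c by (intro conv_exp_bound[where \<beta> = 1, simplified] k u k1) (auto simp: m_def)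
  then have "cmod \<kappa> * cmod (conv k u x) \<le> cmod \<kappa> * (m * exp (c * x) / c)"
    by (rule mult_left_mono) simp
  also have "\<dots> = (cmod \<kappa> / c) * (m * exp (c * x))" by simp
  also have "\<dots> \<le> (1 / 2) * (m * exp (c * x))"
    by (rule mult_right_mono[OF c2]) (simp add: m_def)
  also have "\<dots> = cmod (u x) / 2"
    by (simp add: m_def exp_minus)
  finally have "cmod (\<kappa> * conv k u x) \<le> cmod (u x) / 2"
    by (simp add: norm_mult)
  moreover have "cmod (u x) \<le> cmod (u x - \<kappa> * conv k u x) + cmod (\<kappa> * conv k u x)"
    by norm
  moreover have A': "cmod (u x - \<kappa> * conv k u x) \<le> A" using A x by auto
  ultimately have ux: "cmod (u x) \<le> 2 * A" by linarith
  have "A \<ge> 0" using A' norm_ge_zero order_trans by blast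
  have "m \<le> 1 * (2 * A)"
    unfolding m_def by (intro mult_mono ux) (use c x in auto)
  then have "m * exp (c * t) \<le> 2 * A * exp (c * t)" by (intro mult_right_mono) auto
  with um[of t] t have "cmod (u t) \<le> 2 * A * exp (c * t)" by linarith
  then show ?thesis by (simp only: c_def)
qed

lemma volterra_unique:
  fixes \<kappa> :: complex
  assumes k: "continuous_on {0..} k" and k1: "\<And>s. s \<ge> 0 \<Longrightarrow> cmod (k s) \<le> 1"
    and u: "continuous_on {0..} u" and v: "continuous_on {0..} v"
    and ueq: "\<And>s. s \<ge> 0 \<Longrightarrow> u s = a s + \<kappa> * conv k u s"
    and veq: "\<And>s. s \<ge> 0 \<Longrightarrow> v s = a s + \<kappa> * conv k v s"
    and t: "t \<ge> 0"
  shows "u t = v t"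
proof -
  have lin: "conv k (\<lambda>s. u s - v s) s = conv k u s - conv k v s" for s
    using conv_linear[OF k u v, of 1 "-1"] by simp
  have "cmod (u t - v t) \<le> 2 * 0 * exp ((2 * cmod \<kappa> + 1) * t)"
  proof (rule volterra_bound[OF k k1])
    fix s :: real assume "0 \<le> s"
    then show "cmod (u s - v s - \<kappa> * conv k (\<lambda>s. u s - v s) s) \<le> 0"
      using ueq[of s] veq[of s] by (simp add: lin algebra_simps)
  qed (use u v t in \<open>auto intro!: continuous_intros\<close>)
  then show ?thesis by simp
qed

text \<open>The solution is \<open>exp(c t) v(t)\<close>, where \<open>v\<close> is the fixed point of a contraction of the
  complete space of bounded continuous functions.\<close>

lemma volterra_exists:
  fixes \<kappa> :: complex
  assumes k: "continuous_on {0..} k" and k1: "\<And>s. s \<ge> 0 \<Longrightarrow> cmod (k s) \<le> 1"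
    and a: "continuous_on {0..} a" and aA: "\<And>s. s \<ge> 0 \<Longrightarrow> cmod (a s) \<le> A"
  obtains u where "continuous_on {0..} u" "\<And>t. t \<ge> 0 \<Longrightarrow> u t = a t + \<kappa> * conv k u t"
proof -
  define c where "c = 2 * cmod \<kappa> + 1"
  have c: "c > 0" and c2: "cmod \<kappa> / c \<le> 1 / 2"
    by (auto simp: c_def field_simps add_pos_nonneg)
  define w :: "(real \<Rightarrow>\<^sub>C complex) \<Rightarrow> real \<Rightarrow> complex" where
    "w v s = exp (of_real (c * s)) * apply_bcontfun v s" for v s
  \<comment> \<open>The equation for \<open>v = exp(-c t) u\<close>. As \<open>v\<close> lives on the whole line, the right-hand
    side is extended to negative times by its value at \<open>0\<close>.\<close>
  define F where "F v t = exp (of_real (- c * t)) * (a t + \<kappa> * conv k (w v) t)" for v t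
  have w: "continuous_on {0..} (w v)" for v
    unfolding w_def by (intro continuous_intros) auto
  have conv_bd: "cmod (exp (of_real (- c * t)) * (\<kappa> * conv k z t)) \<le> m / 2"
    if "continuous_on {0..} z" "\<And>s. s \<ge> 0 \<Longrightarrow> cmod (z s) \<le> m * exp (c * s)" "m \<ge> 0" "t \<ge> 0" for z m t
  proof -
    have "cmod (conv k z t) \<le> m * exp (c * t) / c"
      by (intro conv_exp_bound[where \<beta> = 1, simplified] k k1) (use that c in auto)
    then have "exp (- c * t) * (cmod \<kappa> * cmod (conv k z t)) \<le> exp (- c * t) * (cmod \<kappa> * (m * exp (c * t) / c))"
      by (intro mult_left_mono) auto
    also have "\<dots> = (cmod \<kappa> / c) * m" by (simp add: exp_minus)
    also have "\<dots> \<le> (1 / 2) * m" by (rule mult_right_mono[OF c2 \<open>m \<ge> 0\<close>])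
    finally show ?thesis by (simp add: norm_mult)
  qed
  have F_bd: "(\<lambda>t. F v (max 0 t)) \<in> bcontfun" for v
  proof -
    have "continuous_on {0..} (F v)"
      unfolding F_def by (intro continuous_intros a continuous_on_conv k w)
    then have "continuous_on UNIV (\<lambda>t. F v (max 0 t))"
      by (rule continuous_on_compose2) (auto intro!: continuous_intros)
    moreover obtain m where m: "\<And>s. cmod (apply_bcontfun v s) \<le> m"
      using bounded_apply_bcontfun[of v] by (auto simp: bounded_iff)
    have "cmod (F v t) \<le> A + m / 2" if "t \<ge> 0" for t
    proof -
      have "cmod (exp (of_real (- c * t)) * a t) \<le> 1 * A"
        unfolding norm_mult using that c by (intro mult_mono aA) auto
      moreover have "cmod (exp (of_real (- c * t)) * (\<kappa> * conv k (w v) t)) \<le> m / 2"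
        using m order_trans[OF norm_ge_zero m]
        by (intro conv_bd w that) (auto simp: w_def norm_mult)
      ultimately show ?thesis
        unfolding F_def distrib_left by (intro order_trans[OF norm_triangle_ineq]) simp
    qed
    then have "bounded (range (\<lambda>t. F v (max 0 t)))"
      by (auto simp: bounded_iff intro!: exI[of _ "A + m / 2"])
    ultimately show ?thesis by (simp add: bcontfun_def)
  qed
  define T where "T v = Bcontfun (\<lambda>t. F v (max 0 t))" for v
  have T: "apply_bcontfun (T v) t = F v (max 0 t)" for v t
    unfolding T_def using F_bd by (simp add: Bcontfun_inverse)
  have "dist (T v) (T v') \<le> (1 / 2) * dist v v'" for v v'
  proof (rule dist_bound)
    fix t :: real
    define r where "r = max 0 t"
    have "conv k (\<lambda>s. w v s - w v' s) r = conv k (w v) r - conv k (w v') r"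
      using conv_linear[OF k w w, of 1 v "-1" v'] by simp
    then have "F v r - F v' r = exp (of_real (- c * r)) * (\<kappa> * conv k (\<lambda>s. w v s - w v' s) r)"
      by (simp only: F_def) (simp add: algebra_simps)
    moreover have "cmod (exp (of_real (- c * r)) * (\<kappa> * conv k (\<lambda>s. w v s - w v' s) r)) \<le> dist v v' / 2"
    proof (rule conv_bd)
      fix s :: real
      have "cmod (w v s - w v' s) = exp (c * s) * dist (apply_bcontfun v s) (apply_bcontfun v' s)"
        unfolding w_def right_diff_distrib[symmetric] norm_mult dist_norm by simp
      also have "\<dots> \<le> exp (c * s) * dist v v'"
        by (intro mult_left_mono dist_bounded) auto
      finally show "cmod (w v s - w v' s) \<le> dist v v' * exp (c * s)" by (simp add: mult.commute)
    qed (auto intro!: continuous_intros w simp: r_def)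
    ultimately show "dist (apply_bcontfun (T v) t) (apply_bcontfun (T v') t) \<le> (1 / 2) * dist v v'"
      by (simp add: T dist_norm r_def)
  qed
  then obtain v where v: "T v = v"
    using banach_fix_type[of "1/2" T] by auto
  show thesis
  proof (rule that[of "w v"])
    fix t :: real assume "t \<ge> 0"
    then have "apply_bcontfun v t = F v t" using T[of v t] v by simp
    then show "w v t = a t + \<kappa> * conv k (w v) t"
      by (simp add: w_def[of v t] F_def exp_minus)
  qed (rule w)
qed

section \<open>Square-integrable functions\<close>

lemmas integrable_by_bound = Bochner_Integration.integrable_bound
lemmas lebesgue_integral_cong = Bochner_Integration.integral_cong[OF refl]

text \<open>This inequality takes the place of the triangle inequality in \<open>L\<^sup>2\<close>: it suffices for all
  limit arguments and for boundedness of operators.\<close>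

lemma norm_add_power2_le: "(cmod (x + y))^2 \<le> 2 * (cmod x)^2 + 2 * (cmod y)^2"
proof -
  have "(cmod (x + y))^2 \<le> (cmod x + cmod y)^2"
    by (intro power_mono norm_triangle_ineq norm_ge_zero)
  also have "\<dots> \<le> 2 * (cmod x)^2 + 2 * (cmod y)^2"
    using sum_squares_ge_zero[of "cmod x - cmod y" 0] by (simp add: power2_eq_square algebra_simps)
  finally show ?thesis .
qed

lemma L2_measurable: "\<phi> \<in> L2 M \<Longrightarrow> \<phi> \<in> borel_measurable M"
  by (simp add: L2_def)

lemma L2_integrable_square: "\<phi> \<in> L2 M \<Longrightarrow> integrable M (\<lambda>x. (cmod (\<phi> x))^2)"
  by (simp add: L2_def)

lemma L2_dominated:
  assumes [measurable]: "f \<in> borel_measurable M" and "\<phi> \<in> L2 M"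
    and "\<And>x. cmod (f x) \<le> B * cmod (\<phi> x)"
  shows "f \<in> L2 M"
proof -
  have "(cmod (f x))^2 \<le> B^2 * (cmod (\<phi> x))^2" for x
    using power_mono[OF assms(3)[of x] norm_ge_zero, of 2] by (simp add: power_mult_distrib)
  then have "integrable M (\<lambda>x. (cmod (f x))^2)"
    by (intro integrable_by_bound[OF
          integrable_mult_right[OF L2_integrable_square[OF assms(2)], of "B^2"]] AE_I2) simp_all
  then show ?thesis by (simp add: L2_def)
qed

lemma L2_add:
  assumes "\<phi> \<in> L2 M" "\<psi> \<in> L2 M"
  shows "(\<lambda>x. \<phi> x + \<psi> x) \<in> L2 M"
proof -
  have [measurable]: "\<phi> \<in> borel_measurable M" "\<psi> \<in> borel_measurable M"
    using assms by (auto simp: L2_def)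
  have "integrable M (\<lambda>x. (cmod (\<phi> x + \<psi> x))^2)"
    by (rule integrable_by_bound[where f = "\<lambda>x. 2 * (cmod (\<phi> x))^2 + 2 * (cmod (\<psi> x))^2"])
       (use assms in \<open>auto intro!: L2_integrable_square norm_add_power2_le\<close>)
  then show ?thesis by (simp add: L2_def)
qed

lemma L2_cmult: "\<phi> \<in> L2 M \<Longrightarrow> (\<lambda>x. a * \<phi> x) \<in> L2 M"
  by (rule L2_dominated[where B = "cmod a" and \<phi> = \<phi>]) (auto simp: norm_mult L2_def)

lemma L2_diff: "\<phi> \<in> L2 M \<Longrightarrow> \<psi> \<in> L2 M \<Longrightarrow> (\<lambda>x. \<phi> x - \<psi> x) \<in> L2 M"
  using L2_add[OF _ L2_cmult[of \<psi> M "-1"], of \<phi>] by simp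

lemma L2_norm_power2: "(L2_norm M \<phi>)^2 = (LINT x|M. (cmod (\<phi> x))^2)"
  by (simp add: L2_norm_def)

lemma L2_norm_nonneg [simp]: "0 \<le> L2_norm M \<phi>"
  by (simp add: L2_norm_def)

lemma L2_norm_add_power2_le:
  assumes "\<phi> \<in> L2 M" "\<psi> \<in> L2 M"
  shows "(L2_norm M (\<lambda>x. \<phi> x + \<psi> x))^2 \<le> 2 * (L2_norm M \<phi>)^2 + 2 * (L2_norm M \<psi>)^2"
proof -
  have "(LINT x|M. (cmod (\<phi> x + \<psi> x))^2) \<le> (LINT x|M. 2 * (cmod (\<phi> x))^2 + 2 * (cmod (\<psi> x))^2)"
    using assms
    by (intro integral_mono norm_add_power2_le L2_integrable_square L2_add Bochner_Integration.integrable_add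
        integrable_mult_right)
  also have "\<dots> = 2 * (LINT x|M. (cmod (\<phi> x))^2) + 2 * (LINT x|M. (cmod (\<psi> x))^2)"
    using assms by (subst Bochner_Integration.integral_add) (auto intro!: L2_integrable_square)
  finally show ?thesis by (simp add: L2_norm_power2)
qed

lemma L2_norm_cmult: "L2_norm M (\<lambda>x. a * \<phi> x) = cmod a * L2_norm M \<phi>"
  by (simp add: L2_norm_def norm_mult power_mult_distrib real_sqrt_mult)

lemma tendsto_L2_norm_zero_iff:
  "((\<lambda>t. L2_norm M (F t)) \<longlongrightarrow> 0) A \<longleftrightarrow> ((\<lambda>t. (L2_norm M (F t))^2) \<longlongrightarrow> 0) A"
proof
  assume "((\<lambda>t. (L2_norm M (F t))^2) \<longlongrightarrow> 0) A"
  from tendsto_real_sqrt[OF this] show "((\<lambda>t. L2_norm M (F t)) \<longlongrightarrow> 0) A"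
    by (simp add: real_sqrt_abs)
qed (use tendsto_power[of "\<lambda>t. L2_norm M (F t)" 0 A 2] in simp)

lemma tendsto_L2_norm_add_zero:
  assumes "\<forall>\<^sub>F t in A. F t \<in> L2 M" "\<forall>\<^sub>F t in A. R t \<in> L2 M"
    and "((\<lambda>t. L2_norm M (F t)) \<longlongrightarrow> 0) A" "((\<lambda>t. L2_norm M (R t)) \<longlongrightarrow> 0) A"
  shows "((\<lambda>t. L2_norm M (\<lambda>x. F t x + R t x)) \<longlongrightarrow> 0) A"
  unfolding tendsto_L2_norm_zero_iff
proof (rule tendsto_sandwich[OF _ _ tendsto_const])
  show "((\<lambda>t. 2 * (L2_norm M (F t))^2 + 2 * (L2_norm M (R t))^2) \<longlongrightarrow> 0) A"
    using assms(3,4) by (auto intro!: tendsto_eq_intros)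
  show "\<forall>\<^sub>F t in A. (L2_norm M (\<lambda>x. F t x + R t x))^2 \<le> 2 * (L2_norm M (F t))^2 + 2 * (L2_norm M (R t))^2"
    using assms(1,2) by eventually_elim (rule L2_norm_add_power2_le)
qed auto

lemma tendsto_L2_norm_perturb:
  assumes F: "\<forall>\<^sub>F t in A. F t \<in> L2 M" and R: "\<forall>\<^sub>F t in A. R t \<in> L2 M"
    and R0: "((\<lambda>t. L2_norm M (R t)) \<longlongrightarrow> 0) A"
  shows "((\<lambda>t. L2_norm M (\<lambda>x. F t x + R t x)) \<longlongrightarrow> 0) A \<longleftrightarrow> ((\<lambda>t. L2_norm M (F t)) \<longlongrightarrow> 0) A"
proof
  assume FR: "((\<lambda>t. L2_norm M (\<lambda>x. F t x + R t x)) \<longlongrightarrow> 0) A"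
  have "((\<lambda>t. L2_norm M (\<lambda>x. (F t x + R t x) + - 1 * R t x)) \<longlongrightarrow> 0) A"
  proof (rule tendsto_L2_norm_add_zero[OF _ _ FR])
    show "\<forall>\<^sub>F t in A. (\<lambda>x. F t x + R t x) \<in> L2 M" using F R by eventually_elim (rule L2_add)
    show "\<forall>\<^sub>F t in A. (\<lambda>x. - 1 * R t x) \<in> L2 M" using R by eventually_elim (rule L2_cmult)
    show "((\<lambda>t. L2_norm M (\<lambda>x. - 1 * R t x)) \<longlongrightarrow> 0) A" using R0 by (simp only: L2_norm_cmult) simp
  qed
  then show "((\<lambda>t. L2_norm M (F t)) \<longlongrightarrow> 0) A" by simp
qed (rule tendsto_L2_norm_add_zero[OF F R _ R0])

lemma tendsto_L2_norm_zero_dominated: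
  fixes F :: "real \<Rightarrow> 'a \<Rightarrow> complex"
  assumes meas: "\<And>t. t > 0 \<Longrightarrow> F t \<in> borel_measurable M"
    and w: "integrable M (\<lambda>x. (w x)^2)"
    and lim: "\<And>x. ((\<lambda>t. F t x) \<longlongrightarrow> 0) (at_right 0)"
    and bound: "\<And>t x. 0 < t \<Longrightarrow> t < 1 \<Longrightarrow> cmod (F t x) \<le> w x"
  shows "((\<lambda>t. L2_norm M (F t)) \<longlongrightarrow> 0) (at_right 0)"
  unfolding tendsto_L2_norm_zero_iff L2_norm_power2
proof (rule tendsto_at_right_sequentially[where b = 1])
  fix X :: "nat \<Rightarrow> real" assume X: "\<And>n. 0 < X n" "\<And>n. X n < 1" "X \<longlonglongrightarrow> 0"
  note [measurable] = meas[OF X(1)]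
  have "(\<lambda>n. LINT x|M. (cmod (F (X n) x))^2) \<longlonglongrightarrow> (LINT x|M. 0)"
  proof (rule integral_dominated_convergence[OF _ _ w])
    have "filterlim X (at_right 0) sequentially"
      using X by (intro tendsto_imp_filterlim_at_right) auto
    then have "(\<lambda>n. F (X n) x) \<longlonglongrightarrow> 0" for x
      using lim[of x] by (rule filterlim_compose[rotated])
    then have "(\<lambda>n. (cmod (F (X n) x))^2) \<longlonglongrightarrow> 0" for x
      by (auto intro!: tendsto_eq_intros)
    then show "AE x in M. (\<lambda>n. (cmod (F (X n) x))^2) \<longlonglongrightarrow> 0" by simp
    show "AE x in M. norm ((cmod (F (X n) x))^2) \<le> (w x)^2" for n
      using bound[OF X(1,2)] by (auto intro!: power_mono)
  qed measurable
  then show "(\<lambda>n. LINT x|M. (cmod (F (X n) x))^2) \<longlonglongrightarrow> 0" by simp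
qed auto

text \<open>Fatou's lemma along \<open>t = 1 / n\<close>: a limit in \<open>L\<^sup>2\<close> agrees with the pointwise limit. This
  forces elements of the domain of the generator to be of the expected form.\<close>

lemma L2_limit_AE_unique:
  fixes F :: "real \<Rightarrow> 'a \<Rightarrow> complex"
  assumes L2: "\<And>t. t > 0 \<Longrightarrow> F t \<in> L2 M"
    and L2lim: "((\<lambda>t. L2_norm M (F t)) \<longlongrightarrow> 0) (at_right 0)"
    and lim: "\<And>x. ((\<lambda>t. F t x) \<longlongrightarrow> l x) (at_right 0)"
  shows "AE x in M. l x = 0"
proof -
  define X :: "nat \<Rightarrow> real" where "X n = 1 / real (Suc n)" for n
  have X: "X n > 0" for n by (simp add: X_def)
  have Xlim: "filterlim X (at_right 0) sequentially"
    using LIMSEQ_Suc[OF lim_1_over_n] X unfolding X_def[abs_def]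
    by (intro tendsto_imp_filterlim_at_right) auto
  have [measurable]: "F (X n) \<in> borel_measurable M" for n
    using L2[OF X] by (simp add: L2_def)
  have lX: "(\<lambda>n. F (X n) x) \<longlonglongrightarrow> l x" for x
    using lim Xlim by (rule filterlim_compose)
  have [measurable]: "l \<in> borel_measurable M"
    by (rule borel_measurable_LIMSEQ_metric[of "\<lambda>n. F (X n)"]) (use lX in auto)
  have e: "(\<integral>\<^sup>+x. ennreal ((cmod (F (X n) x))^2) \<partial>M) = ennreal ((L2_norm M (F (X n)))^2)" for n
    unfolding L2_norm_power2 by (intro nn_integral_eq_integral L2_integrable_square L2 X) auto
  have "(\<lambda>n. (L2_norm M (F (X n)))^2) \<longlonglongrightarrow> 0"
    using filterlim_compose[OF L2lim Xlim] by (rule tendsto_L2_norm_zero_iff[THEN iffD1])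
  then have "(\<lambda>n. ennreal ((L2_norm M (F (X n)))^2)) \<longlonglongrightarrow> ennreal 0"
    by (rule tendsto_ennrealI)
  then have "liminf (\<lambda>n. \<integral>\<^sup>+x. ennreal ((cmod (F (X n) x))^2) \<partial>M) = 0"
    unfolding e using lim_imp_Liminf[OF sequentially_bot] by fastforce
  moreover have "(\<integral>\<^sup>+x. ennreal ((cmod (l x))^2) \<partial>M) = (\<integral>\<^sup>+x. liminf (\<lambda>n. ennreal ((cmod (F (X n) x))^2)) \<partial>M)"
    by (intro nn_integral_cong lim_imp_Liminf[symmetric] tendsto_ennrealI tendsto_intros lX) simp
  moreover have "\<dots> \<le> liminf (\<lambda>n. \<integral>\<^sup>+x. ennreal ((cmod (F (X n) x))^2) \<partial>M)"
    by (rule nn_integral_liminf) simp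
  ultimately have "(\<integral>\<^sup>+x. ennreal ((cmod (l x))^2) \<partial>M) = 0" by simp
  then have "AE x in M. ennreal ((cmod (l x))^2) = 0"
    by (subst (asm) nn_integral_0_iff_AE) auto
  then show ?thesis by eventually_elim simp
qed

lemma (in finite_measure) L2_bounded:
  assumes "\<phi> \<in> borel_measurable M" "\<And>x. cmod (\<phi> x) \<le> B"
  shows "\<phi> \<in> L2 M"
proof -
  have "(\<lambda>x. 1) \<in> L2 M" by (simp add: L2_def)
  then show ?thesis by (rule L2_dominated[OF assms(1), where B = B]) (use assms(2) in simp)
qed

lemma (in prob_space) L2_integrable:
  assumes "\<phi> \<in> L2 M" shows "integrable M \<phi>"
proof (rule integrable_by_bound[where f = "\<lambda>x. 1 + (cmod (\<phi> x))^2"])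
  show "AE x in M. cmod (\<phi> x) \<le> norm (1 + (cmod (\<phi> x))^2)"
  proof (rule AE_I2)
    fix x
    have "cmod (\<phi> x) \<le> 1 + (cmod (\<phi> x))^2"
      using zero_le_power2[of "cmod (\<phi> x) - 1"] norm_ge_zero[of "\<phi> x"]
      unfolding power2_diff one_power2 by linarith
    then show "cmod (\<phi> x) \<le> norm (1 + (cmod (\<phi> x))^2)" by simp
  qed
qed (use assms in \<open>auto simp: L2_def\<close>)

lemma (in prob_space) integral_norm_le_L2_norm:
  assumes "\<phi> \<in> L2 M" shows "(LINT x|M. cmod (\<phi> x)) \<le> L2_norm M \<phi>"
proof -
  have "0 \<le> variance (\<lambda>x. cmod (\<phi> x))" by (rule variance_positive)
  also have "\<dots> = (LINT x|M. (cmod (\<phi> x))^2) - (LINT x|M. cmod (\<phi> x))^2"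
    using assms L2_integrable[OF assms] by (intro variance_eq) (auto simp: L2_def)
  finally show ?thesis unfolding L2_norm_def by (intro real_le_rsqrt) simp
qed

section \<open>The flow of multiplication by the frequency plus a rank-one operator\<close>

text \<open>The past before time \<open>s\<close> enters as a forcing term for the evolution restarted at time \<open>s\<close>.
  This identity is the source of the semigroup law.\<close>

lemma conv_split:
  assumes b: "continuous_on {0..} b" and u: "continuous_on {0..} u" and "s \<ge> 0" "t \<ge> 0"
  shows "conv b u (s + t) = conv (\<lambda>r. b (t + r)) u s + conv b (\<lambda>r. u (s + r)) t"
proof -
  let ?f = "\<lambda>r. b (s + t - r) * u r"
  have "conv b u (s + t) = integral {0..s} ?f + integral {s..s + t} ?f"
    unfolding conv_def
    by (rule Henstock_Kurzweil_Integration.integral_combine[symmetric])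
       (use assms in \<open>auto intro!: conv_integrand_integrable\<close>)
  also have "integral {s..s + t} ?f = integral {0..t} (\<lambda>r. ?f (r + s))"
    using integral_shift_real_ivl[of s s "s + t" ?f] by simp
  finally show ?thesis
    by (simp add: conv_def algebra_simps)
qed

lemma conv_cmult_left: "conv (\<lambda>s. a * b s) u t = a * conv b u t"
  by (simp add: conv_def mult.assoc)

lemma set_integrable_conv_integrand:
  fixes b u :: "real \<Rightarrow> complex"
  assumes "continuous_on {0..} b" "continuous_on {0..} u"
  shows "set_integrable lborel {0..t} (\<lambda>s. b (t - s) * u s)"
  by (rule borel_integrable_atLeastAtMost'[OF continuous_on_conv_integrand[OF assms]])

lemma conv_eq_lebesgue:
  assumes "continuous_on {0..} b" "continuous_on {0..} u"
  shows "conv b u t = (LINT s|lborel. b (t - s) * (indicator {0..t} s *\<^sub>R u s))"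
  using set_borel_integral_eq_integral(2)[OF set_integrable_conv_integrand[OF assms, of t]]
  by (simp add: conv_def set_lebesgue_integral_def)

definition fourier :: "real measure \<Rightarrow> (real \<Rightarrow> complex) \<Rightarrow> real \<Rightarrow> complex" where
  "fourier M p t = (CLINT \<omega>|M. iexp (t * \<omega>) * p \<omega>)"

text \<open>The solution of the Volterra equation is unique on \<open>[0, \<infinity>)\<close>; at negative times the chosen
  function is arbitrary.\<close>

definition order_parameter :: "real measure \<Rightarrow> complex \<Rightarrow> (real \<Rightarrow> complex) \<Rightarrow> real \<Rightarrow> complex" where
  "order_parameter M \<kappa> \<phi> = (SOME u. continuous_on {0..} u \<and>
     (\<forall>t\<ge>0. u t = fourier M \<phi> t + \<kappa> * conv (char M) u t))"

abbreviation drive :: "real measure \<Rightarrow> complex \<Rightarrow> (real \<Rightarrow> complex) \<Rightarrow> real \<Rightarrow> real \<Rightarrow> complex" where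
  "drive M \<kappa> \<phi> t \<omega> \<equiv> conv (\<lambda>s. iexp (s * \<omega>)) (order_parameter M \<kappa> \<phi>) t"

text \<open>Duhamel's formula for \<open>exp(t T)\<close> with \<open>T = i \<omega> + \<kappa> P\<close>: the value of \<open>P\<close> along the evolution
  is the scalar \<open>order_parameter\<close>.\<close>

definition flow :: "real measure \<Rightarrow> complex \<Rightarrow> real \<Rightarrow> (real \<Rightarrow> complex) \<Rightarrow> real \<Rightarrow> complex" where
  "flow M \<kappa> t \<phi> \<omega> =
     iexp (t * \<omega>) * \<phi> \<omega> + \<kappa> * drive M \<kappa> \<phi> t \<omega>"

definition mean_field_op :: "real measure \<Rightarrow> complex \<Rightarrow> (real \<Rightarrow> complex) \<Rightarrow> real \<Rightarrow> complex" where
  "mean_field_op M \<kappa> \<phi> \<omega> = \<i> * of_real \<omega> * \<phi> \<omega> + \<kappa> * (CLINT \<omega>'|M. \<phi> \<omega>')"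

lemma continuous_on_iexp_mult: "continuous_on A (\<lambda>s. iexp (s * \<omega>))"
  by (intro continuous_intros)

lemma integrable_iexp_mult:
  assumes [measurable_cong]: "sets M = sets borel" and p: "integrable M p"
  shows "integrable M (\<lambda>\<omega>. iexp (t * \<omega>) * p \<omega>)"
  by (rule integrable_by_bound[OF p]) (use p in \<open>auto simp: norm_mult\<close>)

lemma norm_fourier_le:
  assumes "sets M = sets borel" "integrable M p"
  shows "cmod (fourier M p t) \<le> (LINT \<omega>|M. cmod (p \<omega>))"
proof -
  have "cmod (fourier M p t) \<le> (LINT \<omega>|M. cmod (iexp (t * \<omega>) * p \<omega>))"
    unfolding fourier_def by (rule integral_norm_bound)
  then show ?thesis by (simp add: norm_mult)
qed

lemma continuous_on_fourier:
  assumes [measurable_cong]: "sets M = sets borel" and p: "integrable M p"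
  shows "continuous_on A (fourier M p)"
proof -
  have [measurable]: "p \<in> borel_measurable M" using p by auto
  have "isCont (fourier M p) t" for t
    unfolding continuous_at_sequentially
  proof safe
    fix X assume X: "X \<longlonglongrightarrow> t"
    show "(fourier M p \<circ> X) \<longlonglongrightarrow> fourier M p t"
      unfolding comp_def fourier_def
      by (rule integral_dominated_convergence[where w="\<lambda>\<omega>. cmod (p \<omega>)"])
         (use p in \<open>auto intro!: tendsto_intros X simp: norm_mult\<close>)
  qed
  then show ?thesis by (intro continuous_at_imp_continuous_on) auto
qed

context real_distribution
begin

lemma fourier_one: "fourier M (\<lambda>\<omega>. 1) = char M"
  by (simp add: fourier_def char_def fun_eq_iff)

lemma continuous_on_char: "continuous_on A (char M)"
  by (intro continuous_at_imp_continuous_on) (auto simp: isCont_char)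

text \<open>Fubini turns a mean over frequencies of the Duhamel integral into a convolution with a
  Fourier transform.\<close>

lemma integral_conv_exchange:
  assumes p: "integrable M p" and u: "continuous_on {0..} u"
  shows "(CLINT \<omega>|M. p \<omega> * conv (\<lambda>s. iexp (s * \<omega>)) u t) = conv (fourier M p) u t"
proof -
  \<comment> \<open>The cut-off function \<open>U\<close> is measurable on the whole line, although \<open>u\<close> is only
    known to be continuous on \<open>[0, \<infinity>)\<close>.\<close>
  interpret P: pair_sigma_finite M lborel ..
  define U where "U s = indicator {0..t} s *\<^sub>R u s" for s
  have cu: "continuous_on {0..t} u" using u by (rule continuous_on_subset) auto
  have U_int: "integrable lborel U"
    using borel_integrable_atLeastAtMost'[OF cu] unfolding U_def set_integrable_def .
  then have [measurable]: "U \<in> borel_measurable borel" by auto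
  have [measurable]: "p \<in> borel_measurable borel" using p by auto
  have int: "integrable (M \<Otimes>\<^sub>M lborel) (\<lambda>(\<omega>, s). p \<omega> * (iexp ((t - s) * \<omega>) * U s))"
  proof (rule P.Fubini_integrable)
    have "integrable M (\<lambda>\<omega>. cmod (p \<omega>) * (LINT s|lborel. cmod (U s)))"
      using p by (intro integrable_mult_left) auto
    then show "integrable M (\<lambda>\<omega>. LINT s|lborel. norm (case (\<omega>, s) of (\<omega>, s) \<Rightarrow> p \<omega> * (iexp ((t - s) * \<omega>) * U s)))"
      by (simp add: norm_mult)
    have "integrable lborel (\<lambda>s. p \<omega> * (iexp ((t - s) * \<omega>) * U s))" for \<omega>
      by (rule integrable_by_bound[of _ "\<lambda>s. p \<omega> * U s"])
         (use U_int in \<open>auto simp: norm_mult\<close>)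
    then show "AE \<omega> in M. integrable lborel (\<lambda>s. case (\<omega>, s) of (\<omega>, s) \<Rightarrow> p \<omega> * (iexp ((t - s) * \<omega>) * U s))"
      by simp
  qed measurable
  have "(CLINT \<omega>|M. p \<omega> * conv (\<lambda>s. iexp (s * \<omega>)) u t) =
      (CLINT \<omega>|M. (CLINT s|lborel. p \<omega> * (iexp ((t - s) * \<omega>) * U s)))"
    unfolding conv_eq_lebesgue[OF continuous_on_iexp_mult u] U_def
    by (simp only: integral_mult_right_zero)
  also have "\<dots> = (CLINT s|lborel. (CLINT \<omega>|M. p \<omega> * (iexp ((t - s) * \<omega>) * U s)))"
    by (rule P.Fubini_integral[OF int, symmetric])
  also have "\<dots> = (CLINT s|lborel. fourier M p (t - s) * U s)"
  proof (rule lebesgue_integral_cong)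
    fix s
    have "(CLINT \<omega>|M. p \<omega> * (iexp ((t - s) * \<omega>) * U s)) = (CLINT \<omega>|M. iexp ((t - s) * \<omega>) * p \<omega> * U s)"
      by (simp add: mult_ac)
    then show "(CLINT \<omega>|M. p \<omega> * (iexp ((t - s) * \<omega>) * U s)) = fourier M p (t - s) * U s"
      by (simp add: fourier_def)
  qed
  also have "\<dots> = conv (fourier M p) u t"
    unfolding U_def by (rule conv_eq_lebesgue[OF continuous_on_fourier[OF events_eq_borel p] u, symmetric])
  finally show ?thesis .
qed

lemma order_parameter_spec:
  assumes "\<phi> \<in> L2 M"
  shows "continuous_on {0..} (order_parameter M \<kappa> \<phi>) \<and>
    (\<forall>t\<ge>0. order_parameter M \<kappa> \<phi> t = fourier M \<phi> t + \<kappa> * conv (char M) (order_parameter M \<kappa> \<phi>) t)"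
proof -
  obtain u where "continuous_on {0..} u" "\<And>t. t \<ge> 0 \<Longrightarrow> u t = fourier M \<phi> t + \<kappa> * conv (char M) u t"
    using volterra_exists[OF continuous_on_char cmod_char_le_1
        continuous_on_fourier[OF events_eq_borel L2_integrable[OF assms]] norm_fourier_le[OF events_eq_borel L2_integrable[OF assms]]] by metis
  then show ?thesis
    unfolding order_parameter_def by (intro someI_ex[of "\<lambda>u. continuous_on {0..} u \<and> _ u"]) blast
qed

lemma continuous_on_order_parameter: "\<phi> \<in> L2 M \<Longrightarrow> continuous_on {0..} (order_parameter M \<kappa> \<phi>)"
  using order_parameter_spec by blast

lemma order_parameter_volterra:
  "\<phi> \<in> L2 M \<Longrightarrow> t \<ge> 0 \<Longrightarrow>
    order_parameter M \<kappa> \<phi> t = fourier M \<phi> t + \<kappa> * conv (char M) (order_parameter M \<kappa> \<phi>) t"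
  using order_parameter_spec by blast

lemma order_parameter_unique:
  assumes "\<phi> \<in> L2 M" "continuous_on {0..} u"
    and "\<And>t. t \<ge> 0 \<Longrightarrow> u t = fourier M \<phi> t + \<kappa> * conv (char M) u t" and "t \<ge> 0"
  shows "order_parameter M \<kappa> \<phi> t = u t"
  by (rule volterra_unique[OF continuous_on_char cmod_char_le_1
        continuous_on_order_parameter[OF assms(1)] assms(2)
        order_parameter_volterra[OF assms(1)] assms(3)]) (use \<open>t \<ge> 0\<close> in auto)

lemma order_parameter_bound:
  assumes "\<phi> \<in> L2 M" "t \<ge> 0"
  shows "cmod (order_parameter M \<kappa> \<phi> t) \<le> 2 * L2_norm M \<phi> * exp ((2 * cmod \<kappa> + 1) * t)"
proof (rule volterra_bound[OF continuous_on_char cmod_char_le_1 continuous_on_order_parameter[OF assms(1)]])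
  fix s :: real assume "0 \<le> s"
  then show "cmod (order_parameter M \<kappa> \<phi> s - \<kappa> * conv (char M) (order_parameter M \<kappa> \<phi>) s) \<le> L2_norm M \<phi>"
    using order_parameter_volterra[OF assms(1), of s \<kappa>] norm_fourier_le[OF events_eq_borel L2_integrable[OF assms(1)], of s]
      integral_norm_le_L2_norm[OF assms(1)] by simp
qed (rule assms(2))

text \<open>The bound is uniform in \<open>\<omega>\<close>, so it also bounds the \<open>L\<^sup>2\<close> norm with respect to a probability
  measure.\<close>

lemma forcing_bound:
  assumes "\<phi> \<in> L2 M" "t \<ge> 0"
  shows "cmod (\<kappa> * drive M \<kappa> \<phi> t \<omega>)
    \<le> L2_norm M \<phi> * exp ((2 * cmod \<kappa> + 1) * t)"
proof -
  define c where "c = 2 * cmod \<kappa> + 1"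
  have c: "c > 0" "2 * cmod \<kappa> / c \<le> 1" by (auto simp: c_def add_pos_nonneg field_simps)
  have "cmod (drive M \<kappa> \<phi> t \<omega>) \<le> 2 * L2_norm M \<phi> * exp (c * t) / c"
    using c assms order_parameter_bound[OF assms(1), of _ \<kappa>]
    by (intro conv_exp_bound[where \<beta> = 1, simplified] continuous_on_iexp_mult continuous_on_order_parameter)
       (auto simp: c_def norm_exp_i_times simp flip: of_real_mult)
  then have "cmod \<kappa> * cmod (drive M \<kappa> \<phi> t \<omega>)
      \<le> cmod \<kappa> * (2 * L2_norm M \<phi> * exp (c * t) / c)"
    by (intro mult_left_mono) auto
  also have "\<dots> = (2 * cmod \<kappa> / c) * (L2_norm M \<phi> * exp (c * t))" by simp
  also have "\<dots> \<le> 1 * (L2_norm M \<phi> * exp (c * t))"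
    by (intro mult_right_mono c) auto
  finally show ?thesis by (simp add: norm_mult c_def)
qed

lemma borel_measurable_conv_iexp:
  assumes u: "continuous_on {0..} u"
  shows "(\<lambda>\<omega>. conv (\<lambda>s. iexp (s * \<omega>)) u t) \<in> borel_measurable M"
proof -
  have "continuous_on (UNIV \<times> cbox 0 t) (\<lambda>(\<omega>, s). iexp ((t - s) * \<omega>) * u s)"
    unfolding case_prod_beta
    by (intro continuous_intros continuous_on_compose2[OF u]) auto
  from integral_continuous_on_param[OF this]
  have "continuous_on UNIV (\<lambda>\<omega>. conv (\<lambda>s. iexp (s * \<omega>)) u t)"
    by (simp add: conv_def)
  then show ?thesis by (simp add: borel_measurable_continuous_onI)
qed

lemma borel_measurable_flow:
  assumes "\<phi> \<in> L2 M" shows "flow M \<kappa> t \<phi> \<in> borel_measurable M"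
proof -
  note [measurable] = borel_measurable_conv_iexp[OF continuous_on_order_parameter[OF assms]] L2_measurable[OF assms]
  show ?thesis unfolding flow_def by measurable
qed

lemma flow_parts_in_L2:
  assumes "\<phi> \<in> L2 M" "t \<ge> 0"
  shows "(\<lambda>\<omega>. iexp (t * \<omega>) * \<phi> \<omega>) \<in> L2 M"
    and "(\<lambda>\<omega>. \<kappa> * drive M \<kappa> \<phi> t \<omega>) \<in> L2 M"
proof -
  note [measurable] = borel_measurable_conv_iexp[OF continuous_on_order_parameter[OF assms(1)]] L2_measurable[OF assms(1)]
  show "(\<lambda>\<omega>. iexp (t * \<omega>) * \<phi> \<omega>) \<in> L2 M"
    by (rule L2_dominated[OF _ assms(1), where B = 1]) (auto simp: norm_mult)
  show "(\<lambda>\<omega>. \<kappa> * drive M \<kappa> \<phi> t \<omega>) \<in> L2 M"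
    by (rule L2_bounded[OF _ forcing_bound[OF assms]]) measurable
qed

lemma flow_in_L2:
  assumes "\<phi> \<in> L2 M" "t \<ge> 0" shows "flow M \<kappa> t \<phi> \<in> L2 M"
  using L2_add[OF flow_parts_in_L2[OF assms]] unfolding flow_def .

lemma flow_0: "flow M \<kappa> 0 \<phi> = \<phi>"
  by (simp add: flow_def fun_eq_iff)

lemma order_parameter_linear:
  assumes \<phi>: "\<phi> \<in> L2 M" and \<psi>: "\<psi> \<in> L2 M" and "t \<ge> 0"
  shows "order_parameter M \<kappa> (\<lambda>x. a * \<phi> x + b * \<psi> x) t = a * order_parameter M \<kappa> \<phi> t + b * order_parameter M \<kappa> \<psi> t"
proof (rule order_parameter_unique)
  let ?v = "order_parameter M \<kappa> \<psi>"
  let ?u = "order_parameter M \<kappa> \<phi>"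
  let ?\<xi> = "\<lambda>x. a * \<phi> x + b * \<psi> x"
  show "?\<xi> \<in> L2 M" by (intro L2_add L2_cmult \<phi> \<psi>)
  show "continuous_on {0..} (\<lambda>t. a * ?u t + b * ?v t)"
    by (intro continuous_intros continuous_on_order_parameter \<phi> \<psi>)
  fix t :: real assume "t \<ge> 0"
  have "fourier M ?\<xi> t =
      (CLINT \<omega>|M. a * (iexp (t * \<omega>) * \<phi> \<omega>) + b * (iexp (t * \<omega>) * \<psi> \<omega>))"
    unfolding fourier_def by (simp add: algebra_simps)
  also have "\<dots> = a * fourier M \<phi> t + b * fourier M \<psi> t"
    unfolding fourier_def
    by (subst Bochner_Integration.integral_add)
       (intro integrable_mult_right integrable_iexp_mult events_eq_borel L2_integrable \<phi> \<psi> | simp)+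
  finally show "a * ?u t + b * ?v t =
      fourier M ?\<xi> t +
      \<kappa> * conv (char M) (\<lambda>t. a * ?u t + b * ?v t) t"
    using order_parameter_volterra[OF \<phi> \<open>t \<ge> 0\<close>, of \<kappa>] order_parameter_volterra[OF \<psi> \<open>t \<ge> 0\<close>, of \<kappa>]
    by (simp add: conv_linear continuous_on_char continuous_on_order_parameter \<phi> \<psi> algebra_simps)
qed (rule \<open>t \<ge> 0\<close>)

lemma flow_linear:
  assumes \<phi>: "\<phi> \<in> L2 M" and \<psi>: "\<psi> \<in> L2 M" and "t \<ge> 0"
  shows "flow M \<kappa> t (\<lambda>x. a * \<phi> x + b * \<psi> x) \<omega> = a * flow M \<kappa> t \<phi> \<omega> + b * flow M \<kappa> t \<psi> \<omega>"
proof -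
  let ?e = "\<lambda>s. iexp (s * \<omega>)"
  have "conv ?e (order_parameter M \<kappa> (\<lambda>x. a * \<phi> x + b * \<psi> x)) t =
      conv ?e (\<lambda>s. a * order_parameter M \<kappa> \<phi> s + b * order_parameter M \<kappa> \<psi> s) t"
    by (intro conv_cong order_parameter_linear assms refl)
  also have "\<dots> = a * drive M \<kappa> \<phi> t \<omega>
      + b * conv ?e (order_parameter M \<kappa> \<psi>) t"
    by (intro conv_linear continuous_on_iexp_mult continuous_on_order_parameter assms)
  finally show ?thesis by (simp add: flow_def algebra_simps)
qed

text \<open>The pairing of the flow with a bounded function \<open>q\<close>. It serves for \<open>q = exp(i \<omega> t)\<close> in the
  semigroup law and for the test functions in the weak limit.\<close>

lemma integral_flow_mult:
  assumes \<phi>: "\<phi> \<in> L2 M" and [measurable]: "q \<in> borel_measurable M" and q: "\<And>\<omega>. cmod (q \<omega>) \<le> B" and "t \<ge> 0"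
  shows "(CLINT \<omega>|M. flow M \<kappa> t \<phi> \<omega> * q \<omega>) =
    fourier M (\<lambda>\<omega>. \<phi> \<omega> * q \<omega>) t + \<kappa> * conv (fourier M q) (order_parameter M \<kappa> \<phi>) t"
proof -
  have qint: "integrable M q" by (rule integrable_const_bound[of _ B]) (use q in auto)
  have mult_int: "integrable M (\<lambda>\<omega>. f \<omega> * q \<omega>)" if "f \<in> L2 M" for f
    by (rule integrable_by_bound[OF integrable_mult_right[OF L2_integrable[OF that], of "of_real B"]])
       (use L2_measurable[OF that] q order_trans[OF norm_ge_zero q] in
         \<open>auto simp: norm_mult mult.commute[of B] intro!: mult_left_mono\<close>)
  have "(CLINT \<omega>|M. flow M \<kappa> t \<phi> \<omega> * q \<omega>) =
      (CLINT \<omega>|M. iexp (t * \<omega>) * \<phi> \<omega> * q \<omega> + \<kappa> * drive M \<kappa> \<phi> t \<omega> * q \<omega>)"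
    by (simp add: flow_def distrib_right)
  also have "\<dots> = fourier M (\<lambda>\<omega>. \<phi> \<omega> * q \<omega>) t +
      (CLINT \<omega>|M. \<kappa> * (q \<omega> * drive M \<kappa> \<phi> t \<omega>))"
    by (subst Bochner_Integration.integral_add[OF mult_int[OF flow_parts_in_L2(1)[OF \<phi> \<open>t \<ge> 0\<close>]]
          mult_int[OF flow_parts_in_L2(2)[OF \<phi> \<open>t \<ge> 0\<close>]]])
       (simp add: fourier_def mult_ac)
  also have "\<dots> = fourier M (\<lambda>\<omega>. \<phi> \<omega> * q \<omega>) t + \<kappa> * conv (fourier M q) (order_parameter M \<kappa> \<phi>) t"
    by (simp only: integral_mult_right_zero integral_conv_exchange[OF qint continuous_on_order_parameter[OF \<phi>]])
  finally show ?thesis .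
qed

text \<open>Both sides solve the Volterra equation whose inhomogeneity comes from the state at time \<open>s\<close>.\<close>

lemma order_parameter_flow:
  assumes \<phi>: "\<phi> \<in> L2 M" and s: "s \<ge> 0" and "t \<ge> 0"
  shows "order_parameter M \<kappa> (flow M \<kappa> s \<phi>) t = order_parameter M \<kappa> \<phi> (s + t)"
proof (rule order_parameter_unique[OF flow_in_L2[OF \<phi> s]])
  let ?\<eta> = "order_parameter M \<kappa> \<phi>"
  show "continuous_on {0..} (\<lambda>t. ?\<eta> (s + t))"
    by (rule continuous_on_compose2[OF continuous_on_order_parameter[OF \<phi>]])
       (use s in \<open>auto intro!: continuous_intros\<close>)
  fix t :: real assume t: "t \<ge> 0"
  have "fourier M (flow M \<kappa> s \<phi>) t = (CLINT \<omega>|M. flow M \<kappa> s \<phi> \<omega> * iexp (t * \<omega>))"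
    by (simp add: fourier_def mult.commute)
  also have "\<dots> = fourier M (\<lambda>\<omega>. \<phi> \<omega> * iexp (t * \<omega>)) s + \<kappa> * conv (fourier M (\<lambda>\<omega>. iexp (t * \<omega>))) ?\<eta> s"
    by (rule integral_flow_mult[OF \<phi> _ _ s, where B = 1]) auto
  also have "fourier M (\<lambda>\<omega>. \<phi> \<omega> * iexp (t * \<omega>)) s = fourier M \<phi> (s + t)"
    by (simp add: fourier_def exp_add algebra_simps)
  also have "fourier M (\<lambda>\<omega>. iexp (t * \<omega>)) = (\<lambda>r. char M (t + r))"
    by (simp add: fourier_def char_def fun_eq_iff algebra_simps flip: exp_add)
  finally have "fourier M (flow M \<kappa> s \<phi>) t = fourier M \<phi> (s + t) + \<kappa> * conv (\<lambda>r. char M (t + r)) ?\<eta> s" .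
  moreover have "?\<eta> (s + t) = fourier M \<phi> (s + t) + \<kappa> * conv (char M) ?\<eta> (s + t)"
    using s t by (intro order_parameter_volterra \<phi>) simp
  ultimately show "?\<eta> (s + t) = fourier M (flow M \<kappa> s \<phi>) t + \<kappa> * conv (char M) (\<lambda>t. ?\<eta> (s + t)) t"
    using conv_split[OF continuous_on_char continuous_on_order_parameter[OF \<phi>] s t, of \<kappa>]
    by (simp add: algebra_simps)
qed (rule \<open>t \<ge> 0\<close>)

lemma flow_add:
  assumes \<phi>: "\<phi> \<in> L2 M" and s: "s \<ge> 0" and t: "t \<ge> 0"
  shows "flow M \<kappa> (s + t) \<phi> \<omega> = flow M \<kappa> s (flow M \<kappa> t \<phi>) \<omega>"
proof -
  let ?\<eta> = "order_parameter M \<kappa> \<phi>" and ?e = "\<lambda>s. iexp (s * \<omega>)"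
  have "conv ?e ?\<eta> (t + s) = conv (\<lambda>r. ?e (s + r)) ?\<eta> t + conv ?e (\<lambda>r. ?\<eta> (t + r)) s"
    by (rule conv_split[OF continuous_on_iexp_mult continuous_on_order_parameter[OF \<phi>] t s])
  also have "(\<lambda>r. ?e (s + r)) = (\<lambda>r. ?e s * ?e r)"
    by (simp add: fun_eq_iff algebra_simps flip: exp_add)
  also have "conv (\<lambda>r. ?e s * ?e r) ?\<eta> t = ?e s * conv ?e ?\<eta> t"
    by (rule conv_cmult_left)
  also have "conv ?e (\<lambda>r. ?\<eta> (t + r)) s = conv ?e (order_parameter M \<kappa> (flow M \<kappa> t \<phi>)) s"
    by (rule conv_cong) (use order_parameter_flow[OF \<phi> t] in auto)
  finally have "conv ?e ?\<eta> (s + t) = ?e s * conv ?e ?\<eta> t + conv ?e (order_parameter M \<kappa> (flow M \<kappa> t \<phi>)) s"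
    by (simp add: add.commute)
  moreover have "?e (s + t) = ?e s * ?e t"
    by (simp add: algebra_simps flip: exp_add)
  ultimately show ?thesis
    by (simp add: flow_def algebra_simps)
qed

lemma flow_bounded:
  assumes "t \<ge> 0"
  shows "\<exists>B. \<forall>\<phi>\<in>L2 M. L2_norm M (flow M \<kappa> t \<phi>) \<le> B * L2_norm M \<phi>"
proof -
  define E where "E = exp ((2 * cmod \<kappa> + 1) * t)"
  have "L2_norm M (flow M \<kappa> t \<phi>) \<le> sqrt (2 + 2 * E^2) * L2_norm M \<phi>" if \<phi>: "\<phi> \<in> L2 M" for \<phi>
  proof -
    let ?f = "\<lambda>\<omega>. \<kappa> * drive M \<kappa> \<phi> t \<omega>"
    note L = flow_parts_in_L2[OF \<phi> assms]
    have "(LINT \<omega>|M. (cmod (?f \<omega>))^2) \<le> (LINT \<omega>|M. (L2_norm M \<phi> * E)^2)"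
      using forcing_bound[OF \<phi> assms, of \<kappa>] unfolding E_def
      by (intro integral_mono L2_integrable_square L power_mono) auto
    then have f: "(L2_norm M ?f)^2 \<le> (L2_norm M \<phi> * E)^2"
      by (simp add: L2_norm_power2 prob_space del: space_eq_univ)
    have e: "L2_norm M (\<lambda>\<omega>. iexp (t * \<omega>) * \<phi> \<omega>) = L2_norm M \<phi>"
      by (simp add: L2_norm_def norm_mult)
    have "(L2_norm M (flow M \<kappa> t \<phi>))^2 \<le> 2 * (L2_norm M \<phi>)^2 + 2 * (L2_norm M \<phi> * E)^2"
      using L2_norm_add_power2_le[OF L, of \<kappa>] f unfolding e flow_def[abs_def] by linarith
    also have "\<dots> = (sqrt (2 + 2 * E^2) * L2_norm M \<phi>)^2"
      by (simp add: power_mult_distrib algebra_simps)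
    finally show ?thesis by (rule power2_le_imp_le) simp
  qed
  then show ?thesis by blast
qed

end

section \<open>The generator of the flow\<close>

lemma norm_iexp_minus_1_le: "cmod (iexp x - 1) \<le> \<bar>x\<bar>"
  using iexp_approx1[of x 0] by simp

lemma tendsto_iexp_quotient:
  "((\<lambda>t. (iexp (t * \<omega>) - 1) / of_real t) \<longlongrightarrow> \<i> * of_real \<omega>) (at_right 0)"
proof -
  have "((\<lambda>z. exp (\<i> * (z * of_real \<omega>))) has_field_derivative \<i> * of_real \<omega>) (at 0)"
    by (auto intro!: derivative_eq_intros)
  then have "((\<lambda>z. (exp (\<i> * (z * of_real \<omega>)) - 1) / z) \<longlongrightarrow> \<i> * of_real \<omega>) (at 0)"
    by (simp add: DERIV_def)
  moreover have "filterlim (complex_of_real) (at 0) (at_right 0)"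
    unfolding filterlim_at
    by (auto intro!: tendsto_eq_intros simp: eventually_at_right_less eventually_at_filter)
  ultimately show ?thesis
    using filterlim_compose[of "\<lambda>z. (exp (\<i> * (z * of_real \<omega>)) - 1) / z" _ "at 0" complex_of_real "at_right 0"]
    by simp
qed

context real_distribution
begin

text \<open>The integrand converges pointwise, and for \<open>t < 1\<close> it is dominated by \<open>2 |\<phi>|\<close> plus a
  constant.\<close>

lemma flow_strongly_continuous:
  assumes \<phi>: "\<phi> \<in> L2 M"
  shows "((\<lambda>t. L2_norm M (\<lambda>\<omega>. flow M \<kappa> t \<phi> \<omega> - \<phi> \<omega>)) \<longlongrightarrow> 0) (at_right 0)"
proof (rule tendsto_L2_norm_zero_dominated)
  let ?\<eta> = "order_parameter M \<kappa> \<phi>"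
  define E where "E = L2_norm M \<phi> * exp (2 * cmod \<kappa> + 1)"
  show "(\<lambda>\<omega>. flow M \<kappa> t \<phi> \<omega> - \<phi> \<omega>) \<in> borel_measurable M" if "t > 0" for t
    using borel_measurable_flow[OF \<phi>] L2_measurable[OF \<phi>] by simp
  have "integrable M (\<lambda>\<omega>. 4 * (cmod (\<phi> \<omega>))^2 + 4 * E * cmod (\<phi> \<omega>) + E^2)"
    using L2_integrable_square[OF \<phi>] L2_integrable[OF \<phi>] by simp
  then show "integrable M (\<lambda>\<omega>. (2 * cmod (\<phi> \<omega>) + E)^2)"
    by (simp add: power2_sum power_mult_distrib algebra_simps)
  show "cmod (flow M \<kappa> t \<phi> \<omega> - \<phi> \<omega>) \<le> 2 * cmod (\<phi> \<omega>) + E" if t: "0 < t" "t < 1" for t \<omega>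
  proof -
    have "cmod (flow M \<kappa> t \<phi> \<omega> - \<phi> \<omega>) \<le>
        cmod (iexp (t * \<omega>) * \<phi> \<omega>) + cmod (\<kappa> * conv (\<lambda>s. iexp (s * \<omega>)) ?\<eta> t) + cmod (\<phi> \<omega>)"
      unfolding flow_def by (intro order_trans[OF norm_triangle_ineq4] add_mono norm_triangle_ineq order_refl)
    also have "cmod (iexp (t * \<omega>) * \<phi> \<omega>) = cmod (\<phi> \<omega>)"
      by (simp only: norm_mult norm_exp_i_times mult_1)
    also have "cmod (\<kappa> * conv (\<lambda>s. iexp (s * \<omega>)) ?\<eta> t) \<le> L2_norm M \<phi> * exp ((2 * cmod \<kappa> + 1) * t)"
      using t by (intro forcing_bound \<phi>) simp
    also have "\<dots> \<le> E"
      unfolding E_def using t by (intro mult_left_mono) (auto intro!: mult_left_le add_nonneg_nonneg)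
    finally show ?thesis by simp
  qed
  show "((\<lambda>t. flow M \<kappa> t \<phi> \<omega> - \<phi> \<omega>) \<longlongrightarrow> 0) (at_right 0)" for \<omega>
  proof -
    have "continuous_on {0..} (\<lambda>t. flow M \<kappa> t \<phi> \<omega> - \<phi> \<omega>)"
      unfolding flow_def
      by (intro continuous_intros continuous_on_conv continuous_on_order_parameter \<phi> continuous_on_iexp_mult)
    then have "((\<lambda>t. flow M \<kappa> t \<phi> \<omega> - \<phi> \<omega>) \<longlongrightarrow> flow M \<kappa> 0 \<phi> \<omega> - \<phi> \<omega>) (at 0 within {0..})"
      by (auto simp: continuous_on_def)
    then have "((\<lambda>t. flow M \<kappa> t \<phi> \<omega> - \<phi> \<omega>) \<longlongrightarrow> 0) (at 0 within {0..})"
      by (simp add: flow_0)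
    then show ?thesis by (rule tendsto_within_subset) auto
  qed
qed

lemma C0_semigroup_flow: "C0_semigroup M (flow M \<kappa>)"
  unfolding C0_semigroup_def
  by (intro conjI allI ballI impI AE_I2 flow_in_L2 flow_linear flow_bounded flow_add flow_strongly_continuous)
     (auto simp: flow_0)

text \<open>The bounded rank-one part contributes \<open>\<kappa> \<eta>(0) = \<kappa> P \<phi>\<close> to the generator, for every \<open>\<phi>\<close>.\<close>

lemma forcing_difference_quotient:
  assumes \<phi>: "\<phi> \<in> L2 M"
  shows "((\<lambda>t. L2_norm M (\<lambda>\<omega>. \<kappa> * (drive M \<kappa> \<phi> t \<omega> / of_real t
      - order_parameter M \<kappa> \<phi> 0))) \<longlongrightarrow> 0) (at_right 0)"
proof (rule tendsto_L2_norm_zero_dominated)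
  let ?\<eta> = "order_parameter M \<kappa> \<phi>"
  note \<eta> = continuous_on_order_parameter[OF \<phi>, of \<kappa>]
  define B where "B = 2 * L2_norm M \<phi> * exp (2 * cmod \<kappa> + 1)"
  define J where "J \<omega> t = integral {0..1} (\<lambda>x. iexp ((t - t * x) * \<omega>) * ?\<eta> (t * x))" for \<omega> t
  have J: "conv (\<lambda>s. iexp (s * \<omega>)) ?\<eta> t / of_real t = J \<omega> t" if "t > 0" for t \<omega>
    using that by (simp add: conv_rescaled J_def)
  have \<eta>_le: "cmod (?\<eta> s) \<le> B" if "0 \<le> s" "s \<le> 1" for s
  proof -
    have "cmod (?\<eta> s) \<le> 2 * L2_norm M \<phi> * exp ((2 * cmod \<kappa> + 1) * s)"
      using that by (intro order_parameter_bound \<phi>) simp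
    also have "\<dots> \<le> B"
      unfolding B_def using that by (intro mult_left_mono) (auto intro!: mult_left_le add_nonneg_nonneg)
    finally show ?thesis .
  qed
  have contJ: "continuous_on {0..} (J \<omega>)" for \<omega>
  proof -
    have "continuous_on ({0..} \<times> cbox 0 (1::real)) (\<lambda>(t, x). iexp ((t - t * x) * \<omega>) * ?\<eta> (t * x))"
      unfolding case_prod_beta
      by (intro continuous_intros continuous_on_compose2[OF \<eta>]) auto
    from integral_continuous_on_param[OF this] show ?thesis by (simp add: J_def[abs_def])
  qed
  show "(\<lambda>\<omega>. \<kappa> * (conv (\<lambda>s. iexp (s * \<omega>)) ?\<eta> t / of_real t - ?\<eta> 0)) \<in> borel_measurable M" if "t > 0" for t
  proof -
    note [measurable] = borel_measurable_conv_iexp[OF \<eta>]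
    show ?thesis by measurable
  qed
  show "integrable M (\<lambda>\<omega>. (cmod \<kappa> * (2 * B))^2)" by simp
  show "cmod (\<kappa> * (conv (\<lambda>s. iexp (s * \<omega>)) ?\<eta> t / of_real t - ?\<eta> 0)) \<le> cmod \<kappa> * (2 * B)"
    if t: "0 < t" "t < 1" for t \<omega>
  proof -
    have tx: "0 \<le> t * x \<and> t * x \<le> 1" if "x \<in> {0..1}" for x
      using that t by (auto intro!: mult_le_one)
    have "cmod (J \<omega> t) \<le> B * (1 - 0)"
      unfolding J_def
    proof (rule integral_bound)
      show "continuous_on {0..1} (\<lambda>x. iexp ((t - t * x) * \<omega>) * ?\<eta> (t * x))"
        using tx by (intro continuous_intros continuous_on_compose2[OF \<eta>]) auto
      show "cmod (iexp ((t - t * x) * \<omega>) * ?\<eta> (t * x)) \<le> B" if "x \<in> {0..1}" for x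
        using tx[OF that] \<eta>_le by (simp only: norm_mult norm_exp_i_times mult_1)
    qed simp
    then have "cmod (J \<omega> t - ?\<eta> 0) \<le> 2 * B"
      using norm_triangle_ineq4[of "J \<omega> t" "?\<eta> 0"] \<eta>_le[of 0] by simp
    then show ?thesis
      unfolding J[OF t(1)] norm_mult by (intro mult_left_mono) auto
  qed
  show "((\<lambda>t. \<kappa> * (conv (\<lambda>s. iexp (s * \<omega>)) ?\<eta> t / of_real t - ?\<eta> 0)) \<longlongrightarrow> 0) (at_right 0)" for \<omega>
  proof -
    have "(J \<omega> \<longlongrightarrow> J \<omega> 0) (at 0 within {0..})"
      using contJ[of \<omega>] by (auto simp: continuous_on_def)
    then have "(J \<omega> \<longlongrightarrow> J \<omega> 0) (at_right 0)"
      by (rule tendsto_within_subset) auto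
    then have "((\<lambda>t. \<kappa> * (J \<omega> t - ?\<eta> 0)) \<longlongrightarrow> \<kappa> * (J \<omega> 0 - ?\<eta> 0)) (at_right 0)"
      by (intro tendsto_intros)
    moreover have "J \<omega> 0 = ?\<eta> 0" by (simp add: J_def)
    ultimately have "((\<lambda>t. \<kappa> * (J \<omega> t - ?\<eta> 0)) \<longlongrightarrow> 0) (at_right 0)" by simp
    then show ?thesis
      by (rule Lim_transform_eventually) (use J in \<open>auto simp: eventually_at_filter\<close>)
  qed
qed

text \<open>The unbounded part alone decides the domain. If the quotient converges in \<open>L\<^sup>2\<close>, its limit
  must be the pointwise limit \<open>i \<omega> \<phi>\<close>; conversely \<open>|exp(i t \<omega>) - 1| \<le> t |\<omega>|\<close> gives a
  dominating function when \<open>\<omega> \<phi>\<close> is square integrable.\<close>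

lemma multiplication_difference_quotient:
  assumes \<phi>: "\<phi> \<in> L2 M" and \<xi>: "\<xi> \<in> L2 M"
  shows "((\<lambda>t. L2_norm M (\<lambda>\<omega>. (iexp (t * \<omega>) - 1) / of_real t * \<phi> \<omega> - \<xi> \<omega>)) \<longlongrightarrow> 0) (at_right 0) \<longleftrightarrow>
    (\<lambda>\<omega>. of_real \<omega> * \<phi> \<omega>) \<in> L2 M \<and> (AE \<omega> in M. \<xi> \<omega> = \<i> * of_real \<omega> * \<phi> \<omega>)" (is "?lim \<longleftrightarrow> ?eq")
proof -
  let ?l = "\<lambda>\<omega>. \<i> * of_real \<omega> * \<phi> \<omega>"
  let ?q = "\<lambda>t \<omega>. (iexp (t * \<omega>) - 1) / of_real t * \<phi> \<omega>"
  note [measurable] = L2_measurable[OF \<phi>] L2_measurable[OF \<xi>]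
  have ptlim: "((\<lambda>t. ?q t \<omega>) \<longlongrightarrow> ?l \<omega>) (at_right 0)" for \<omega>
    by (intro tendsto_intros tendsto_iexp_quotient)
  show ?thesis
  proof
    assume ?lim
    have L: "(\<lambda>\<omega>. ?q t \<omega> - \<xi> \<omega>) \<in> L2 M" if "t > 0" for t
    proof (rule L2_diff[OF L2_dominated[OF _ \<phi>, where B = "2 / t"] \<xi>])
      fix \<omega>
      have "cmod (iexp (t * \<omega>) - 1) \<le> 2"
        using norm_triangle_ineq4[of "iexp (t * \<omega>)" 1] by (simp only: norm_exp_i_times) simp
      then have "cmod ((iexp (t * \<omega>) - 1) / of_real t) \<le> 2 / t"
        unfolding norm_divide using that by (simp add: divide_right_mono)
      then show "cmod (?q t \<omega>) \<le> 2 / t * cmod (\<phi> \<omega>)"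
        unfolding norm_mult by (rule mult_right_mono) simp
    qed measurable
    have "AE \<omega> in M. ?l \<omega> - \<xi> \<omega> = 0"
      by (rule L2_limit_AE_unique[OF L \<open>?lim\<close>]) (assumption, intro tendsto_diff tendsto_const ptlim)
    then have ae: "AE \<omega> in M. \<xi> \<omega> = ?l \<omega>" by eventually_elim simp
    have "integrable M (\<lambda>\<omega>. (cmod (of_real \<omega> * \<phi> \<omega>))^2)"
    proof (rule integrable_cong_AE_imp[OF L2_integrable_square[OF \<xi>]])
      show "AE \<omega> in M. (cmod (\<xi> \<omega>))^2 = (cmod (of_real \<omega> * \<phi> \<omega>))^2"
        using ae by eventually_elim (simp add: norm_mult)
    qed measurable
    with ae show ?eq by (simp add: L2_def)
  next
    assume ?eq
    then have L: "(\<lambda>\<omega>. of_real \<omega> * \<phi> \<omega>) \<in> L2 M" and ae: "AE \<omega> in M. \<xi> \<omega> = ?l \<omega>" by auto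
    have "((\<lambda>t. L2_norm M (\<lambda>\<omega>. ?q t \<omega> - ?l \<omega>)) \<longlongrightarrow> 0) (at_right 0)"
    proof (rule tendsto_L2_norm_zero_dominated)
      show "integrable M (\<lambda>\<omega>. (2 * cmod (of_real \<omega> * \<phi> \<omega>))^2)"
        using L2_integrable_square[OF L] by (simp add: power_mult_distrib)
      show "cmod (?q t \<omega> - ?l \<omega>) \<le> 2 * cmod (of_real \<omega> * \<phi> \<omega>)"
        if "0 < t" for t \<omega>
      proof -
        have "cmod ((iexp (t * \<omega>) - 1) / of_real t) \<le> \<bar>t * \<omega>\<bar> / t"
          unfolding norm_divide using that norm_iexp_minus_1_le[of "t * \<omega>"] by (simp add: divide_right_mono)
        also have "\<dots> = \<bar>\<omega>\<bar>" using that by (simp add: abs_mult)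
        finally have "cmod ((iexp (t * \<omega>) - 1) / of_real t) * cmod (\<phi> \<omega>) \<le> \<bar>\<omega>\<bar> * cmod (\<phi> \<omega>)"
          by (rule mult_right_mono) simp
        then show ?thesis
          using norm_triangle_ineq4[of "?q t \<omega>" "?l \<omega>"]
          unfolding norm_mult by simp
      qed
      show "((\<lambda>t. ?q t \<omega> - ?l \<omega>) \<longlongrightarrow> 0) (at_right 0)" for \<omega>
        using ptlim[of \<omega>] by (rule LIM_zero)
    qed measurable
    moreover have "L2_norm M (\<lambda>\<omega>. ?q t \<omega> - \<xi> \<omega>) =
        L2_norm M (\<lambda>\<omega>. ?q t \<omega> - ?l \<omega>)" for t
    proof -
      have "(LINT \<omega>|M. (cmod (?q t \<omega> - \<xi> \<omega>))^2) =
          (LINT \<omega>|M. (cmod (?q t \<omega> - ?l \<omega>))^2)"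
      proof (rule integral_cong_AE)
        show "AE \<omega> in M. (cmod (?q t \<omega> - \<xi> \<omega>))^2 =
            (cmod (?q t \<omega> - ?l \<omega>))^2"
          using ae by eventually_elim simp
      qed measurable
      then show ?thesis by (simp only: L2_norm_def)
    qed
    ultimately show ?lim by (simp only:)
  qed
qed

lemma generates_flow:
  "generates M {\<phi> \<in> L2 M. (\<lambda>\<omega>. of_real \<omega> * \<phi> \<omega>) \<in> L2 M} (mean_field_op M \<kappa>) (flow M \<kappa>)"
  unfolding generates_def
proof (intro conjI C0_semigroup_flow ballI)
  fix \<phi> \<psi> assume \<phi>: "\<phi> \<in> L2 M" and \<psi>: "\<psi> \<in> L2 M"
  let ?\<eta> = "order_parameter M \<kappa> \<phi>"
  let ?c = "\<lambda>t \<omega>. conv (\<lambda>s. iexp (s * \<omega>)) ?\<eta> t"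
  define \<xi> where "\<xi> \<omega> = \<psi> \<omega> - \<kappa> * ?\<eta> 0" for \<omega>
  have const: "(\<lambda>\<omega>. c) \<in> L2 M" for c :: complex by (rule L2_bounded) auto
  have \<xi>: "\<xi> \<in> L2 M" unfolding \<xi>_def by (intro L2_diff \<psi> const)
  define F where "F t \<omega> = (iexp (t * \<omega>) - 1) / of_real t * \<phi> \<omega> - \<xi> \<omega>" for t \<omega>
  define R where "R t \<omega> = \<kappa> * (?c t \<omega> / of_real t - ?\<eta> 0)" for t \<omega>
  \<comment> \<open>\<open>F\<close> is the unbounded and \<open>R\<close> the bounded part; \<open>R\<close> tends to zero, so \<open>F\<close> decides
    convergence.\<close>
  have split: "(flow M \<kappa> t \<phi> \<omega> - \<phi> \<omega>) / of_real t - \<psi> \<omega> = F t \<omega> + R t \<omega>" for t \<omega>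
    by (simp add: F_def R_def \<xi>_def flow_def diff_divide_distrib add_divide_distrib algebra_simps)
  have F: "F t \<in> L2 M" and R: "R t \<in> L2 M" if "t > 0" for t
  proof -
    have t: "t \<ge> 0" using that by simp
    have "(\<lambda>\<omega>. 1 / of_real t * (iexp (t * \<omega>) * \<phi> \<omega> - \<phi> \<omega>) - \<xi> \<omega>) \<in> L2 M"
      by (intro L2_diff L2_cmult flow_parts_in_L2 \<phi> \<xi> t)
    then show "F t \<in> L2 M" unfolding F_def[abs_def] by (simp add: algebra_simps diff_divide_distrib)
    have "(\<lambda>\<omega>. 1 / of_real t * (\<kappa> * ?c t \<omega>) - \<kappa> * ?\<eta> 0) \<in> L2 M"
      by (intro L2_diff L2_cmult flow_parts_in_L2 \<phi> const t)
    then show "R t \<in> L2 M" unfolding R_def[abs_def] by (simp add: algebra_simps)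
  qed
  have "((\<lambda>t. L2_norm M (\<lambda>\<omega>. (flow M \<kappa> t \<phi> \<omega> - \<phi> \<omega>) / of_real t - \<psi> \<omega>)) \<longlongrightarrow> 0) (at_right 0) \<longleftrightarrow>
      ((\<lambda>t. L2_norm M (F t)) \<longlongrightarrow> 0) (at_right 0)"
    unfolding split
  proof (rule tendsto_L2_norm_perturb)
    show "\<forall>\<^sub>F t in at_right 0. F t \<in> L2 M" "\<forall>\<^sub>F t in at_right 0. R t \<in> L2 M"
      using F R by (auto simp: eventually_at_filter)
    show "((\<lambda>t. L2_norm M (R t)) \<longlongrightarrow> 0) (at_right 0)"
      unfolding R_def[abs_def] by (rule forcing_difference_quotient[OF \<phi>])
  qed
  also have "\<dots> \<longleftrightarrow> (\<lambda>\<omega>. of_real \<omega> * \<phi> \<omega>) \<in> L2 M \<and> (AE \<omega> in M. \<xi> \<omega> = \<i> * of_real \<omega> * \<phi> \<omega>)"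
    unfolding F_def[abs_def] by (rule multiplication_difference_quotient[OF \<phi> \<xi>])
  also have "(\<lambda>\<omega>. \<xi> \<omega> = \<i> * of_real \<omega> * \<phi> \<omega>) = (\<lambda>\<omega>. \<psi> \<omega> = mean_field_op M \<kappa> \<phi> \<omega>)"
  proof -
    have "?\<eta> 0 = (CLINT \<omega>|M. \<phi> \<omega>)"
      using order_parameter_volterra[OF \<phi>, of 0 \<kappa>] by (simp add: fourier_def)
    then show ?thesis by (auto simp: \<xi>_def mean_field_op_def fun_eq_iff algebra_simps)
  qed
  finally show "((\<lambda>t. L2_norm M (\<lambda>\<omega>. (flow M \<kappa> t \<phi> \<omega> - \<phi> \<omega>) / of_real t - \<psi> \<omega>)) \<longlongrightarrow> 0) (at_right 0) \<longleftrightarrow>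
      \<phi> \<in> {\<phi> \<in> L2 M. (\<lambda>\<omega>. of_real \<omega> * \<phi> \<omega>) \<in> L2 M} \<and> (AE \<omega> in M. \<psi> \<omega> = mean_field_op M \<kappa> \<phi> \<omega>)"
    using \<phi> by simp
qed

end

text \<open>Running a semigroup at speed \<open>\<alpha>\<close> multiplies its generator by \<open>\<alpha>\<close>. With \<open>\<alpha> = j\<close> this reduces
  \<open>T\<^sub>j\<close> to \<open>i \<omega> + \<kappa> P\<close>.\<close>

lemma generates_time_scaled:
  assumes gen: "generates M D A S" and \<alpha>: "\<alpha> > 0"
  shows "generates M D (\<lambda>\<phi> x. of_real \<alpha> * A \<phi> x) (\<lambda>t. S (\<alpha> * t))"
proof -
  have sc: "filterlim (\<lambda>t. \<alpha> * t) (at_right 0) (at_right 0)"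
    using \<alpha> by (intro tendsto_imp_filterlim_at_right) (auto intro!: tendsto_eq_intros simp: eventually_at_filter)
  have sc': "filterlim (\<lambda>t. t / \<alpha>) (at_right 0) (at_right 0)"
    using \<alpha> by (intro tendsto_imp_filterlim_at_right) (auto intro!: tendsto_eq_intros simp: eventually_at_filter)
  have C0: "C0_semigroup M S" using gen by (simp add: generates_def)
  have "C0_semigroup M (\<lambda>t. S (\<alpha> * t))"
    unfolding C0_semigroup_def
  proof (intro conjI allI impI ballI)
    fix \<phi> assume \<phi>: "\<phi> \<in> L2 M"
    then have "((\<lambda>t. L2_norm M (\<lambda>x. S t \<phi> x - \<phi> x)) \<longlongrightarrow> 0) (at_right 0)"
      using C0 by (simp add: C0_semigroup_def)
    from filterlim_compose[OF this sc]
    show "((\<lambda>t. L2_norm M (\<lambda>x. S (\<alpha> * t) \<phi> x - \<phi> x)) \<longlongrightarrow> 0) (at_right 0)" .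
  qed (use C0 \<alpha> in \<open>auto simp: C0_semigroup_def distrib_left\<close>)
  moreover have "((\<lambda>t. L2_norm M (\<lambda>x. (S (\<alpha> * t) \<phi> x - \<phi> x) / of_real t - \<psi> x)) \<longlongrightarrow> 0) (at_right 0) \<longleftrightarrow>
      \<phi> \<in> D \<and> (AE x in M. \<psi> x = of_real \<alpha> * A \<phi> x)" if \<phi>: "\<phi> \<in> L2 M" and \<psi>: "\<psi> \<in> L2 M" for \<phi> \<psi>
  proof -
    define N where "N t = L2_norm M (\<lambda>x. (S t \<phi> x - \<phi> x) / of_real t - 1 / of_real \<alpha> * \<psi> x)" for t
    have "(S (\<alpha> * t) \<phi> x - \<phi> x) / of_real t - \<psi> x =
        of_real \<alpha> * ((S (\<alpha> * t) \<phi> x - \<phi> x) / of_real (\<alpha> * t) - 1 / of_real \<alpha> * \<psi> x)" for t x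
      using \<alpha> by (simp add: right_diff_distrib diff_divide_distrib)
    then have "(\<lambda>t. L2_norm M (\<lambda>x. (S (\<alpha> * t) \<phi> x - \<phi> x) / of_real t - \<psi> x)) = (\<lambda>t. \<alpha> * N (\<alpha> * t))"
      using \<alpha> by (simp only: L2_norm_cmult N_def) simp
    moreover have "((\<lambda>t. \<alpha> * N (\<alpha> * t)) \<longlongrightarrow> 0) (at_right 0) \<longleftrightarrow> (N \<longlongrightarrow> 0) (at_right 0)"
    proof
      assume "((\<lambda>t. \<alpha> * N (\<alpha> * t)) \<longlongrightarrow> 0) (at_right 0)"
      from tendsto_mult_left[OF filterlim_compose[OF this sc'], of "1 / \<alpha>"] \<alpha>
      show "(N \<longlongrightarrow> 0) (at_right 0)" by simp
    next
      assume "(N \<longlongrightarrow> 0) (at_right 0)"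
      from tendsto_mult_left[OF filterlim_compose[OF this sc], of \<alpha>]
      show "((\<lambda>t. \<alpha> * N (\<alpha> * t)) \<longlongrightarrow> 0) (at_right 0)" by simp
    qed
    moreover have "(N \<longlongrightarrow> 0) (at_right 0) \<longleftrightarrow> \<phi> \<in> D \<and> (AE x in M. 1 / of_real \<alpha> * \<psi> x = A \<phi> x)"
      unfolding N_def
      by (rule gen[unfolded generates_def, THEN conjunct2, THEN bspec, THEN bspec, OF \<phi> L2_cmult[OF \<psi>]])
    moreover have "(\<lambda>x. 1 / of_real \<alpha> * \<psi> x = A \<phi> x) = (\<lambda>x. \<psi> x = of_real \<alpha> * A \<phi> x)"
      using \<alpha> by (auto simp: fun_eq_iff field_simps)
    ultimately show ?thesis by (simp only:)
  qed
  ultimately show ?thesis unfolding generates_def by blast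
qed

section \<open>Line integrals in a strip and Cauchy transforms\<close>

lemma norm_lebesgue_integral_le:
  fixes f :: "'a \<Rightarrow> complex"
  assumes "integrable M f" "integrable M w" "\<And>x. cmod (f x) \<le> w x"
  shows "cmod (LINT x|M. f x) \<le> (LINT x|M. w x)"
proof (rule order_trans[OF integral_norm_bound integral_mono])
  show "integrable M (\<lambda>x. norm (f x))" using assms(1) by simp
qed (use assms in auto)

lemma lborel_inverse_1_plus_square:
  shows integrable_lborel_inverse_1_plus_square: "integrable lborel (\<lambda>x::real. 1 / (1 + x^2))"
    and integral_lborel_inverse_1_plus_square: "(LINT x|lborel. 1 / (1 + x^2)) = pi"
  using integrable_inverse_1_plus_square LBINT_inverse_1_plus_square
  by (simp_all add: set_integrable_def interval_lebesgue_integral_def set_lebesgue_integral_def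
      einterval_eq_UNIV inverse_eq_divide)

lemma integral_symmetric_interval_tendsto:
  fixes h :: "real \<Rightarrow> complex"
  assumes h: "integrable lborel h"
  shows "(\<lambda>n. integral {- real n..real n} h) \<longlonglongrightarrow> (LINT x|lborel. h x)"
proof -
  have [measurable]: "h \<in> borel_measurable borel" using h by auto
  have "integral {- real n..real n} h = (LINT x|lborel. indicator {- real n..real n} x *\<^sub>R h x)" for n
    using set_borel_integral_eq_integral(2)[of "{- real n..real n}" h] h
    by (simp add: set_integrable_def set_lebesgue_integral_def integrable_mult_indicator)
  moreover have "(\<lambda>n. LINT x|lborel. indicator {- real n..real n} x *\<^sub>R h x) \<longlonglongrightarrow> (LINT x|lborel. h x)"
  proof (rule integral_dominated_convergence[where w = "\<lambda>x. cmod (h x)"])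
    show "AE x in lborel. (\<lambda>n. indicator {- real n..real n} x *\<^sub>R h x) \<longlonglongrightarrow> h x"
    proof (rule AE_I2)
      fix x :: real
      have "\<forall>\<^sub>F n in sequentially. h x = indicator {- real n..real n} x *\<^sub>R h x"
        using eventually_ge_at_top[of "nat \<lceil>\<bar>x\<bar>\<rceil>"] by eventually_elim (auto simp: indicator_def)
      then show "(\<lambda>n. indicator {- real n..real n} x *\<^sub>R h x) \<longlonglongrightarrow> h x"
        by (rule Lim_transform_eventually[OF tendsto_const])
    qed
  qed (use h in \<open>auto simp: indicator_def\<close>)
  ultimately show ?thesis by simp
qed

text \<open>On the convex strip \<open>f\<close> has a primitive. The integrals over \<open>[-n, n]\<close> at heights \<open>a\<close> and \<open>b\<close>
  differ by increments of the primitive along the two vertical sides, which are of order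
  \<open>1 / n\<^sup>2\<close>.\<close>

lemma horizontal_line_integral_shift:
  assumes "a \<le> b" and hol: "f holomorphic_on {z. a \<le> Im z \<and> Im z \<le> b}"
    and bound: "\<And>z. a \<le> Im z \<Longrightarrow> Im z \<le> b \<Longrightarrow> cmod (f z) \<le> B / (1 + (Re z)^2)"
  shows horizontal_line_integrable: "\<And>c. a \<le> c \<Longrightarrow> c \<le> b \<Longrightarrow> integrable lborel (\<lambda>x. f (of_real x + \<i> * of_real c))"
    and horizontal_line_integral_eq:
      "(CLINT x|lborel. f (of_real x + \<i> * of_real a)) = (CLINT x|lborel. f (of_real x + \<i> * of_real b))"
proof -
  let ?S = "{z. a \<le> Im z \<and> Im z \<le> b}"
  let ?l = "\<lambda>c x. of_real x + \<i> * of_real c :: complex"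
  show int: "integrable lborel (\<lambda>x. f (?l c x))" if c: "a \<le> c" "c \<le> b" for c
  proof (rule integrable_by_bound)
    show "integrable lborel (\<lambda>x. B * (1 / (1 + x^2)))"
      by (intro integrable_mult_right integrable_lborel_inverse_1_plus_square)
    have "continuous_on UNIV (\<lambda>x. f (?l c x))"
      by (rule continuous_on_compose2[OF holomorphic_on_imp_continuous_on[OF hol]])
         (use c in \<open>auto intro!: continuous_intros\<close>)
    then show "(\<lambda>x. f (?l c x)) \<in> borel_measurable lborel"
      by (simp add: borel_measurable_continuous_onI)
    have "cmod (f (?l c x)) \<le> norm (B * (1 / (1 + x^2)))" for x
      using bound[of "?l c x"] c abs_ge_self[of "B * (1 / (1 + x^2))"] by simp
    then show "AE x in lborel. cmod (f (?l c x)) \<le> norm (B * (1 / (1 + x^2)))" by simp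
  qed
  have cvS: "convex ?S"
    using convex_Int[OF convex_halfspace_Im_ge[of a] convex_halfspace_Im_le[of b]]
    by (simp add: Collect_conj_eq)
  obtain F where F: "\<And>z. z \<in> ?S \<Longrightarrow> (F has_field_derivative f z) (at z within ?S)"
  proof (rule holomorphic_convex_primitive[OF cvS finite.emptyI holomorphic_on_imp_continuous_on[OF hol]])
    fix z assume z: "z \<in> interior ?S - {}"
    have "f holomorphic_on interior ?S" using hol interior_subset by (rule holomorphic_on_subset)
    then show "f field_differentiable at z" using z by (auto intro: holomorphic_on_imp_differentiable_at)
  qed blast
  have ftc: "((\<lambda>x. f (?l c x)) has_integral F (?l c r) - F (?l c (- r))) {- r..r}"
    if c: "a \<le> c" "c \<le> b" and "r \<ge> 0" for c r
  proof (rule fundamental_theorem_of_calculus)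
    fix x assume "x \<in> {- r..r}"
    have "((\<lambda>x. ?l c x) has_vector_derivative 1) (at x within {- r..r})"
      by (auto intro!: derivative_eq_intros)
    moreover have "(F has_field_derivative f (?l c x)) (at (?l c x) within ?l c ` {- r..r})"
      by (rule DERIV_subset[OF F]) (use c in auto)
    ultimately show "((\<lambda>x. F (?l c x)) has_vector_derivative f (?l c x)) (at x within {- r..r})"
      using field_vector_diff_chain_within[of "?l c" 1 x "{- r..r}" F] by (simp add: o_def)
  qed (use \<open>r \<ge> 0\<close> in simp)
  \<comment> \<open>Mean value estimate for the primitive along the vertical segment at abscissa \<open>r\<close>.\<close>
  have side: "cmod (F (?l a r) - F (?l b r)) \<le> (b - a) * B / (1 + r^2)" for r
  proof -
    let ?V = "{z \<in> ?S. Re z = r}"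
    have "convex ?V"
      using convex_Int[OF cvS convex_hyperplane[of "1::complex" r]] by (simp add: Int_def inner_complex_def)
    then have "cmod (F (?l a r) - F (?l b r)) \<le> B / (1 + r^2) * cmod (?l a r - ?l b r)"
      by (rule field_differentiable_bound[where f' = f])
         (use \<open>a \<le> b\<close> bound in \<open>auto intro!: DERIV_subset[OF F]\<close>)
    also have "?l a r - ?l b r = \<i> * of_real (a - b)" by (simp add: algebra_simps)
    also have "cmod \<dots> = b - a" using \<open>a \<le> b\<close> by (simp add: norm_mult del: of_real_diff)
    finally show ?thesis by (simp add: mult.commute)
  qed
  define h where "h x = f (?l a x) - f (?l b x)" for x
  have h: "integrable lborel h"
    unfolding h_def using int[of a] int[of b] \<open>a \<le> b\<close> by simp
  have I: "cmod (integral {- real n..real n} h) \<le> 2 * ((b - a) * B) / (1 + (real n)^2)" for n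
  proof -
    have "(h has_integral (F (?l a n) - F (?l a (- real n))) - (F (?l b n) - F (?l b (- real n)))) {- real n..real n}"
      unfolding h_def using ftc[of a "real n"] ftc[of b "real n"] \<open>a \<le> b\<close> by (intro has_integral_diff) simp_all
    then have "integral {- real n..real n} h = (F (?l a n) - F (?l b n)) - (F (?l a (- real n)) - F (?l b (- real n)))"
      by (simp add: integral_unique)
    also have "cmod \<dots> \<le> (b - a) * B / (1 + (real n)^2) + (b - a) * B / (1 + (- real n)^2)"
      by (rule order_trans[OF norm_triangle_ineq4 add_mono[OF side side]])
    finally show ?thesis by (simp add: mult.commute)
  qed
  have "(\<lambda>n. 2 * ((b - a) * B) / (1 + (real n)^2)) \<longlonglongrightarrow> 0" by real_asymp
  then have "(\<lambda>n. integral {- real n..real n} h) \<longlonglongrightarrow> 0"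
    by (rule Lim_null_comparison[rotated]) (use I in auto)
  with integral_symmetric_interval_tendsto[OF h] have "(LINT x|lborel. h x) = 0"
    by (rule LIMSEQ_unique)
  then show "(CLINT x|lborel. f (?l a x)) = (CLINT x|lborel. f (?l b x))"
    unfolding h_def using int[of a] int[of b] \<open>a \<le> b\<close> by simp
qed

text \<open>The variable is rotated so that the transform lives on the right half-plane:
  \<open>cauchy_transform F\<close> is the Laplace transform of the Fourier transform of \<open>F\<close>, and for
  \<open>F = g\<close> it is the mean of the resolvent of multiplication by \<open>i \<omega>\<close>.\<close>

definition cauchy_transform :: "(real \<Rightarrow> complex) \<Rightarrow> complex \<Rightarrow> complex" where
  "cauchy_transform F \<mu> = (CLINT x|lborel. F x / (\<mu> - \<i> * of_real x))"

lemma Re_le_cmod_kernel: "Re \<mu> \<le> cmod (\<mu> - \<i> * of_real x)"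
  using complex_Re_le_cmod[of "\<mu> - \<i> * of_real x"] by simp

lemma cauchy_kernel_nonzero: "Re \<mu> > 0 \<Longrightarrow> \<mu> - \<i> * of_real x \<noteq> 0"
  using Re_le_cmod_kernel[of \<mu> x] by auto

lemma cauchy_kernel_le:
  assumes "Re \<mu> > 0" shows "cmod (F x / (\<mu> - \<i> * of_real x)) \<le> cmod (F x) / Re \<mu>"
  unfolding norm_divide by (rule divide_left_mono[OF Re_le_cmod_kernel])
    (use assms cauchy_kernel_nonzero[OF assms, of x] in auto)

lemma cauchy_transform_integrable:
  assumes F: "integrable lborel F" and \<mu>: "Re \<mu> > 0"
  shows "integrable lborel (\<lambda>x. F x / (\<mu> - \<i> * of_real x))"
proof (rule integrable_by_bound)
  show "integrable lborel (\<lambda>x. cmod (F x) / Re \<mu>)" using F by simp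
  have [measurable]: "F \<in> borel_measurable borel" using F by auto
  show "(\<lambda>x. F x / (\<mu> - \<i> * of_real x)) \<in> borel_measurable lborel" by measurable
qed (use cauchy_kernel_le[OF \<mu>] \<mu> in auto)

lemma norm_cauchy_transform_le:
  assumes F: "integrable lborel F" and \<mu>: "Re \<mu> > 0"
  shows "cmod (cauchy_transform F \<mu>) \<le> (LINT x|lborel. cmod (F x)) / Re \<mu>"
proof -
  have "cmod (cauchy_transform F \<mu>) \<le> (LINT x|lborel. cmod (F x) / Re \<mu>)"
    unfolding cauchy_transform_def
    by (rule norm_lebesgue_integral_le) (use cauchy_transform_integrable[OF F \<mu>] F cauchy_kernel_le[OF \<mu>] in auto)
  then show ?thesis by simp
qed

text \<open>The resolvent identity. The difference quotient is again a Cauchy transform, so Lipschitz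
  continuity and complex differentiability follow without differentiating under the integral.\<close>

lemma cauchy_transform_diff:
  assumes F: "integrable lborel F" and \<mu>: "Re \<mu> > 0" and \<nu>: "Re \<nu> > 0"
  shows "cauchy_transform F \<nu> - cauchy_transform F \<mu> =
    - (\<nu> - \<mu>) * cauchy_transform (\<lambda>x. F x / (\<mu> - \<i> * of_real x)) \<nu>"
proof -
  have "cauchy_transform F \<nu> - cauchy_transform F \<mu> =
      (CLINT x|lborel. F x / (\<nu> - \<i> * of_real x) - F x / (\<mu> - \<i> * of_real x))"
    unfolding cauchy_transform_def
    by (rule Bochner_Integration.integral_diff[symmetric]) (intro cauchy_transform_integrable F \<mu> \<nu>)+
  also have "\<dots> = (CLINT x|lborel. - (\<nu> - \<mu>) * (F x / (\<mu> - \<i> * of_real x) / (\<nu> - \<i> * of_real x)))"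
    using cauchy_kernel_nonzero[OF \<mu>] cauchy_kernel_nonzero[OF \<nu>]
    by (intro Bochner_Integration.integral_cong refl) (simp add: divide_simps, simp add: algebra_simps)
  also have "\<dots> = - (\<nu> - \<mu>) * cauchy_transform (\<lambda>x. F x / (\<mu> - \<i> * of_real x)) \<nu>"
    unfolding cauchy_transform_def by (rule integral_mult_right_zero)
  finally show ?thesis .
qed

lemma cauchy_transform_lipschitz:
  assumes F: "integrable lborel F" and \<mu>: "Re \<mu> > 0" and \<nu>: "Re \<nu> > 0"
  shows "cmod (cauchy_transform F \<nu> - cauchy_transform F \<mu>) \<le>
    cmod (\<nu> - \<mu>) * ((LINT x|lborel. cmod (F x)) / (Re \<mu> * Re \<nu>))"
proof -
  let ?G = "\<lambda>x. F x / (\<mu> - \<i> * of_real x)"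
  note G = cauchy_transform_integrable[OF F \<mu>]
  have "(LINT x|lborel. cmod (?G x)) \<le> (LINT x|lborel. cmod (F x) / Re \<mu>)"
    using G F cauchy_kernel_le[OF \<mu>] by (intro integral_mono) auto
  then have "(LINT x|lborel. cmod (?G x)) / Re \<nu> \<le> (LINT x|lborel. cmod (F x)) / Re \<mu> / Re \<nu>"
    using \<nu> by (intro divide_right_mono) auto
  with norm_cauchy_transform_le[OF G \<nu>]
  have "cmod (cauchy_transform ?G \<nu>) \<le> (LINT x|lborel. cmod (F x)) / (Re \<mu> * Re \<nu>)"
    by (simp add: divide_divide_eq_left)
  then show ?thesis
    unfolding cauchy_transform_diff[OF F \<mu> \<nu>] norm_mult norm_minus_cancel
    by (rule mult_left_mono) simp
qed

lemma cauchy_transform_continuous: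
  assumes F: "integrable lborel F"
  shows "continuous_on {\<mu>. Re \<mu> > 0} (cauchy_transform F)"
  unfolding continuous_on_def
proof
  let ?H = "\<lambda>\<mu>. at \<mu> within {\<mu>. Re \<mu> > 0}"
  fix \<mu> :: complex assume "\<mu> \<in> {\<mu>. Re \<mu> > 0}"
  then have \<mu>: "Re \<mu> > 0" by simp
  let ?I = "LINT x|lborel. cmod (F x)"
  have "((\<lambda>\<nu>. cmod (\<nu> - \<mu>) * (?I / (Re \<mu> * Re \<nu>))) \<longlongrightarrow> cmod (\<mu> - \<mu>) * (?I / (Re \<mu> * Re \<mu>)))
      (?H \<mu>)"
    by (intro tendsto_intros) (use \<mu> in auto)
  then have "((\<lambda>\<nu>. cmod (\<nu> - \<mu>) * (?I / (Re \<mu> * Re \<nu>))) \<longlongrightarrow> 0) (?H \<mu>)" by simp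
  then have "((\<lambda>\<nu>. cauchy_transform F \<nu> - cauchy_transform F \<mu>) \<longlongrightarrow> 0) (?H \<mu>)"
    by (rule Lim_null_comparison[rotated])
       (use cauchy_transform_lipschitz[OF F \<mu>] in \<open>auto simp: eventually_at_filter\<close>)
  then show "(cauchy_transform F \<longlongrightarrow> cauchy_transform F \<mu>) (?H \<mu>)"
    by (simp add: LIM_zero_iff)
qed

lemma cauchy_transform_holomorphic:
  assumes F: "integrable lborel F"
  shows "cauchy_transform F holomorphic_on {\<mu>. Re \<mu> > 0}"
  unfolding holomorphic_on_def field_differentiable_def
proof (intro ballI exI)
  let ?H = "\<lambda>\<mu>. at \<mu> within {\<mu>. Re \<mu> > 0}"
  fix \<mu> :: complex assume "\<mu> \<in> {\<mu>. Re \<mu> > 0}"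
  then have \<mu>: "Re \<mu> > 0" by simp
  define Q where "Q = cauchy_transform (\<lambda>x. F x / (\<mu> - \<i> * of_real x))"
  have "(Q \<longlongrightarrow> Q \<mu>) (?H \<mu>)"
    using cauchy_transform_continuous[OF cauchy_transform_integrable[OF F \<mu>]] \<mu>
    unfolding Q_def continuous_on_def by blast
  then have "((\<lambda>\<nu>. - Q \<nu>) \<longlongrightarrow> - Q \<mu>) (?H \<mu>)" by (rule tendsto_minus)
  moreover have "- Q \<nu> = (cauchy_transform F \<nu> - cauchy_transform F \<mu>) / (\<nu> - \<mu>)" if "Re \<nu> > 0" "\<nu> \<noteq> \<mu>" for \<nu>
    unfolding cauchy_transform_diff[OF F \<mu> that(1)] Q_def using that(2)
    by (simp only: mult_minus_left minus_divide_left[symmetric] nonzero_mult_div_cancel_left right_minus_eq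
        not_False_eq_True)
  then have "\<forall>\<^sub>F \<nu> in ?H \<mu>. - Q \<nu> = (cauchy_transform F \<nu> - cauchy_transform F \<mu>) / (\<nu> - \<mu>)"
    by (auto simp: eventually_at_filter)
  ultimately show "(cauchy_transform F has_field_derivative - Q \<mu>) (?H \<mu>)"
    unfolding has_field_derivative_iff by (rule Lim_transform_eventually)
qed

text \<open>Write \<open>y = Im \<mu>\<close> and \<open>s = sqrt (1 + y\<^sup>2)\<close>. Bounding the kernel \<open>u = 1 / |\<mu> - i x|\<close> by
  \<open>2 u \<le> s u\<^sup>2 + 1 / s\<close> leaves the integral of \<open>u\<^sup>2 / (1 + x\<^sup>2)\<close>, and this is of order
  \<open>1 / s\<^sup>2\<close> because \<open>1 + y\<^sup>2 \<le> 2 (1 + x\<^sup>2) + 2 (1 + (y - x)\<^sup>2)\<close>. The decay of order \<open>1 / s\<close>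
  makes the product of two such transforms integrable on vertical lines.\<close>

lemma cauchy_transform_decay:
  assumes F: "integrable lborel F" and FB: "\<And>x. cmod (F x) \<le> B / (1 + x^2)" and "d > 0"
  obtains A where "A > 0" "\<And>\<mu>. Re \<mu> \<ge> d \<Longrightarrow> cmod (cauchy_transform F \<mu>) \<le> A / sqrt (1 + (Im \<mu>)^2)"
proof -
  define m where "m = min (d^2) 1"
  have m: "m > 0" "m \<le> d^2" "m \<le> 1" using \<open>d > 0\<close> by (auto simp: m_def)
  have B: "B \<ge> 0" using order_trans[OF norm_ge_zero FB[of 0]] by simp
  define A where "A = B / 2 * (4 * pi / m + pi) + 1"
  show thesis
  proof (rule that[of A])
    show "A > 0" unfolding A_def using B m by (intro add_nonneg_pos) auto
    fix \<mu> :: complex assume \<mu>d: "Re \<mu> \<ge> d"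
    then have \<mu>: "Re \<mu> > 0" using \<open>d > 0\<close> by simp
    define y where "y = Im \<mu>"
    define s where "s = sqrt (1 + y^2)"
    have s: "s \<ge> 1" "s^2 = 1 + y^2" by (auto simp: s_def)
    define p where "p x = 1 / (1 + x^2)" for x :: real
    have p: "integrable lborel p" "(LINT x|lborel. p x) = pi"
      using lborel_inverse_1_plus_square unfolding p_def by auto
    have py: "integrable lborel (\<lambda>x. p (y - x))" "(LINT x|lborel. p (y - x)) = pi"
      using lborel_integrable_real_affine[OF p(1), of "-1" y] lborel_integral_real_affine[of "-1" p y] p(2)
      by (auto simp: algebra_simps)
    define w where "w x = B * ((p x + p (y - x)) / (m * s) + p x / (2 * s))" for x
    have wi: "integrable lborel w" unfolding w_def using p py by simp
    have key: "cmod (F x / (\<mu> - \<i> * of_real x)) \<le> w x" for x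
    proof -
      have s0: "s > 0" using s(1) by simp
      define u where "u = 1 / cmod (\<mu> - \<i> * of_real x)"
      have pos: "1 + x^2 > 0" "1 + (y - x)^2 > 0" by (auto intro: add_pos_nonneg)
      have "m * (1 + (y - x)^2) \<le> d^2 + (y - x)^2"
        using m mult_right_mono[OF m(3), of "(y - x)^2"] by (simp add: distrib_left)
      also have "\<dots> \<le> (Re \<mu>)^2 + (y - x)^2" using \<mu>d \<open>d > 0\<close> by (simp add: power_mono)
      also have "\<dots> = (cmod (\<mu> - \<i> * of_real x))^2" by (simp add: cmod_power2 y_def)
      finally have "u^2 \<le> 1 / (m * (1 + (y - x)^2))"
        unfolding u_def power_divide using m pos by (simp add: frac_le)
      then have u2: "u^2 \<le> p (y - x) / m" by (simp add: p_def mult.commute)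
      define a b where "a = 1 + x^2" and "b = 1 + (y - x)^2"
      have ab: "a > 0" "b > 0" "p x = 1 / a" "p (y - x) = 1 / b"
        using pos by (auto simp: a_def b_def p_def)
      have "s^2 \<le> 2 * a + 2 * b"
        unfolding s a_def b_def using zero_le_power2[of "2 * x - y"]
        by (simp add: power2_eq_square algebra_simps)
      then have "p x * p (y - x) * s^2 \<le> 2 * (p x + p (y - x))"
        unfolding ab(3,4) using ab(1,2) by (simp add: field_simps)
      moreover have "s^2 > 0" using s(1) by simp
      ultimately have pp: "p x * p (y - x) \<le> 2 * (p x + p (y - x)) / s^2"
        by (simp only: pos_le_divide_eq)
      have "2 * u \<le> s * u^2 + 1 / s"
        using zero_le_power2[of "s * u - 1"] s by (simp add: power2_eq_square field_simps)
      also have "\<dots> \<le> s * (p (y - x) / m) + 1 / s"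
        using u2 s by (intro add_mono mult_left_mono) auto
      finally have "p x * (2 * u) \<le> p x * (s * (p (y - x) / m) + 1 / s)"
        by (rule mult_left_mono) (simp add: p_def)
      also have "\<dots> = s / m * (p x * p (y - x)) + p x / s" by (simp add: algebra_simps)
      also have "\<dots> \<le> s / m * (2 * (p x + p (y - x)) / s^2) + p x / s"
        using s m by (intro add_mono mult_left_mono pp) auto
      also have "\<dots> = 2 * ((p x + p (y - x)) / (m * s) + p x / (2 * s))"
        using s0 m(1) by (simp add: field_simps power2_eq_square)
      finally have "2 * (p x * u) \<le> 2 * ((p x + p (y - x)) / (m * s) + p x / (2 * s))"
        by (simp only: mult.left_commute[of "p x" 2 u])
      then have "p x * u \<le> (p x + p (y - x)) / (m * s) + p x / (2 * s)"
        by (rule mult_left_le_imp_le) simp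
      then have "B * (p x * u) \<le> w x" unfolding w_def by (rule mult_left_mono[OF _ B])
      moreover have "cmod (F x) * u \<le> B * p x * u"
        using FB[of x] by (intro mult_right_mono) (auto simp: p_def u_def)
      ultimately show ?thesis by (simp add: norm_divide u_def mult.assoc)
    qed
    have "cmod (cauchy_transform F \<mu>) \<le> (LINT x|lborel. w x)"
      unfolding cauchy_transform_def
      by (rule norm_lebesgue_integral_le[OF cauchy_transform_integrable[OF F \<mu>] wi key])
    also have "\<dots> = B * ((pi + pi) / (m * s) + pi / (2 * s))"
      unfolding w_def using p py by simp
    also have "\<dots> = B / 2 * (4 * pi / m + pi) / s" using m s by (simp add: field_simps)
    also have "\<dots> \<le> A / s" unfolding A_def using s by (intro divide_right_mono) auto
    finally show "cmod (cauchy_transform F \<mu>) \<le> A / sqrt (1 + (Im \<mu>)^2)" by (simp add: s_def y_def)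
  qed
qed

section \<open>Laplace transforms and Fourier inversion\<close>

text \<open>The integrand of the Laplace integral as a function on the whole line, so that Fubini and
  the Fourier inversion formula apply directly.\<close>

definition damped :: "(real \<Rightarrow> complex) \<Rightarrow> complex \<Rightarrow> real \<Rightarrow> complex" where
  "damped f \<zeta> t = indicator {0..} t *\<^sub>R (exp (- (\<zeta> * of_real t)) * f t)"

definition laplace :: "(real \<Rightarrow> complex) \<Rightarrow> complex \<Rightarrow> complex" where
  "laplace f \<zeta> = (CLINT t|lborel. damped f \<zeta> t)"

lemma integrable_decaying_exp:
  assumes "a > 0"
  shows "integrable lborel (\<lambda>t. indicator {0..} t * exp (- (a * t)) :: real)"
proof -
  have "(\<lambda>t. exp (- a * t)) absolutely_integrable_on {0..}"
    using assms by (intro nonnegative_absolutely_integrable_1 integrable_on_exp_minus_to_infinity) auto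
  then have "integrable (completion lborel) (\<lambda>t. indicator {0..} t * exp (- (a * t)))"
    by (simp add: set_integrable_def)
  moreover have "(\<lambda>t. indicator {0..} t * exp (- (a * t))) \<in> borel_measurable lborel" by measurable
  ultimately show ?thesis by (simp add: integrable_completion)
qed

lemma laplace_one:
  assumes w: "Re w > 0"
  shows integrable_damped_one: "integrable lborel (damped (\<lambda>t. 1) w)"
    and laplace_one_eq: "laplace (\<lambda>t. 1) w = 1 / w"
proof -
  show int: "integrable lborel (damped (\<lambda>t. 1) w)"
  proof (rule integrable_by_bound[OF integrable_decaying_exp[OF w]])
    show "damped (\<lambda>t. 1) w \<in> borel_measurable lborel" unfolding damped_def[abs_def] by measurable
  qed (auto simp: damped_def indicator_def)
  have w0: "w \<noteq> 0" using w by auto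
  have "((\<lambda>y. (1 - exp (- (w * of_real y))) / w) \<longlongrightarrow> laplace (\<lambda>t. 1) w) at_top"
  proof (rule Lim_transform_eventually[OF tendsto_integral_at_top[OF _ int, folded laplace_def]])
    show "\<forall>\<^sub>F y in at_top. (CLINT x|lborel. indicator {..y} x *\<^sub>R damped (\<lambda>t. 1) w x) = (1 - exp (- (w * of_real y))) / w"
      using eventually_ge_at_top[of 0]
    proof eventually_elim
      case (elim y)
      have "((\<lambda>t. exp (- (w * of_real t))) has_integral
          - exp (- (w * of_real y)) / w - - exp (- (w * of_real 0)) / w) {0..y}"
        by (rule fundamental_theorem_of_calculus[OF elim])
           (use w0 in \<open>auto intro!: derivative_eq_intros has_vector_derivative_real_field\<close>)
      then have I: "integral {0..y} (\<lambda>t. exp (- (w * of_real t))) = (1 - exp (- (w * of_real y))) / w"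
        by (simp add: integral_unique diff_divide_distrib)
      have "(CLINT x|lborel. indicator {..y} x *\<^sub>R damped (\<lambda>t. 1) w x) =
          (LINT x:{0..y}|lborel. exp (- (w * of_real x)))"
        unfolding set_lebesgue_integral_def damped_def
        by (intro Bochner_Integration.integral_cong refl) (auto simp: indicator_def)
      also have "\<dots> = integral {0..y} (\<lambda>t. exp (- (w * of_real t)))"
        by (intro set_borel_integral_eq_integral(2) borel_integrable_atLeastAtMost' continuous_intros)
      finally show ?case using I by simp
    qed
  qed simp
  moreover have "((\<lambda>y. (1 - exp (- (w * of_real y))) / w) \<longlongrightarrow> (1 - 0) / w) at_top"
  proof (intro tendsto_intros w0)
    have "((\<lambda>y. exp (- (Re w * y))) \<longlongrightarrow> 0) at_top" using w by real_asymp
    then show "((\<lambda>y. exp (- (w * of_real y))) \<longlongrightarrow> 0) at_top"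
      by (rule Lim_null_comparison[rotated]) auto
  qed
  ultimately have "laplace (\<lambda>t. 1) w = (1 - 0) / w"
    by (intro tendsto_unique[of "at_top :: real filter"]) auto
  then show "laplace (\<lambda>t. 1) w = 1 / w" by simp
qed

lemma borel_measurable_damped:
  assumes f: "continuous_on {0..} f"
  shows "damped f \<zeta> \<in> borel_measurable borel"
  unfolding damped_def[abs_def]
  by (intro borel_measurable_continuous_on_indicator continuous_intros f) auto

lemma integrable_damped:
  assumes f: "continuous_on {0..} f" and bound: "\<And>t. t \<ge> 0 \<Longrightarrow> cmod (f t) \<le> m * exp (c * t)" and "c < Re \<zeta>"
  shows "integrable lborel (damped f \<zeta>)"
proof (rule integrable_by_bound)
  let ?w = "\<lambda>t. m * (indicator {0..} t * exp (- ((Re \<zeta> - c) * t)))"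
  show "integrable lborel (\<lambda>t. ?w t)"
    using \<open>c < Re \<zeta>\<close> by (intro integrable_mult_right integrable_decaying_exp) simp
  show "AE t in lborel. norm (damped f \<zeta> t) \<le> norm (?w t)"
  proof (rule AE_I2)
    fix t :: real
    have "norm (damped f \<zeta> t) \<le> ?w t"
    proof (cases "t \<ge> 0")
      case True
      then have "exp (- (Re \<zeta> * t)) * cmod (f t) \<le> exp (- (Re \<zeta> * t)) * (m * exp (c * t))"
        by (intro mult_left_mono bound) auto
      also have "\<dots> = m * exp (- ((Re \<zeta> - c) * t))" by (simp add: algebra_simps flip: exp_add)
      finally show ?thesis using True by (simp add: damped_def norm_mult)
    qed (simp add: damped_def)
    then show "norm (damped f \<zeta> t) \<le> norm (?w t)"
      using abs_ge_self order_trans unfolding real_norm_def by blast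
  qed
qed (use borel_measurable_damped[OF f] in simp)

lemma integrable_lborel_pair_mult:
  fixes f g :: "real \<Rightarrow> complex"
  assumes f: "integrable lborel f" and g: "integrable lborel g"
    and [measurable]: "(\<lambda>(x, y). h x y) \<in> borel_measurable (lborel \<Otimes>\<^sub>M lborel)"
    and h: "\<And>x y. cmod (h x y) \<le> 1"
  shows "integrable (lborel \<Otimes>\<^sub>M lborel) (\<lambda>(x, y). f x * g y * h x y)"
proof -
  have [measurable]: "f \<in> borel_measurable borel" "g \<in> borel_measurable borel" using f g by auto
  have "integrable (lborel \<Otimes>\<^sub>M lborel) (\<lambda>(x, y). f x * g y)"
  proof (rule lborel_pair.Fubini_integrable)
    show "integrable lborel (\<lambda>x. LINT y|lborel. norm (case (x, y) of (x, y) \<Rightarrow> f x * g y))"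
      using f by (simp add: norm_mult)
    show "AE x in lborel. integrable lborel (\<lambda>y. case (x, y) of (x, y) \<Rightarrow> f x * g y)"
      using g by simp
  qed measurable
  then show ?thesis
  proof (rule integrable_by_bound)
    have "cmod (f x) * cmod (g y) * cmod (h x y) \<le> cmod (f x) * cmod (g y)" for x y
      using h[of x y] by (intro mult_left_le) auto
    then show "AE z in lborel \<Otimes>\<^sub>M lborel.
        norm (case z of (x, y) \<Rightarrow> f x * g y * h x y) \<le> norm (case z of (x, y) \<Rightarrow> f x * g y)"
      by (auto simp: norm_mult split: prod.split)
  qed measurable
qed

text \<open>Fubini, with \<open>\<integral>\<^sub>0\<^sup>\<infinity> exp(-(\<mu> - i x) t) dt = 1 / (\<mu> - i x)\<close> as the inner integral.\<close>

lemma laplace_fourier: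
  assumes F: "integrable lborel F" and \<mu>: "Re \<mu> > 0"
  shows "laplace (fourier lborel F) \<mu> = cauchy_transform F \<mu>"
proof -
  let ?d = "damped (\<lambda>t. 1) \<mu>"
  have int: "integrable (lborel \<Otimes>\<^sub>M lborel) (\<lambda>(x, t). F x * ?d t * iexp (t * x))"
    by (rule integrable_lborel_pair_mult[OF F integrable_damped_one[OF \<mu>]]) auto
  have "laplace (fourier lborel F) \<mu> = (CLINT t|lborel. (CLINT x|lborel. F x * ?d t * iexp (t * x)))"
    unfolding laplace_def
  proof (rule lebesgue_integral_cong)
    fix t
    have "damped (fourier lborel F) \<mu> t = (CLINT x|lborel. ?d t * (iexp (t * x) * F x))"
      by (simp only: integral_mult_right_zero) (simp add: damped_def fourier_def)
    then show "damped (fourier lborel F) \<mu> t = (CLINT x|lborel. F x * ?d t * iexp (t * x))"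
      by (simp add: mult_ac)
  qed
  also have "\<dots> = (CLINT x|lborel. (CLINT t|lborel. F x * ?d t * iexp (t * x)))"
    by (rule lborel_pair.Fubini_integral[OF int])
  also have "\<dots> = (CLINT x|lborel. F x / (\<mu> - \<i> * of_real x))"
  proof (rule lebesgue_integral_cong)
    fix x
    have "?d t * iexp (t * x) = damped (\<lambda>t. 1) (\<mu> - \<i> * of_real x) t" for t
      by (simp add: damped_def algebra_simps flip: exp_add)
    then have "(CLINT t|lborel. F x * ?d t * iexp (t * x)) = (CLINT t|lborel. F x * damped (\<lambda>t. 1) (\<mu> - \<i> * of_real x) t)"
      by (simp only: mult.assoc)
    also have "\<dots> = F x * laplace (\<lambda>t. 1) (\<mu> - \<i> * of_real x)"
      by (simp only: integral_mult_right_zero laplace_def)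
    also have "\<dots> = F x / (\<mu> - \<i> * of_real x)"
      using \<mu> by (simp add: laplace_one_eq)
    finally show "(CLINT t|lborel. F x * ?d t * iexp (t * x)) = F x / (\<mu> - \<i> * of_real x)" .
  qed
  finally show ?thesis by (simp add: cauchy_transform_def)
qed

text \<open>The factor \<open>exp(-\<zeta> t) = exp(-\<zeta> (t - s)) exp(-\<zeta> s)\<close> splits over the convolution; the
  indicators cut the integration over the line down to \<open>[0, t]\<close>.\<close>

lemma damped_conv:
  assumes b: "continuous_on {0..} b" and u: "continuous_on {0..} u"
  shows "damped (conv b u) \<zeta> t = (CLINT s|lborel. damped b \<zeta> (t - s) * damped u \<zeta> s)"
proof -
  have "(CLINT s|lborel. damped b \<zeta> (t - s) * damped u \<zeta> s) =
      (CLINT s|lborel. exp (- (\<zeta> * of_real t)) * (b (t - s) * (indicator {0..t} s *\<^sub>R u s)))"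
  proof (rule lebesgue_integral_cong)
    fix s
    have "exp (- (\<zeta> * of_real t)) = exp (- (\<zeta> * of_real (t - s))) * exp (- (\<zeta> * of_real s))"
      by (simp add: algebra_simps flip: exp_add)
    then show "damped b \<zeta> (t - s) * damped u \<zeta> s =
        exp (- (\<zeta> * of_real t)) * (b (t - s) * (indicator {0..t} s *\<^sub>R u s))"
      by (auto simp: damped_def indicator_def)
  qed
  also have "\<dots> = exp (- (\<zeta> * of_real t)) * conv b u t"
    by (simp only: integral_mult_right_zero conv_eq_lebesgue[OF b u])
  also have "\<dots> = damped (conv b u) \<zeta> t"
    by (cases "t \<ge> 0") (auto simp: damped_def conv_def)
  finally show ?thesis ..
qed

lemma laplace_conv:
  assumes b: "continuous_on {0..} b" and u: "continuous_on {0..} u"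
    and ib: "integrable lborel (damped b \<zeta>)" and iu: "integrable lborel (damped u \<zeta>)"
  shows "integrable lborel (damped (conv b u) \<zeta>)" "laplace (conv b u) \<zeta> = laplace b \<zeta> * laplace u \<zeta>"
proof -
  have [measurable]: "damped b \<zeta> \<in> borel_measurable borel" "damped u \<zeta> \<in> borel_measurable borel"
    using ib iu by auto
  have shift: "(LINT t|lborel. h (t - s)) = (LINT t|lborel. h t)" for h :: "real \<Rightarrow> 'b :: {banach, second_countable_topology}" and s
    using lborel_integral_real_affine[of 1 h "- s"] by simp
  have ishift: "integrable lborel (\<lambda>t. damped b \<zeta> (t - s))" for s
    using lborel_integrable_real_affine[OF ib, of 1 "- s"] by simp
  have int: "integrable (lborel \<Otimes>\<^sub>M lborel) (\<lambda>(s, t). damped b \<zeta> (t - s) * damped u \<zeta> s)"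
  proof (rule lborel_pair.Fubini_integrable)
    have "integrable lborel (\<lambda>s. (LINT t|lborel. cmod (damped b \<zeta> t)) * cmod (damped u \<zeta> s))"
      using iu by simp
    then show "integrable lborel (\<lambda>s. LINT t|lborel. norm (case (s, t) of (s, t) \<Rightarrow> damped b \<zeta> (t - s) * damped u \<zeta> s))"
      using shift[of "\<lambda>t. cmod (damped b \<zeta> t)"] by (simp add: norm_mult)
    show "AE s in lborel. integrable lborel (\<lambda>t. case (s, t) of (s, t) \<Rightarrow> damped b \<zeta> (t - s) * damped u \<zeta> s)"
      using ishift by simp
  qed measurable
  have eq: "damped (conv b u) \<zeta> = (\<lambda>t. CLINT s|lborel. damped b \<zeta> (t - s) * damped u \<zeta> s)"
    using damped_conv[OF b u] by blast
  show "integrable lborel (damped (conv b u) \<zeta>)"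
    unfolding eq using lborel_pair.integrable_snd[OF int] by simp
  have "laplace (conv b u) \<zeta> = (CLINT s|lborel. (CLINT t|lborel. damped b \<zeta> (t - s) * damped u \<zeta> s))"
    unfolding laplace_def eq by (rule lborel_pair.Fubini_integral[OF int])
  also have "\<dots> = (CLINT s|lborel. laplace b \<zeta> * damped u \<zeta> s)"
    using shift[of "damped b \<zeta>"] by (simp add: laplace_def)
  also have "\<dots> = laplace b \<zeta> * laplace u \<zeta>"
    by (simp only: integral_mult_right_zero laplace_def)
  finally show "laplace (conv b u) \<zeta> = laplace b \<zeta> * laplace u \<zeta>" .
qed

text \<open>A rescaled form of the fact that the characteristic function of the standard normal
  distribution is again Gaussian.\<close>

lemma fourier_gaussian:
  assumes "\<epsilon> > 0"
  shows "(CLINT y|lborel. iexp (y * v) * of_real (exp (- ((\<epsilon> * y)^2) / 2))) =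
    of_real (2 * pi / \<epsilon> * std_normal_density (v / \<epsilon>))"
proof -
  have char: "(CLINT z|lborel. std_normal_density z *\<^sub>R iexp (u * z)) = of_real (exp (- (u^2) / 2))" for u
    using fun_cong[OF char_std_normal_distribution, of u]
    unfolding char_def by (subst (asm) integral_density) auto
  have dens: "exp (- (z^2) / 2) = sqrt (2 * pi) * std_normal_density z" for z
    by (simp add: std_normal_density_def)
  have "(CLINT y|lborel. iexp (y * v) * of_real (exp (- ((\<epsilon> * y)^2) / 2))) =
      (1 / \<epsilon>) *\<^sub>R (CLINT z|lborel. iexp (z / \<epsilon> * v) * of_real (exp (- (z^2) / 2)))"
    using lborel_integral_real_affine[of "1 / \<epsilon>" "\<lambda>y. iexp (y * v) * of_real (exp (- ((\<epsilon> * y)^2) / 2))" 0] assms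
    by simp
  also have "(CLINT z|lborel. iexp (z / \<epsilon> * v) * of_real (exp (- (z^2) / 2))) =
      (CLINT z|lborel. of_real (sqrt (2 * pi)) * (std_normal_density z *\<^sub>R iexp (v / \<epsilon> * z)))"
    unfolding dens by (simp add: scaleR_conv_of_real mult_ac)
  also have "\<dots> = of_real (sqrt (2 * pi)) * of_real (exp (- ((v / \<epsilon>)^2) / 2))"
    by (simp only: integral_mult_right_zero char)
  also have "\<dots> = of_real (2 * pi * std_normal_density (v / \<epsilon>))"
    unfolding dens by (simp flip: of_real_mult)
  finally show ?thesis by (simp add: scaleR_conv_of_real)
qed

text \<open>Damping the inversion integral by a Gaussian of width \<open>1 / \<epsilon>\<close> turns it, by Fubini, into the
  mean of \<open>f\<close> against a normal density of width \<open>\<epsilon>\<close> around \<open>t\<close>. Both sides converge as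
  \<open>\<epsilon> \<rightarrow> 0\<close>; continuity of \<open>f\<close> is used only at \<open>t\<close>, which allows the jump of a Laplace integrand
  at \<open>0\<close>.\<close>

lemma fourier_inversion:
  fixes f :: "real \<Rightarrow> complex"
  assumes f: "integrable lborel f" and bounded: "\<And>s. cmod (f s) \<le> m" and cont: "isCont f t"
    and Fhat: "integrable lborel (fourier lborel f)"
  shows "(CLINT y|lborel. fourier lborel f (- y) * iexp (y * t)) = 2 * pi * f t"
proof -
  have [measurable]: "f \<in> borel_measurable borel" "fourier lborel f \<in> borel_measurable borel"
    using f Fhat by auto
  define e where "e n = 1 / real (Suc n)" for n
  have e: "e n > 0" for n by (simp add: e_def)
  have e0: "e \<longlonglongrightarrow> 0" unfolding e_def[abs_def] by real_asymp
  define g where "g n y = complex_of_real (exp (- ((e n * y)^2) / 2))" for n y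
  have g: "integrable lborel (g n)" for n
  proof -
    have "integrable lborel (\<lambda>y. sqrt (2 * pi) * std_normal_density (0 + e n * y))"
      by (intro integrable_mult_right lborel_integrable_real_affine) (use e[of n] in auto)
    then have "integrable lborel (\<lambda>y. exp (- ((e n * y)^2) / 2))"
      by (simp add: std_normal_density_def)
    then show ?thesis unfolding g_def by (rule integrable_of_real)
  qed
  define A where "A n = (CLINT y|lborel. fourier lborel f (- y) * iexp (y * t) * g n y)" for n
  have Fhat': "integrable lborel (\<lambda>y. fourier lborel f (- y))"
    using lborel_integrable_real_affine[OF Fhat, of "-1" 0] by simp
  have A_lim: "A \<longlonglongrightarrow> (CLINT y|lborel. fourier lborel f (- y) * iexp (y * t))"
    unfolding A_def
  proof (rule integral_dominated_convergence[where w = "\<lambda>y. cmod (fourier lborel f (- y))"])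
    have "(\<lambda>n. fourier lborel f (- y) * iexp (y * t) * g n y) \<longlonglongrightarrow>
        fourier lborel f (- y) * iexp (y * t) * of_real (exp (- ((0 * y)^2) / 2))" for y
      unfolding g_def by (intro tendsto_intros e0) auto
    then show "AE y in lborel. (\<lambda>n. fourier lborel f (- y) * iexp (y * t) * g n y) \<longlonglongrightarrow> fourier lborel f (- y) * iexp (y * t)"
      by simp
    show "AE y in lborel. cmod (fourier lborel f (- y) * iexp (y * t) * g n y) \<le> cmod (fourier lborel f (- y))" for n
      by (auto simp: norm_mult g_def intro!: mult_left_le)
    show "(\<lambda>y. fourier lborel f (- y) * iexp (y * t) * g n y) \<in> borel_measurable lborel" for n
      unfolding g_def by measurable
  qed (use Fhat' in auto)
  have A_eq: "A n = (CLINT x|lborel. 2 * pi * (std_normal_density x *\<^sub>R f (t - e n * x)))" for n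
  proof -
    have int: "integrable (lborel \<Otimes>\<^sub>M lborel) (\<lambda>(s, y). f s * g n y * iexp (y * (t - s)))"
      by (rule integrable_lborel_pair_mult[OF f g]) auto
    have "A n = (CLINT y|lborel. (CLINT s|lborel. f s * g n y * iexp (y * (t - s))))"
      unfolding A_def
    proof (rule lebesgue_integral_cong)
      fix y
      have "fourier lborel f (- y) * iexp (y * t) * g n y = iexp (y * t) * g n y * fourier lborel f (- y)"
        by simp
      also have "\<dots> = (CLINT s|lborel. iexp (y * t) * g n y * (iexp (- y * s) * f s))"
        by (simp only: integral_mult_right_zero fourier_def)
      also have "\<dots> = (CLINT s|lborel. f s * g n y * iexp (y * (t - s)))"
        by (intro Bochner_Integration.integral_cong refl) (simp add: algebra_simps exp_diff exp_minus divide_inverse)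
      finally show "fourier lborel f (- y) * iexp (y * t) * g n y = (CLINT s|lborel. f s * g n y * iexp (y * (t - s)))" .
    qed
    also have "\<dots> = (CLINT s|lborel. (CLINT y|lborel. f s * g n y * iexp (y * (t - s))))"
      by (rule lborel_pair.Fubini_integral[OF int])
    also have "\<dots> = (CLINT s|lborel. f s * of_real (2 * pi / e n * std_normal_density ((t - s) / e n)))"
    proof (rule lebesgue_integral_cong)
      fix s
      have "(CLINT y|lborel. f s * g n y * iexp (y * (t - s))) = (CLINT y|lborel. f s * (iexp (y * (t - s)) * g n y))"
        by (simp add: mult_ac)
      also have "\<dots> = f s * of_real (2 * pi / e n * std_normal_density ((t - s) / e n))"
        unfolding g_def by (simp only: integral_mult_right_zero fourier_gaussian[OF e])
      finally show "(CLINT y|lborel. f s * g n y * iexp (y * (t - s))) = f s * of_real (2 * pi / e n * std_normal_density ((t - s) / e n))" .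
    qed
    also have "\<dots> = e n *\<^sub>R (CLINT x|lborel. f (t + - e n * x) * of_real (2 * pi / e n * std_normal_density x))"
      using lborel_integral_real_affine[of "- e n" "\<lambda>s. f s * of_real (2 * pi / e n * std_normal_density ((t - s) / e n))" t] e[of n]
      by simp
    also have "\<dots> = (CLINT x|lborel. e n *\<^sub>R (f (t + - e n * x) * of_real (2 * pi / e n * std_normal_density x)))"
      by simp
    also have "\<dots> = (CLINT x|lborel. 2 * pi * (std_normal_density x *\<^sub>R f (t - e n * x)))"
      using e[of n] by (intro Bochner_Integration.integral_cong refl) (simp add: scaleR_conv_of_real)
    finally show ?thesis .
  qed
  have "A \<longlonglongrightarrow> (CLINT x|lborel. 2 * pi * (std_normal_density x *\<^sub>R f t))"
    unfolding A_eq
  proof (rule integral_dominated_convergence[where w = "\<lambda>x. 2 * pi * (std_normal_density x * m)"])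
    have "(\<lambda>n. f (t - e n * x)) \<longlonglongrightarrow> f t" for x
    proof (rule isCont_tendsto_compose[OF cont])
      have "(\<lambda>n. t - e n * x) \<longlonglongrightarrow> t - 0 * x" by (intro tendsto_intros e0)
      then show "(\<lambda>n. t - e n * x) \<longlonglongrightarrow> t" by simp
    qed
    then show "AE x in lborel. (\<lambda>n. 2 * pi * (std_normal_density x *\<^sub>R f (t - e n * x))) \<longlonglongrightarrow> 2 * pi * (std_normal_density x *\<^sub>R f t)"
      by (auto intro!: tendsto_intros)
    show "AE x in lborel. cmod (2 * pi * (std_normal_density x *\<^sub>R f (t - e n * x))) \<le> 2 * pi * (std_normal_density x * m)" for n
      by (intro AE_I2) (simp add: norm_mult mult.commute[of m] mult_left_mono bounded)
  qed auto
  also have "(CLINT x|lborel. 2 * pi * (std_normal_density x *\<^sub>R f t)) = 2 * pi * f t"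
    by simp
  finally show ?thesis using A_lim LIMSEQ_unique by blast
qed

section \<open>Decay of convolutions with a Volterra solution\<close>

text \<open>If \<open>F\<close> is the restriction to the line at height \<open>\<delta>\<close> of a function that is holomorphic and
  decays in the strip, then for \<open>t \<ge> 0\<close> this is the Fourier integral of that function over the
  real line. The factor \<open>exp(-\<delta> t)\<close> shifts the Laplace transform by \<open>\<delta>\<close>.\<close>

definition decaying_kernel :: "real \<Rightarrow> (real \<Rightarrow> complex) \<Rightarrow> real \<Rightarrow> complex" where
  "decaying_kernel \<delta> F t = exp (- (of_real \<delta> * of_real t)) * fourier lborel F t"

lemma damped_decaying_kernel:
  "damped (decaying_kernel \<delta> F) \<zeta> = damped (fourier lborel F) (\<zeta> + of_real \<delta>)"
  by (simp add: damped_def decaying_kernel_def fun_eq_iff algebra_simps flip: exp_add)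

lemma continuous_on_decaying_kernel:
  "integrable lborel F \<Longrightarrow> continuous_on A (decaying_kernel \<delta> F)"
  unfolding decaying_kernel_def[abs_def]
  by (intro continuous_intros continuous_on_fourier sets_lborel)

lemma laplace_decaying_kernel:
  assumes F: "integrable lborel F" and \<zeta>: "Re \<zeta> > - \<delta>"
  shows "integrable lborel (damped (decaying_kernel \<delta> F) \<zeta>)"
    and "laplace (decaying_kernel \<delta> F) \<zeta> = cauchy_transform F (\<zeta> + of_real \<delta>)"
proof -
  show "integrable lborel (damped (decaying_kernel \<delta> F) \<zeta>)"
    unfolding damped_decaying_kernel
    by (rule integrable_damped[OF continuous_on_fourier[OF sets_lborel F], where c = 0 and m = "LINT x|lborel. cmod (F x)"])
       (use \<zeta> norm_fourier_le[OF sets_lborel F] in auto)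
  show "laplace (decaying_kernel \<delta> F) \<zeta> = cauchy_transform F (\<zeta> + of_real \<delta>)"
    using laplace_fourier[OF F, of "\<zeta> + of_real \<delta>"] \<zeta>
    by (simp add: laplace_def damped_decaying_kernel)
qed

text \<open>The absence of zeros in the closed right half-plane becomes a uniform lower bound on a strip
  that reaches slightly to the left. For large imaginary part the transform is small, on the
  remaining compact rectangle the modulus has a positive minimum, and Lipschitz continuity
  carries the bound across the imaginary axis.\<close>

lemma characteristic_function_lower_bound:
  fixes \<kappa> :: complex
  assumes F: "integrable lborel F" and FB: "\<And>x. cmod (F x) \<le> B / (1 + x^2)" and "\<delta> > 0"
    and nz: "\<And>\<zeta>. Re \<zeta> \<ge> 0 \<Longrightarrow> 1 - \<kappa> * cauchy_transform F (\<zeta> + of_real \<delta>) \<noteq> 0"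
  obtains \<epsilon> m where "0 < \<epsilon>" "\<epsilon> \<le> \<delta> / 2" "m > 0"
    "\<And>\<zeta>. - \<epsilon> \<le> Re \<zeta> \<Longrightarrow> Re \<zeta> \<le> \<sigma> \<Longrightarrow> m \<le> cmod (1 - \<kappa> * cauchy_transform F (\<zeta> + of_real \<delta>))"
proof -
  let ?c = "\<lambda>\<zeta>. cauchy_transform F (\<zeta> + of_real \<delta>)"
  let ?h = "\<lambda>\<zeta>. 1 - \<kappa> * ?c \<zeta>"
  obtain A where A: "A > 0" "\<And>\<mu>. Re \<mu> \<ge> \<delta> \<Longrightarrow> cmod (cauchy_transform F \<mu>) \<le> A / sqrt (1 + (Im \<mu>)^2)"
    using cauchy_transform_decay[OF F FB \<open>\<delta> > 0\<close>] by blast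
  \<comment> \<open>Beyond height \<open>Y\<close> the transform times \<open>\<kappa>\<close> has modulus at most \<open>1 / 2\<close>.\<close>
  define Y where "Y = 2 * cmod \<kappa> * A"
  have far: "1 / 2 \<le> cmod (?h \<zeta>)" if "Re \<zeta> \<ge> 0" "\<bar>Im \<zeta>\<bar> \<ge> Y" for \<zeta>
  proof -
    have "Y \<le> sqrt (1 + (Im \<zeta>)^2)"
      using that(2) real_sqrt_le_mono[of "(Im \<zeta>)^2" "1 + (Im \<zeta>)^2"] by simp
    moreover have s: "sqrt (1 + (Im \<zeta>)^2) > 0" by (simp add: add_pos_nonneg)
    moreover have "cmod \<kappa> * cmod (?c \<zeta>) \<le> cmod \<kappa> * (A / sqrt (1 + (Im \<zeta>)^2))"
      using A(2)[of "\<zeta> + of_real \<delta>"] that(1) by (intro mult_left_mono) auto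
    moreover have "cmod \<kappa> * (A / sqrt (1 + (Im \<zeta>)^2)) \<le> 1 / 2"
      using calculation(1) s by (simp add: Y_def field_simps)
    ultimately have "cmod (\<kappa> * ?c \<zeta>) \<le> 1 / 2"
      unfolding norm_mult by linarith
    then show ?thesis
      using norm_triangle_ineq2[of 1 "\<kappa> * ?c \<zeta>"] by simp
  qed
  define K where "K = cbox (Complex 0 (- \<bar>Y\<bar>)) (Complex \<bar>\<sigma>\<bar> \<bar>Y\<bar>)"
  have contK: "continuous_on K (\<lambda>\<zeta>. cmod (?h \<zeta>))"
    by (intro continuous_intros continuous_on_compose2[OF cauchy_transform_continuous[OF F]])
       (use \<open>\<delta> > 0\<close> in \<open>auto simp: K_def in_cbox_complex_iff\<close>)
  have "compact K" "K \<noteq> {}"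
    by (auto simp: K_def box_ne_empty Basis_complex_def)
  from continuous_attains_inf[OF this contK] obtain z0 where
    z0: "z0 \<in> K" "\<And>\<zeta>. \<zeta> \<in> K \<Longrightarrow> cmod (?h z0) \<le> cmod (?h \<zeta>)" by blast
  define m1 where "m1 = min (1 / 2) (cmod (?h z0))"
  have "?h z0 \<noteq> 0" using z0(1) by (intro nz) (auto simp: K_def in_cbox_complex_iff)
  then have m1: "m1 > 0" unfolding m1_def by simp
  have right: "m1 \<le> cmod (?h \<zeta>)" if "Re \<zeta> \<ge> 0" "Re \<zeta> \<le> \<bar>\<sigma>\<bar>" for \<zeta>
  proof (cases "\<bar>Im \<zeta>\<bar> \<ge> Y")
    case True
    then show ?thesis using far[OF that(1)] by (simp add: m1_def)
  next
    case False
    then have "\<zeta> \<in> K" using that by (auto simp: K_def in_cbox_complex_iff)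
    then show ?thesis using z0(2)[of \<zeta>] by (simp add: m1_def)
  qed
  define I where "I = (LINT x|lborel. cmod (F x))"
  have I: "I \<ge> 0" unfolding I_def by simp
  define q where "q = 4 * (cmod \<kappa> * I + 1)"
  have q: "q > 0" unfolding q_def using I by (simp add: add_nonneg_pos)
  \<comment> \<open>Small enough that a step of length \<open>\<epsilon>\<close> to the left changes the function by at most
    \<open>m1 / 2\<close>.\<close>
  define \<epsilon> where "\<epsilon> = min (\<delta> / 2) (m1 * \<delta>^2 / q)"
  have \<epsilon>: "\<epsilon> > 0" "\<epsilon> \<le> \<delta> / 2" "\<epsilon> * q \<le> m1 * \<delta>^2"
    using \<open>\<delta> > 0\<close> m1 q by (auto simp: \<epsilon>_def min_def field_simps)
  show thesis
  proof (rule that[of \<epsilon> "m1 / 2"])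
    fix \<zeta> :: complex assume \<zeta>: "- \<epsilon> \<le> Re \<zeta>" "Re \<zeta> \<le> \<sigma>"
    show "m1 / 2 \<le> cmod (?h \<zeta>)"
    proof (cases "Re \<zeta> \<ge> 0")
      case True
      then show ?thesis using right[of \<zeta>] \<zeta> m1 by simp
    next
      case False
      define \<xi> where "\<xi> = Complex 0 (Im \<zeta>)"
      have "cmod (cauchy_transform F (\<xi> + of_real \<delta>) - ?c \<zeta>) \<le>
          cmod ((\<xi> + of_real \<delta>) - (\<zeta> + of_real \<delta>)) * (I / (Re (\<zeta> + of_real \<delta>) * Re (\<xi> + of_real \<delta>)))"
        unfolding I_def using \<zeta> \<epsilon> \<open>\<delta> > 0\<close> by (intro cauchy_transform_lipschitz F) (auto simp: \<xi>_def)
      also have "\<dots> \<le> \<epsilon> * (I / (\<delta> / 2 * \<delta>))"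
      proof (intro mult_mono divide_left_mono I)
        have "\<xi> - \<zeta> = of_real (- Re \<zeta>)" by (simp add: \<xi>_def complex_eq_iff)
        then show "cmod ((\<xi> + of_real \<delta>) - (\<zeta> + of_real \<delta>)) \<le> \<epsilon>"
          using \<zeta> False by (simp del: of_real_minus)
      qed (use \<zeta> \<epsilon> \<open>\<delta> > 0\<close> I in \<open>auto simp: \<xi>_def intro!: divide_nonneg_nonneg mult_nonneg_nonneg mult_pos_pos\<close>)
      also have "\<dots> = 2 * \<epsilon> * I / \<delta>^2" by (simp add: power2_eq_square)
      finally have "cmod \<kappa> * cmod (cauchy_transform F (\<xi> + of_real \<delta>) - ?c \<zeta>) \<le>
          cmod \<kappa> * (2 * \<epsilon> * I / \<delta>^2)" by (rule mult_left_mono) simp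
      also have "\<dots> \<le> m1 / 2"
      proof -
        have "\<epsilon> * (4 * (cmod \<kappa> * I)) \<le> \<epsilon> * q" using \<epsilon>(1) by (intro mult_left_mono) (auto simp: q_def)
        with \<epsilon>(3) have "\<epsilon> * (4 * (cmod \<kappa> * I)) \<le> m1 * \<delta>^2" by linarith
        then show ?thesis using \<open>\<delta> > 0\<close> by (simp add: field_simps)
      qed
      finally have "cmod (?h \<zeta> - ?h \<xi>) \<le> m1 / 2"
        by (simp add: norm_mult flip: right_diff_distrib)
      moreover have "m1 \<le> cmod (?h \<xi>)" by (rule right) (auto simp: \<xi>_def)
      ultimately show ?thesis
        using norm_triangle_ineq2[of "?h \<xi>" "?h \<xi> - ?h \<zeta>"] norm_minus_commute[of "?h \<xi>" "?h \<zeta>"] by simp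
    qed
  qed (use \<epsilon> m1 in auto)
qed

text \<open>The Laplace transform turns the Volterra equation into a linear equation for one number.\<close>

lemma volterra_laplace:
  fixes \<kappa> :: complex
  assumes F0: "integrable lborel F0" and F1: "integrable lborel F1" and "\<delta> > 0"
    and u: "continuous_on {0..} u" and u_bound: "\<And>t. t \<ge> 0 \<Longrightarrow> cmod (u t) \<le> m * exp (c * t)"
    and ueq: "\<And>t. t \<ge> 0 \<Longrightarrow> u t = decaying_kernel \<delta> F1 t + \<kappa> * conv (decaying_kernel \<delta> F0) u t"
    and \<zeta>: "Re \<zeta> > c" "Re \<zeta> \<ge> 0"
  shows "(1 - \<kappa> * cauchy_transform F0 (\<zeta> + of_real \<delta>)) * laplace u \<zeta> = cauchy_transform F1 (\<zeta> + of_real \<delta>)"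
proof -
  let ?k1 = "decaying_kernel \<delta> F1"
  let ?k0 = "decaying_kernel \<delta> F0"
  have \<zeta>\<delta>: "Re \<zeta> > - \<delta>" using \<zeta> \<open>\<delta> > 0\<close> by simp
  note L0 = laplace_decaying_kernel[OF F0 \<zeta>\<delta>] and L1 = laplace_decaying_kernel[OF F1 \<zeta>\<delta>]
  have iu: "integrable lborel (damped u \<zeta>)" by (rule integrable_damped[OF u u_bound \<zeta>(1)])
  note C = laplace_conv[OF continuous_on_decaying_kernel[OF F0] u L0(1) iu]
  have "damped u \<zeta> = (\<lambda>t. damped ?k1 \<zeta> t + \<kappa> * damped (conv ?k0 u) \<zeta> t)"
  proof
    fix t show "damped u \<zeta> t = damped ?k1 \<zeta> t + \<kappa> * damped (conv ?k0 u) \<zeta> t"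
      using ueq[of t] by (cases "t \<ge> 0") (auto simp: damped_def algebra_simps)
  qed
  then have "laplace u \<zeta> = laplace ?k1 \<zeta> + \<kappa> * laplace (conv ?k0 u) \<zeta>"
    unfolding laplace_def using L1(1) C(1) by simp
  then show ?thesis using L0(2) L1(2) C(2) by (simp add: algebra_simps)
qed

text \<open>The a priori bound gives only exponential growth of \<open>u\<close>, so inversion of the Laplace
  transform of the convolution first holds on the line \<open>Re \<zeta> = \<sigma>\<close> with \<open>\<sigma> > c\<close>. The transform
  of the convolution is holomorphic and of order \<open>1 / (1 + (Im \<zeta>)\<^sup>2)\<close> on \<open>-\<epsilon> \<le> Re \<zeta> \<le> \<sigma>\<close>, so
  the line can be moved to \<open>Re \<zeta> = -\<epsilon>\<close>.\<close>

lemma volterra_weak_decay: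
  fixes \<kappa> :: complex
  assumes F0: "integrable lborel F0" "\<And>x. cmod (F0 x) \<le> B / (1 + x^2)"
    and F1: "integrable lborel F1" "\<And>x. cmod (F1 x) \<le> B1 / (1 + x^2)"
    and F2: "integrable lborel F2" "\<And>x. cmod (F2 x) \<le> B2 / (1 + x^2)"
    and \<delta>: "\<delta> > 0"
    and u: "continuous_on {0..} u" and u_bound: "\<And>t. t \<ge> 0 \<Longrightarrow> cmod (u t) \<le> m * exp (c * t)" and "c > 0"
    and ueq: "\<And>t. t \<ge> 0 \<Longrightarrow> u t = decaying_kernel \<delta> F1 t + \<kappa> * conv (decaying_kernel \<delta> F0) u t"
    and nz: "\<And>\<zeta>. Re \<zeta> \<ge> 0 \<Longrightarrow> 1 - \<kappa> * cauchy_transform F0 (\<zeta> + of_real \<delta>) \<noteq> 0"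
  shows "((\<lambda>t. conv (decaying_kernel \<delta> F2) u t) \<longlongrightarrow> 0) at_top"
proof -
  let ?c = "\<lambda>F \<zeta>. cauchy_transform F (\<zeta> + of_real \<delta>)"
  define \<sigma> where "\<sigma> = c + 1"
  define w where "w = conv (decaying_kernel \<delta> F2) u"
  obtain \<epsilon> m0 where \<epsilon>: "0 < \<epsilon>" "\<epsilon> \<le> \<delta> / 2" and m0: "m0 > 0"
    "\<And>\<zeta>. - \<epsilon> \<le> Re \<zeta> \<Longrightarrow> Re \<zeta> \<le> \<sigma> \<Longrightarrow> m0 \<le> cmod (1 - \<kappa> * ?c F0 \<zeta>)"
    using characteristic_function_lower_bound[OF F0 \<delta> nz, of \<sigma>] by blast
  define W where "W \<zeta> = ?c F2 \<zeta> * ?c F1 \<zeta> /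
      (1 - \<kappa> * ?c F0 \<zeta>)" for \<zeta>
  have \<delta>2: "\<delta> / 2 > 0" using \<delta> by simp
  obtain A1 where A1: "A1 > 0" "\<And>\<mu>. Re \<mu> \<ge> \<delta> / 2 \<Longrightarrow> cmod (cauchy_transform F1 \<mu>) \<le> A1 / sqrt (1 + (Im \<mu>)^2)"
    using cauchy_transform_decay[OF F1 \<delta>2] by blast
  obtain A2 where A2: "A2 > 0" "\<And>\<mu>. Re \<mu> \<ge> \<delta> / 2 \<Longrightarrow> cmod (cauchy_transform F2 \<mu>) \<le> A2 / sqrt (1 + (Im \<mu>)^2)"
    using cauchy_transform_decay[OF F2 \<delta>2] by blast
  define D where "D = A2 * A1 / m0"
  have D: "D > 0" using A1 A2 m0 by (simp add: D_def)
  have W_bound: "cmod (W \<zeta>) \<le> D / (1 + (Im \<zeta>)^2)" if "- \<epsilon> \<le> Re \<zeta>" "Re \<zeta> \<le> \<sigma>" for \<zeta>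
  proof -
    let ?s = "sqrt (1 + (Im \<zeta>)^2)"
    have "cmod (W \<zeta>) \<le> (A2 / ?s) * (A1 / ?s) / m0"
      unfolding W_def norm_divide norm_mult
    proof (intro frac_le mult_mono m0 that)
      show "cmod (?c F2 \<zeta>) \<le> A2 / ?s"
        using A2(2)[of "\<zeta> + of_real \<delta>"] that \<epsilon> by simp
      show "cmod (?c F1 \<zeta>) \<le> A1 / ?s"
        using A1(2)[of "\<zeta> + of_real \<delta>"] that \<epsilon> by simp
    qed (use A1 A2 in auto)
    also have "\<dots> = D / (?s * ?s)" by (simp add: D_def)
    also have "?s * ?s = 1 + (Im \<zeta>)^2" by (simp add: add_nonneg_nonneg)
    finally show ?thesis .
  qed
  let ?z = "\<lambda>y. \<i> * (of_real y + \<i> * of_real (- \<sigma>))"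
  \<comment> \<open>The vertical line \<open>Re \<zeta> = \<sigma>\<close> is written as \<open>\<zeta> = i z\<close> with \<open>Im z = -\<sigma>\<close>, so that the
    shift of horizontal lines applies.\<close>
  have inversion: "2 * pi * w t = (CLINT y|lborel. W (?z y) * exp (?z y * of_real t))"
    if t: "t > 0" for t
  proof -
    define f where "f = damped w (of_real \<sigma>)"
    have cw: "continuous_on {0..} w"
      unfolding w_def by (intro continuous_on_conv continuous_on_decaying_kernel F2 u)
    have \<sigma>: "\<sigma> > c" "\<sigma> > 0" using \<open>c > 0\<close> by (auto simp: \<sigma>_def)
    define I where "I = (LINT x|lborel. cmod (F2 x))"
    have I: "I \<ge> 0" unfolding I_def by simp
    have "m \<ge> 0" using order_trans[OF norm_ge_zero u_bound[of 0]] by simp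
    have w_bound: "cmod (w s) \<le> I * m / c * exp (c * s)" if "s \<ge> 0" for s
    proof -
      have "cmod (decaying_kernel \<delta> F2 r) \<le> I" if "r \<ge> 0" for r
      proof -
        have "exp (- (\<delta> * r)) * cmod (fourier lborel F2 r) \<le> 1 * I"
          using that \<delta> norm_fourier_le[OF sets_lborel F2(1), of r] by (intro mult_mono) (auto simp: I_def)
        then show ?thesis by (simp add: decaying_kernel_def norm_mult)
      qed
      then have "cmod (conv (decaying_kernel \<delta> F2) u s) \<le> I * (m * exp (c * s) / c)"
        using \<open>c > 0\<close> that \<open>m \<ge> 0\<close>
        by (intro conv_exp_bound u u_bound continuous_on_decaying_kernel F2) auto
      then show ?thesis by (simp add: w_def)
    qed
    have fint: "integrable lborel f" unfolding f_def
      by (rule integrable_damped[OF cw w_bound]) (use \<sigma> in auto)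
    have f_bound: "cmod (f s) \<le> I * m / c" for s
    proof (cases "s \<ge> 0")
      case True
      have "exp (- (\<sigma> * s)) * cmod (w s) \<le> exp (- (c * s)) * (I * m / c * exp (c * s))"
        using True \<sigma> w_bound[OF True] by (intro mult_mono) (auto intro!: mult_right_mono)
      also have "\<dots> = I * m / c" by (simp add: exp_minus)
      finally show ?thesis using True by (simp add: f_def damped_def norm_mult)
    qed (use I \<open>m \<ge> 0\<close> \<open>c > 0\<close> in \<open>auto simp: f_def damped_def\<close>)
    have "continuous_on {0<..} (\<lambda>s. exp (- (of_real \<sigma> * of_real s)) * w s)"
      by (intro continuous_intros continuous_on_subset[OF cw]) auto
    then have "continuous_on {0<..} f"
      by (rule continuous_on_cong[THEN iffD1, rotated 2]) (auto simp: f_def damped_def)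
    then have fcont: "isCont f t" using t by (simp add: continuous_on_eq_continuous_at)
    have fourier_f: "fourier lborel f (- y) = W (of_real \<sigma> + \<i> * of_real y)" for y
    proof -
      define \<zeta> where "\<zeta> = of_real \<sigma> + \<i> * of_real y"
      have \<zeta>: "Re \<zeta> = \<sigma>" by (simp add: \<zeta>_def)
      have \<zeta>\<delta>: "Re \<zeta> > - \<delta>" using \<zeta> \<sigma> \<delta> by simp
      have iu: "integrable lborel (damped u \<zeta>)" by (rule integrable_damped[OF u u_bound]) (use \<zeta> \<sigma> in auto)
      note L2 = laplace_decaying_kernel[OF F2(1) \<zeta>\<delta>]
      have "iexp (- y * s) * f s = damped w \<zeta> s" for s
        by (auto simp: f_def damped_def \<zeta>_def indicator_def algebra_simps simp flip: exp_add)
      then have "fourier lborel f (- y) = laplace w \<zeta>" by (simp add: fourier_def laplace_def)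
      also have "\<dots> = ?c F2 \<zeta> * laplace u \<zeta>"
        unfolding w_def laplace_conv(2)[OF continuous_on_decaying_kernel[OF F2(1)] u L2(1) iu] L2(2) ..
      also have "\<dots> = W \<zeta>"
      proof -
        have "(1 - \<kappa> * ?c F0 \<zeta>) * laplace u \<zeta> = ?c F1 \<zeta>"
          using \<zeta> \<sigma> by (intro volterra_laplace[OF F0(1) F1(1) \<delta> u u_bound ueq]) auto
        from this[symmetric] show ?thesis using nz[of \<zeta>] \<zeta> \<sigma> by (simp add: W_def)
      qed
      finally show ?thesis by (simp add: \<zeta>_def)
    qed
    have Fhat: "integrable lborel (fourier lborel f)"
    proof (rule integrable_by_bound)
      show "integrable lborel (\<lambda>y. D * (1 / (1 + y^2)))"
        by (intro integrable_mult_right integrable_lborel_inverse_1_plus_square)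
      show "fourier lborel f \<in> borel_measurable lborel"
        using continuous_on_fourier[OF sets_lborel fint] by (simp add: borel_measurable_continuous_onI)
      show "AE y in lborel. cmod (fourier lborel f y) \<le> norm (D * (1 / (1 + y^2)))"
      proof (rule AE_I2)
        fix y :: real
        show "cmod (fourier lborel f y) \<le> norm (D * (1 / (1 + y^2)))"
          using W_bound[of "of_real \<sigma> + \<i> * of_real (- y)"] fourier_f[of "- y"] \<sigma> \<epsilon> D
          by (simp add: add_nonneg_nonneg)
      qed
    qed
    have "2 * pi * (exp (- (of_real \<sigma> * of_real t)) * w t) = (CLINT y|lborel. W (of_real \<sigma> + \<i> * of_real y) * iexp (y * t))"
    proof -
      have "f t = exp (- (of_real \<sigma> * of_real t)) * w t" using t by (simp add: f_def damped_def)
      then show ?thesis using fourier_inversion[OF fint f_bound fcont Fhat] unfolding fourier_f by simp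
    qed
    then have "exp (of_real \<sigma> * of_real t) * (2 * pi * (exp (- (of_real \<sigma> * of_real t)) * w t)) =
        (CLINT y|lborel. exp (of_real \<sigma> * of_real t) * (W (of_real \<sigma> + \<i> * of_real y) * iexp (y * t)))"
      by (simp only: integral_mult_right_zero)
    also have "\<dots> = (CLINT y|lborel. W (?z y) * exp (?z y * of_real t))"
    proof (rule lebesgue_integral_cong)
      fix y
      have "\<i> * (of_real y + \<i> * of_real (- \<sigma>)) = of_real \<sigma> + \<i> * of_real y"
        by (simp add: algebra_simps)
      then show "exp (of_real \<sigma> * of_real t) * (W (of_real \<sigma> + \<i> * of_real y) * iexp (y * t)) =
          W (?z y) * exp (?z y * of_real t)"
        by (simp only:) (simp add: algebra_simps exp_add)
    qed
    also have "exp (of_real \<sigma> * of_real t) * (2 * pi * (exp (- (of_real \<sigma> * of_real t)) * w t)) =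
        exp (of_real \<sigma> * of_real t) * exp (- (of_real \<sigma> * of_real t)) * (2 * pi * w t)"
      by (simp only: mult_ac)
    finally show ?thesis by (simp only: exp_minus_inverse mult_1)
  qed
  have w_decay: "cmod (w t) \<le> D * exp (- (\<epsilon> * t))" if t: "t > 0" for t
  proof -
    define f where "f z = W (\<i> * z) * exp (\<i> * z * of_real t)" for z
    let ?S = "{z. - \<sigma> \<le> Im z \<and> Im z \<le> \<epsilon>}"
    have comp: "(\<lambda>z. cauchy_transform F (\<i> * z + of_real \<delta>)) holomorphic_on ?S" if "integrable lborel F" for F
      by (rule holomorphic_on_compose_gen[OF _ cauchy_transform_holomorphic[OF that], unfolded o_def])
         (use \<epsilon> \<delta> in \<open>auto intro!: holomorphic_intros\<close>)
    have hol: "f holomorphic_on ?S"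
      unfolding f_def W_def
    proof (intro holomorphic_intros comp F0 F1 F2)
      fix z assume "z \<in> ?S"
      then show "1 - \<kappa> * cauchy_transform F0 (\<i> * z + of_real \<delta>) \<noteq> 0"
        using m0(1) m0(2)[of "\<i> * z"] by auto
    qed
    have norm_exp: "cmod (exp (\<i> * z * of_real t)) = exp (- (Im z * t))" for z by simp
    have bound: "cmod (f z) \<le> D * exp (\<sigma> * t) / (1 + (Re z)^2)" if "- \<sigma> \<le> Im z" "Im z \<le> \<epsilon>" for z
    proof -
      have "cmod (W (\<i> * z)) \<le> D / (1 + (Re z)^2)"
        using W_bound[of "\<i> * z"] that by simp
      moreover have "- (Im z * t) \<le> \<sigma> * t"
        using mult_right_mono[OF that(1), of t] t by simp
      moreover have "D / (1 + (Re z)^2) \<ge> 0" using D by (simp add: add_nonneg_nonneg)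
      ultimately have "cmod (W (\<i> * z)) * exp (- (Im z * t)) \<le> D / (1 + (Re z)^2) * exp (\<sigma> * t)"
        by (intro mult_mono) auto
      then show ?thesis unfolding f_def norm_mult[of "W _"] norm_exp by simp
    qed
    have "- \<sigma> \<le> \<epsilon>" using \<epsilon> \<open>c > 0\<close> by (simp add: \<sigma>_def)
    note shift = horizontal_line_integral_shift[OF this hol bound]
    have "2 * pi * w t = (CLINT y|lborel. f (of_real y + \<i> * of_real (- \<sigma>)))"
      using inversion[OF t] by (simp only: f_def)
    also have "\<dots> = (CLINT y|lborel. f (of_real y + \<i> * of_real \<epsilon>))" by (rule shift(2))
    finally have "cmod (2 * pi * w t) = cmod (CLINT y|lborel. f (of_real y + \<i> * of_real \<epsilon>))" by simp
    also have "\<dots> \<le> (LINT y|lborel. D * exp (- (\<epsilon> * t)) * (1 / (1 + y^2)))"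
    proof (rule norm_lebesgue_integral_le)
      show "integrable lborel (\<lambda>y. f (of_real y + \<i> * of_real \<epsilon>))"
        using \<open>- \<sigma> \<le> \<epsilon>\<close> by (intro shift(1)) auto
      show "integrable lborel (\<lambda>y. D * exp (- (\<epsilon> * t)) * (1 / (1 + y^2)))"
        by (intro integrable_mult_right integrable_lborel_inverse_1_plus_square)
      fix y
      have "cmod (W (\<i> * (of_real y + \<i> * of_real \<epsilon>))) \<le> D / (1 + y^2)"
        using W_bound[of "\<i> * (of_real y + \<i> * of_real \<epsilon>)"] \<open>- \<sigma> \<le> \<epsilon>\<close> \<epsilon> \<open>c > 0\<close> by (simp add: \<sigma>_def)
      then have "cmod (W (\<i> * (of_real y + \<i> * of_real \<epsilon>))) * exp (- (\<epsilon> * t)) \<le> D / (1 + y^2) * exp (- (\<epsilon> * t))"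
        by (rule mult_right_mono) simp
      then show "cmod (f (of_real y + \<i> * of_real \<epsilon>)) \<le> D * exp (- (\<epsilon> * t)) * (1 / (1 + y^2))"
        unfolding f_def norm_mult[of "W _"] norm_exp by simp
    qed
    also have "\<dots> = D * exp (- (\<epsilon> * t)) * pi"
      by (simp only: integral_mult_right_zero integral_lborel_inverse_1_plus_square)
    finally have "2 * cmod (w t) \<le> D * exp (- (\<epsilon> * t))" by (simp add: norm_mult)
    then show ?thesis using norm_ge_zero[of "w t"] by linarith
  qed
  have "((\<lambda>t. D * exp (- (\<epsilon> * t))) \<longlongrightarrow> 0) at_top" using \<epsilon>(1) by real_asymp
  then have "(w \<longlongrightarrow> 0) at_top"
    by (rule Lim_null_comparison[rotated])
       (use w_decay in \<open>auto intro!: eventually_mono[OF eventually_gt_at_top[of 0]]\<close>)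
  then show ?thesis by (simp add: w_def)
qed

section \<open>Boundary values of the Cauchy transform and absence of eigenvalues\<close>

text \<open>The substitution that puts the scale \<open>\<epsilon>\<close> into the argument of \<open>g\<close> keeps the kernel fixed, so
  dominated convergence applies for every integrable kernel, of any sign.\<close>

lemma approximate_identity:
  fixes g k :: "real \<Rightarrow> real"
  assumes g: "continuous_on UNIV g" and gC: "\<And>x. \<bar>g x\<bar> \<le> C" and k: "integrable lborel k"
  shows "((\<lambda>\<epsilon>. LINT v|lborel. g (y + \<epsilon> * v) * k v) \<longlongrightarrow> g y * (LINT v|lborel. k v)) (at_right 0)"
proof (rule tendsto_at_right_sequentially[where b = 1])
  fix X :: "nat \<Rightarrow> real" assume X: "X \<longlonglongrightarrow> 0"
  have [measurable]: "g \<in> borel_measurable borel" "k \<in> borel_measurable borel"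
    using g k by (auto intro: borel_measurable_continuous_onI)
  have "(\<lambda>n. LINT v|lborel. g (y + X n * v) * k v) \<longlonglongrightarrow> (LINT v|lborel. g y * k v)"
  proof (rule integral_dominated_convergence[where w = "\<lambda>v. C * \<bar>k v\<bar>"])
    have "(\<lambda>n. g (y + X n * v)) \<longlonglongrightarrow> g y" for v
    proof (rule isCont_tendsto_compose[of y g])
      show "isCont g y" using g by (simp add: continuous_on_eq_continuous_at)
      have "(\<lambda>n. y + X n * v) \<longlonglongrightarrow> y + 0 * v" by (intro tendsto_intros X)
      then show "(\<lambda>n. y + X n * v) \<longlonglongrightarrow> y" by simp
    qed
    then show "AE v in lborel. (\<lambda>n. g (y + X n * v) * k v) \<longlonglongrightarrow> g y * k v"
      by (intro AE_I2 tendsto_intros)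
    show "AE v in lborel. norm (g (y + X n * v) * k v) \<le> C * \<bar>k v\<bar>" for n
      by (auto simp: abs_mult intro!: mult_right_mono gC)
  qed (use k in auto)
  then show "(\<lambda>n. LINT v|lborel. g (y + X n * v) * k v) \<longlonglongrightarrow> g y * (LINT v|lborel. k v)"
    by simp
qed simp

text \<open>The difference between the conjugate Poisson kernel and the truncated kernel \<open>1 / v\<close> of the
  principal value, both at scale one. Being odd and of order \<open>1 / (1 + v\<^sup>2)\<close>, it has integral
  zero, so both regularizations of the singular integral have the same limit.\<close>

definition poisson_defect :: "real \<Rightarrow> real" where
  "poisson_defect v = v / (1 + v^2) - indicator {v. 1 < \<bar>v\<bar>} v / v"

lemma poisson_defect:
  shows integrable_poisson_defect: "integrable lborel poisson_defect"
    and integral_poisson_defect: "(LINT v|lborel. poisson_defect v) = 0"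
proof -
  have bound: "\<bar>poisson_defect v\<bar> \<le> 2 * (1 / (1 + v^2))" for v
  proof (cases "1 < \<bar>v\<bar>")
    case True
    then have v: "v \<noteq> 0" "1 + v^2 > 0" by (auto intro: add_pos_nonneg)
    have "poisson_defect v = - (1 / v * (1 / (1 + v^2)))"
      using True v by (simp add: poisson_defect_def divide_simps power2_eq_square)
    then have "\<bar>poisson_defect v\<bar> = 1 / \<bar>v\<bar> * (1 / (1 + v^2))"
      using v by (simp add: abs_mult)
    also have "\<dots> \<le> 2 * (1 / (1 + v^2))"
      using True v by (intro mult_right_mono) (auto simp: divide_simps)
    finally show ?thesis .
  next
    case False
    have "1 + v^2 > 0" by (auto intro: add_pos_nonneg)
    then have "\<bar>poisson_defect v\<bar> = \<bar>v\<bar> * (1 / (1 + v^2))"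
      using False by (simp add: poisson_defect_def)
    also have "\<dots> \<le> 2 * (1 / (1 + v^2))" using False by (intro mult_right_mono) auto
    finally show ?thesis .
  qed
  have [measurable]: "poisson_defect \<in> borel_measurable borel"
    unfolding poisson_defect_def[abs_def] by measurable
  show "integrable lborel poisson_defect"
  proof (rule integrable_by_bound)
    show "integrable lborel (\<lambda>v::real. 2 * (1 / (1 + v^2)))"
      by (intro integrable_mult_right integrable_lborel_inverse_1_plus_square)
    show "AE v in lborel. norm (poisson_defect v) \<le> norm (2 * (1 / (1 + v^2)))"
      using order_trans[OF bound abs_ge_self] by simp
  qed measurable
  \<comment> \<open>The kernel is odd.\<close>
  have "poisson_defect (0 + - 1 * v) = - poisson_defect v" for v
    by (simp add: poisson_defect_def indicator_def)
  then have "(LINT v|lborel. poisson_defect v) = - (LINT v|lborel. poisson_defect v)"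
    using lborel_integral_real_affine[of "- 1" poisson_defect 0] by simp
  then show "(LINT v|lborel. poisson_defect v) = 0" by simp
qed

locale strip_density =
  fixes g :: "real \<Rightarrow> real" and G :: "complex \<Rightarrow> complex" and \<delta> C :: real
  assumes density: "prob_density g"
    and \<delta>_pos: "\<delta> > 0"
    and continuation: "analytic_continuation g G (strip \<delta>)"
    and decay: "\<And>z. z \<in> strip \<delta> \<Longrightarrow> cmod (G z) \<le> C / (1 + (cmod z)^2)"
begin

lemma G_real: "G (of_real x) = of_real (g x)"
  using continuation \<delta>_pos by (simp add: analytic_continuation_def strip_def)

lemma G_holomorphic: "G holomorphic_on strip \<delta>"
  using continuation by (simp add: analytic_continuation_def analytic_imp_holomorphic)

lemma g_nonneg: "g x \<ge> 0"
  using density by (simp add: prob_density_def)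

lemma C_nonneg: "C \<ge> 0"
  using order_trans[OF norm_ge_zero decay[of 0]] \<delta>_pos by (simp add: strip_def)

lemma G_bound:
  assumes "z \<in> strip \<delta>" shows "cmod (G z) \<le> C / (1 + (Re z)^2)"
proof -
  have "(Re z)^2 \<le> (cmod z)^2" by (simp add: cmod_power2)
  then have "C / (1 + (cmod z)^2) \<le> C / (1 + (Re z)^2)"
    by (intro divide_left_mono C_nonneg mult_pos_pos) (auto intro: add_pos_nonneg)
  then show ?thesis using decay[OF assms] by simp
qed

lemma g_bound: "\<bar>g x\<bar> \<le> C"
proof -
  have "\<bar>g x\<bar> \<le> C / (1 + x^2)"
    using G_bound[of "of_real x"] \<delta>_pos by (simp add: strip_def G_real)
  also have "\<dots> \<le> C / 1" by (intro divide_left_mono C_nonneg) (auto intro: add_pos_nonneg)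
  finally show ?thesis by simp
qed

lemma g_continuous: "continuous_on UNIV g"
proof -
  have "continuous_on UNIV (\<lambda>x. Re (G (of_real x)))"
    by (intro continuous_intros continuous_on_compose2[OF holomorphic_on_imp_continuous_on[OF G_holomorphic]])
       (use \<delta>_pos in \<open>auto simp: strip_def\<close>)
  then show ?thesis by (simp add: G_real)
qed

lemma g_measurable [measurable]: "g \<in> borel_measurable borel"
  by (rule borel_measurable_continuous_onI[OF g_continuous])

lemma g_integrable: "integrable lborel g"
  using density by (simp add: prob_density_def)

lemma of_real_g_integrable: "integrable lborel (\<lambda>x. complex_of_real (g x))"
  using g_integrable by (rule integrable_of_real)

lemma weighted_real_distribution: "real_distribution (weighted g)"
proof -
  have "prob_space (weighted g)"
  proof
    have "emeasure (weighted g) (space (weighted g)) = (\<integral>\<^sup>+x. ennreal (g x) \<partial>lborel)"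
      unfolding weighted_def by (subst emeasure_density) auto
    also have "\<dots> = ennreal (LINT x|lborel. g x)"
      by (rule nn_integral_eq_integral[OF g_integrable]) (simp add: g_nonneg)
    also have "\<dots> = 1" using density by (simp add: prob_density_def)
    finally show "emeasure (weighted g) (space (weighted g)) = 1" .
  qed
  then show ?thesis
    by (simp add: real_distribution_def real_distribution_axioms_def weighted_def)
qed

sublocale real_distribution "weighted g"
  by (rule weighted_real_distribution)

lemma integral_weighted:
  fixes f :: "real \<Rightarrow> complex"
  assumes "f \<in> borel_measurable borel"
  shows "(CLINT x|weighted g. f x) = (CLINT x|lborel. f x * of_real (g x))"
  unfolding weighted_def
  by (subst integral_density) (use assms g_nonneg in \<open>auto simp: scaleR_conv_of_real mult.commute\<close>)

text \<open>The boundary values of \<open>p G\<close> on the upper edge of the strip, parametrized by the real part.\<close>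

definition upper_edge :: "(complex \<Rightarrow> complex) \<Rightarrow> real \<Rightarrow> complex" where
  "upper_edge p x = p (of_real x + \<i> * of_real \<delta>) * G (of_real x + \<i> * of_real \<delta>)"

lemma upper_edge_shift:
  assumes hol: "f holomorphic_on strip \<delta>" and b: "\<And>z. z \<in> strip \<delta> \<Longrightarrow> cmod (f z) \<le> b"
  shows "integrable lborel (upper_edge f)"
    and "cmod (upper_edge f x) \<le> b * C / (1 + x^2)"
    and "(CLINT x|lborel. f (of_real x) * of_real (g x)) = (CLINT x|lborel. upper_edge f x)"
proof -
  have "(\<lambda>z. f z * G z) holomorphic_on strip \<delta>"
    by (intro holomorphic_intros hol G_holomorphic)
  then have hol': "(\<lambda>z. f z * G z) holomorphic_on {z. 0 \<le> Im z \<and> Im z \<le> \<delta>}"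
    by (simp add: strip_def)
  have bound: "cmod (f z * G z) \<le> b * C / (1 + (Re z)^2)" if "0 \<le> Im z" "Im z \<le> \<delta>" for z
  proof -
    have z: "z \<in> strip \<delta>" using that by (simp add: strip_def)
    have "cmod (f z) * cmod (G z) \<le> b * (C / (1 + (Re z)^2))"
      using order_trans[OF norm_ge_zero b[OF z]] by (intro mult_mono b z G_bound) auto
    then show ?thesis by (simp add: norm_mult)
  qed
  have "0 \<le> \<delta>" using \<delta>_pos by simp
  note shift = horizontal_line_integral_shift[OF this hol' bound]
  show "integrable lborel (upper_edge f)"
    using shift(1)[of \<delta>] \<delta>_pos by (simp add: upper_edge_def[abs_def])
  show "cmod (upper_edge f x) \<le> b * C / (1 + x^2)"
    using bound[of "of_real x + \<i> * of_real \<delta>"] \<delta>_pos by (simp add: upper_edge_def)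
  show "(CLINT x|lborel. f (of_real x) * of_real (g x)) = (CLINT x|lborel. upper_edge f x)"
    using shift(2) by (simp add: upper_edge_def G_real)
qed

text \<open>Phase mixing: for \<open>t \<ge> 0\<close> the factor \<open>exp(i t z)\<close> is bounded on the strip and has modulus
  \<open>exp(-\<delta> t)\<close> on its upper edge.\<close>

lemma fourier_eq_decaying_kernel:
  assumes hol: "p holomorphic_on strip \<delta>" and b: "\<And>z. z \<in> strip \<delta> \<Longrightarrow> cmod (p z) \<le> b" and t: "t \<ge> 0"
  shows "fourier (weighted g) (\<lambda>\<omega>. p (of_real \<omega>)) t = decaying_kernel \<delta> (upper_edge p) t"
proof -
  define f where "f z = exp (\<i> * of_real t * z) * p z" for z
  have [measurable]: "(\<lambda>\<omega>. p (of_real \<omega>)) \<in> borel_measurable borel"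
    by (intro borel_measurable_continuous_onI continuous_on_compose2[OF holomorphic_on_imp_continuous_on[OF hol]]
          continuous_intros)
       (use \<delta>_pos in \<open>auto simp: strip_def\<close>)
  have "cmod (f z) \<le> b" if z: "z \<in> strip \<delta>" for z
  proof -
    have "exp (- (t * Im z)) * cmod (p z) \<le> 1 * b"
      using z t by (intro mult_mono b) (auto simp: strip_def)
    then show ?thesis by (simp add: f_def norm_mult)
  qed
  moreover have "f holomorphic_on strip \<delta>"
    unfolding f_def by (intro holomorphic_intros hol)
  ultimately have "(CLINT x|lborel. f (of_real x) * of_real (g x)) = (CLINT x|lborel. upper_edge f x)"
    using upper_edge_shift(3) by blast
  moreover have "(CLINT x|lborel. f (of_real x) * of_real (g x)) = fourier (weighted g) (\<lambda>\<omega>. p (of_real \<omega>)) t"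
    unfolding fourier_def f_def by (subst integral_weighted) (auto simp: mult_ac)
  moreover have "upper_edge f x = exp (- (of_real \<delta> * of_real t)) * (iexp (t * x) * upper_edge p x)" for x
    by (simp add: upper_edge_def f_def algebra_simps exp_add exp_diff exp_minus divide_inverse)
  ultimately show ?thesis
    unfolding decaying_kernel_def fourier_def by (simp only: integral_mult_right_zero)
qed

text \<open>The Laplace transform \<open>D\<close> of the characteristic function of \<open>g\<close>. Written through the upper
  edge of the strip it is defined for \<open>Re \<zeta> > -\<delta>\<close>, so it has values on the imaginary axis.\<close>

definition response :: "complex \<Rightarrow> complex" where
  "response \<zeta> = cauchy_transform (upper_edge (\<lambda>z. 1)) (\<zeta> + of_real \<delta>)"

lemma one_edge:
  shows one_edge_integrable: "integrable lborel (upper_edge (\<lambda>z. 1))"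
    and one_edge_bound: "cmod (upper_edge (\<lambda>z. 1) x) \<le> C / (1 + x^2)"
  using upper_edge_shift(1,2)[of "\<lambda>z. 1" 1] by auto

lemma response_holomorphic: "response holomorphic_on {\<zeta>. Re \<zeta> > - \<delta>}"
  unfolding response_def[abs_def]
  by (rule holomorphic_on_compose_gen[OF _ cauchy_transform_holomorphic[OF one_edge_integrable], unfolded o_def])
     (auto intro!: holomorphic_intros)

lemma response_continuous: "continuous_on {\<zeta>. Re \<zeta> > - \<delta>} response"
  by (rule holomorphic_on_imp_continuous_on[OF response_holomorphic])

lemma response_eq_cauchy_transform:
  assumes \<zeta>: "Re \<zeta> > 0"
  shows "response \<zeta> = cauchy_transform (\<lambda>x. of_real (g x)) \<zeta>"
proof -
  define f where "f z = 1 / (\<zeta> - \<i> * z)" for z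
  have nz: "\<zeta> - \<i> * z \<noteq> 0" "Re \<zeta> \<le> cmod (\<zeta> - \<i> * z)" if "z \<in> strip \<delta>" for z
    using that \<zeta> complex_Re_le_cmod[of "\<zeta> - \<i> * z"] by (auto simp: strip_def)
  have "cmod (f z) \<le> 1 / Re \<zeta>" if "z \<in> strip \<delta>" for z
    unfolding f_def norm_divide using nz[OF that] \<zeta> by (simp add: frac_le)
  moreover have "f holomorphic_on strip \<delta>"
    unfolding f_def using nz by (intro holomorphic_intros) auto
  ultimately have "(CLINT x|lborel. f (of_real x) * of_real (g x)) = (CLINT x|lborel. upper_edge f x)"
    using upper_edge_shift(3) by blast
  moreover have "upper_edge f x = upper_edge (\<lambda>z. 1) x / (\<zeta> + of_real \<delta> - \<i> * of_real x)" for x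
    by (simp add: upper_edge_def f_def algebra_simps)
  ultimately show ?thesis
    by (simp add: response_def cauchy_transform_def f_def)
qed

text \<open>The substitution \<open>x = y + \<epsilon> v\<close> in the Cauchy integral at \<open>\<epsilon> + i y\<close> produces the Poisson
  kernel and its conjugate at scale one.\<close>

lemma response_near_imaginary_axis:
  assumes "\<epsilon> > 0"
  shows "Re (response (Complex \<epsilon> y)) = (LINT v|lborel. g (y + \<epsilon> * v) * (1 / (1 + v^2)))"
    and "Im (response (Complex \<epsilon> y)) = (LINT v|lborel. g (y + \<epsilon> * v) * (v / (1 + v^2)))"
proof -
  let ?k = "\<lambda>v. of_real (g (y + \<epsilon> * v)) / (1 - \<i> * of_real v)"
  let ?F = "\<lambda>x. of_real (g x) / (Complex \<epsilon> y - \<i> * of_real x)"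
  \<comment> \<open>The Jacobian \<open>\<epsilon>\<close> cancels against the scale of the kernel.\<close>
  have eps: "\<epsilon> *\<^sub>R ?F (y + \<epsilon> * v) = ?k v" for v
  proof -
    have "Complex \<epsilon> y - \<i> * of_real (y + \<epsilon> * v) = of_real \<epsilon> * (1 - \<i> * of_real v)"
      by (simp add: complex_eq_iff)
    then show ?thesis using assms by (simp add: scaleR_conv_of_real)
  qed
  have F: "integrable lborel ?F"
    by (rule cauchy_transform_integrable[OF of_real_g_integrable]) (use assms in simp)
  have "integrable lborel (\<lambda>v. \<epsilon> *\<^sub>R ?F (y + \<epsilon> * v))"
    by (intro integrable_scaleR_right lborel_integrable_real_affine F) (use assms in auto)
  then have k: "integrable lborel ?k" unfolding eps .
  have "response (Complex \<epsilon> y) = (CLINT x|lborel. ?F x)"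
    using assms by (simp add: response_eq_cauchy_transform cauchy_transform_def)
  also have "\<dots> = \<epsilon> *\<^sub>R (CLINT v|lborel. ?F (y + \<epsilon> * v))"
    using lborel_integral_real_affine[of \<epsilon> ?F y] assms by simp
  also have "\<dots> = (CLINT v|lborel. ?k v)"
    unfolding eps[symmetric] by (rule integral_scaleR_right[symmetric])
  finally have r: "response (Complex \<epsilon> y) = (CLINT v|lborel. ?k v)" .
  show "Re (response (Complex \<epsilon> y)) = (LINT v|lborel. g (y + \<epsilon> * v) * (1 / (1 + v^2)))"
    unfolding r integral_Re[OF k, symmetric] by (simp add: Re_divide)
  show "Im (response (Complex \<epsilon> y)) = (LINT v|lborel. g (y + \<epsilon> * v) * (v / (1 + v^2)))"
    unfolding r integral_Im[OF k, symmetric] by (simp add: Im_divide)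
qed

lemma response_tendsto: "((\<lambda>\<epsilon>. response (Complex \<epsilon> y)) \<longlongrightarrow> response (Complex 0 y)) (at_right 0)"
proof -
  have "continuous_on {0..} (\<lambda>\<epsilon>. response (Complex \<epsilon> y))"
    by (rule continuous_on_compose2[OF response_continuous])
       (use \<delta>_pos in \<open>auto simp: Complex_eq intro!: continuous_intros\<close>)
  then have "((\<lambda>\<epsilon>. response (Complex \<epsilon> y)) \<longlongrightarrow> response (Complex 0 y)) (at 0 within {0..})"
    by (auto simp: continuous_on_def)
  then show ?thesis by (rule tendsto_within_subset) auto
qed

text \<open>The real part of the Plemelj formula: the Poisson kernel is an approximate identity of mass
  \<open>\<pi>\<close>.\<close>

lemma Re_response_imaginary_axis: "Re (response (Complex 0 y)) = pi * g y"
proof -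
  have "((\<lambda>\<epsilon>. LINT v|lborel. g (y + \<epsilon> * v) * (1 / (1 + v^2))) \<longlongrightarrow> g y * pi) (at_right 0)"
    using approximate_identity[OF g_continuous g_bound integrable_lborel_inverse_1_plus_square, of y]
    by (simp only: integral_lborel_inverse_1_plus_square)
  moreover have "((\<lambda>\<epsilon>. LINT v|lborel. g (y + \<epsilon> * v) * (1 / (1 + v^2))) \<longlongrightarrow> Re (response (Complex 0 y))) (at_right 0)"
    by (rule Lim_transform_eventually[OF tendsto_Re[OF response_tendsto]])
       (auto simp: eventually_at_filter response_near_imaginary_axis)
  ultimately have "g y * pi = Re (response (Complex 0 y))"
    by (rule tendsto_unique[OF trivial_limit_at_right_real])
  then show ?thesis by (simp add: mult.commute)
qed

text \<open>The imaginary part of the Plemelj formula. The truncated integrals differ from the conjugate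
  Poisson integrals by a term that vanishes in the limit, so the principal value exists and
  equals the boundary value.\<close>

lemma hilbert_transform_response: "hilbert_transform g y = - (1 / pi) * Im (response (Complex 0 y))"
proof -
  let ?I = "\<lambda>\<epsilon>. indicator {\<omega>. \<epsilon> < \<bar>\<omega>\<bar>} :: real \<Rightarrow> real"
  let ?R = "\<lambda>\<epsilon>. LINT v|lborel. g (y + \<epsilon> * v) * poisson_defect v"
  define P where "P \<epsilon> = (LINT \<omega>:{\<omega>. \<epsilon> < \<bar>\<omega>\<bar>}|lborel. g (\<omega> + y) / \<omega>)" for \<epsilon>
  have P: "P \<epsilon> = Im (response (Complex \<epsilon> y)) - ?R \<epsilon>" if "\<epsilon> > 0" for \<epsilon>
  proof -
    have gi: "integrable lborel (\<lambda>v. g (y + \<epsilon> * v))"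
      by (intro lborel_integrable_real_affine g_integrable) (use that in simp)
    have mult: "integrable lborel (\<lambda>v. g (y + \<epsilon> * v) * k v)"
      if [measurable]: "k \<in> borel_measurable borel" and k: "\<And>v. \<bar>k v\<bar> \<le> 1" for k :: "real \<Rightarrow> real"
      by (rule integrable_by_bound[OF gi]) (use k in \<open>auto simp: abs_mult intro!: mult_left_le\<close>)
    have "P \<epsilon> = (LINT \<omega>|lborel. ?I \<epsilon> \<omega> * (g (\<omega> + y) / \<omega>))"
      by (simp add: P_def set_lebesgue_integral_def)
    also have "\<dots> = \<epsilon> * (LINT v|lborel. ?I \<epsilon> (\<epsilon> * v) * (g (\<epsilon> * v + y) / (\<epsilon> * v)))"
      using lborel_integral_real_affine[of \<epsilon> "\<lambda>\<omega>. ?I \<epsilon> \<omega> * (g (\<omega> + y) / \<omega>)" 0] that by simp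
    also have "\<dots> = (LINT v|lborel. \<epsilon> * (?I \<epsilon> (\<epsilon> * v) * (g (\<epsilon> * v + y) / (\<epsilon> * v))))"
      by (rule integral_mult_right_zero[symmetric])
    also have "\<dots> = (LINT v|lborel. g (y + \<epsilon> * v) * (v / (1 + v^2)) - g (y + \<epsilon> * v) * poisson_defect v)"
    proof (rule lebesgue_integral_cong)
      fix v
      have "?I \<epsilon> (\<epsilon> * v) = (indicator {v. 1 < \<bar>v\<bar>} v :: real)"
        using that by (auto simp: indicator_def abs_mult)
      then show "\<epsilon> * (?I \<epsilon> (\<epsilon> * v) * (g (\<epsilon> * v + y) / (\<epsilon> * v))) =
          g (y + \<epsilon> * v) * (v / (1 + v^2)) - g (y + \<epsilon> * v) * poisson_defect v"
        using that by (simp add: poisson_defect_def right_diff_distrib add.commute)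
    qed
    also have "\<dots> = (LINT v|lborel. g (y + \<epsilon> * v) * (v / (1 + v^2))) - ?R \<epsilon>"
    proof (rule Bochner_Integration.integral_diff)
      show "integrable lborel (\<lambda>v. g (y + \<epsilon> * v) * (v / (1 + v^2)))"
      proof (rule mult)
        fix v :: real
        have "\<bar>v\<bar> \<le> 1 + v^2" using zero_le_power2[of "\<bar>v\<bar> - 1 / 2"]
          by (simp add: power2_eq_square algebra_simps)
        moreover have "1 + v^2 > 0" by (auto intro: add_pos_nonneg)
        ultimately show "\<bar>v / (1 + v^2)\<bar> \<le> 1" by simp
      qed measurable
      show "integrable lborel (\<lambda>v. g (y + \<epsilon> * v) * poisson_defect v)"
      proof (rule integrable_by_bound)
        show "integrable lborel (\<lambda>v. C * poisson_defect v)"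
          by (intro integrable_mult_right integrable_poisson_defect)
        show "AE v in lborel. norm (g (y + \<epsilon> * v) * poisson_defect v) \<le> norm (C * poisson_defect v)"
          using g_bound C_nonneg by (auto simp: abs_mult intro!: mult_right_mono)
        show "(\<lambda>v. g (y + \<epsilon> * v) * poisson_defect v) \<in> borel_measurable lborel"
          unfolding poisson_defect_def by measurable
      qed
    qed
    also have "(LINT v|lborel. g (y + \<epsilon> * v) * (v / (1 + v^2))) = Im (response (Complex \<epsilon> y))"
      using response_near_imaginary_axis(2)[OF that] by simp
    finally show ?thesis .
  qed
  have "((\<lambda>\<epsilon>. LINT v|lborel. g (y + \<epsilon> * v) * poisson_defect v) \<longlongrightarrow> 0) (at_right 0)"
    using approximate_identity[OF g_continuous g_bound integrable_poisson_defect, of y]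
    by (simp add: integral_poisson_defect)
  then have "((\<lambda>\<epsilon>. Im (response (Complex \<epsilon> y)) - ?R \<epsilon>)
      \<longlongrightarrow> Im (response (Complex 0 y)) - 0) (at_right 0)"
    by (intro tendsto_diff tendsto_Im response_tendsto)
  then have "(P \<longlongrightarrow> Im (response (Complex 0 y)) - 0) (at_right 0)"
    by (rule Lim_transform_eventually) (use P in \<open>auto simp: eventually_at_filter\<close>)
  then have "Lim (at_right 0) P = Im (response (Complex 0 y))"
    by (intro tendsto_Lim) auto
  then show ?thesis by (simp add: hilbert_transform_def P_def[abs_def])
qed

text \<open>The kernel \<open>1 / (\<zeta> - i x)\<close> has positive real part for \<open>Re \<zeta> > 0\<close>.\<close>

lemma Re_response_nonneg:
  assumes "Re \<zeta> \<ge> 0" shows "Re (response \<zeta>) \<ge> 0"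
proof (cases "Re \<zeta> = 0")
  case True
  then have "\<zeta> = Complex 0 (Im \<zeta>)" by (simp add: complex_eq_iff)
  then show ?thesis using Re_response_imaginary_axis[of "Im \<zeta>"] g_nonneg by simp
next
  case False
  with assms have \<zeta>: "Re \<zeta> > 0" by simp
  have "Re (response \<zeta>) = (LINT x|lborel. Re (of_real (g x) / (\<zeta> - \<i> * of_real x)))"
    unfolding response_eq_cauchy_transform[OF \<zeta>] cauchy_transform_def
    by (rule integral_Re[OF cauchy_transform_integrable[OF of_real_g_integrable \<zeta>], symmetric])
  also have "\<dots> \<ge> 0"
    by (intro Bochner_Integration.integral_nonneg) (use \<zeta> g_nonneg in \<open>simp add: Re_divide\<close>)
  finally show ?thesis .
qed

text \<open>One bound controls the imaginary and the other the real direction; together they confine the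
  set of points at which \<open>response\<close> is not small.\<close>

lemma response_decay:
  obtains A where "A > 0" "\<And>\<zeta>. Re \<zeta> \<ge> 0 \<Longrightarrow> cmod (response \<zeta>) \<le> A / sqrt (1 + (Im \<zeta>)^2)"
    "\<And>\<zeta>. Re \<zeta> \<ge> 0 \<Longrightarrow> cmod (response \<zeta>) \<le> A / (Re \<zeta> + \<delta>)"
proof -
  let ?E1 = "upper_edge (\<lambda>z. 1)"
  obtain A where A: "A > 0" "\<And>\<mu>. Re \<mu> \<ge> \<delta> \<Longrightarrow>
      cmod (cauchy_transform (?E1) \<mu>) \<le> A / sqrt (1 + (Im \<mu>)^2)"
    using cauchy_transform_decay[OF one_edge_integrable one_edge_bound \<delta>_pos] by blast
  define I where "I = (LINT x|lborel. cmod (?E1 x))"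
  show thesis
  proof (rule that[of "max A I"])
    fix \<zeta> :: complex assume \<zeta>: "Re \<zeta> \<ge> 0"
    have "cmod (response \<zeta>) \<le> A / sqrt (1 + (Im \<zeta>)^2)"
      using A(2)[of "\<zeta> + of_real \<delta>"] \<zeta> by (simp add: response_def)
    also have "\<dots> \<le> max A I / sqrt (1 + (Im \<zeta>)^2)" by (intro divide_right_mono) auto
    finally show "cmod (response \<zeta>) \<le> max A I / sqrt (1 + (Im \<zeta>)^2)" .
    have "cmod (response \<zeta>) \<le> I / (Re \<zeta> + \<delta>)"
      using norm_cauchy_transform_le[OF one_edge_integrable, of "\<zeta> + of_real \<delta>"] \<zeta> \<delta>_pos
      by (simp add: response_def I_def)
    also have "\<dots> \<le> max A I / (Re \<zeta> + \<delta>)" using \<zeta> \<delta>_pos by (intro divide_right_mono) auto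
    finally show "cmod (response \<zeta>) \<le> max A I / (Re \<zeta> + \<delta>)" .
  qed (use A in auto)
qed

text \<open>The solutions of \<open>\<kappa> D(\<zeta>) = 1\<close> with \<open>Re \<zeta> > 0\<close> are the eigenvalues of \<open>i \<omega> + \<kappa> P\<close> there. For
  \<open>\<kappa> > 0\<close> a solution makes the set \<open>X\<close> of points where \<open>D\<close> is real and at least \<open>1 / \<kappa>\<close>
  nonempty. The maximum of \<open>D\<close> on the compact set \<open>X\<close> is not attained in the open half-plane,
  where the image of \<open>D\<close> is open; on the imaginary axis the hypothesis on the roots of \<open>H[g]\<close>
  excludes it.\<close>

lemma no_eigenvalue_right_half_plane:
  fixes \<kappa> :: real
  assumes crit: "\<And>y. hilbert_transform g y = 0 \<Longrightarrow> \<kappa> * (pi * g y) < 1" and \<zeta>0: "Re \<zeta>0 \<ge> 0"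
  shows "of_real \<kappa> * response \<zeta>0 \<noteq> 1"
proof
  assume eq: "of_real \<kappa> * response \<zeta>0 = 1"
  then have "Re (of_real \<kappa> * response \<zeta>0) = 1" by simp
  then have "\<kappa> * Re (response \<zeta>0) = 1" by simp
  moreover have "Re (response \<zeta>0) \<ge> 0" by (rule Re_response_nonneg[OF \<zeta>0])
  ultimately have \<kappa>: "\<kappa> > 0"
    using mult_nonpos_nonneg[of \<kappa> "Re (response \<zeta>0)"] by linarith
  define r where "r = 1 / \<kappa>"
  have r: "r > 0" using \<kappa> by (simp add: r_def)
  have resp0: "response \<zeta>0 = of_real r" using eq \<kappa> by (simp add: r_def field_simps)
  obtain A where A: "A > 0" "\<And>\<zeta>. Re \<zeta> \<ge> 0 \<Longrightarrow> cmod (response \<zeta>) \<le> A / sqrt (1 + (Im \<zeta>)^2)"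
    "\<And>\<zeta>. Re \<zeta> \<ge> 0 \<Longrightarrow> cmod (response \<zeta>) \<le> A / (Re \<zeta> + \<delta>)"
    using response_decay by blast
  define T where "T = {w::complex. Im w = 0 \<and> r \<le> Re w}"
  define X where "X = {\<zeta>. 0 \<le> Re \<zeta>} \<inter> response -` T"
  have T: "r \<le> cmod w" if "w \<in> T" for w
    using that complex_Re_le_cmod[of w] by (simp add: T_def)
  have cont: "continuous_on {\<zeta>. 0 \<le> Re \<zeta>} response"
    by (rule continuous_on_subset[OF response_continuous]) (use \<delta>_pos in auto)
  have "closed T" unfolding T_def
    by (intro closed_Collect_conj closed_Collect_eq closed_Collect_le continuous_intros)
  then have "closed X"
    unfolding X_def by (intro continuous_closed_preimage cont) (auto simp: closed_halfspace_Re_ge)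
  moreover have "bounded X"
  proof (rule bounded_subset[OF bounded_cbox])
    show "X \<subseteq> cbox (Complex 0 (- (A / r))) (Complex (A / r) (A / r))"
    proof
      fix \<zeta> assume "\<zeta> \<in> X"
      then have \<zeta>: "Re \<zeta> \<ge> 0" and le: "r \<le> cmod (response \<zeta>)" using T by (auto simp: X_def)
      have "r \<le> A / (Re \<zeta> + \<delta>)" using A(3)[OF \<zeta>] le by simp
      then have "Re \<zeta> + \<delta> \<le> A / r" using r \<zeta> \<delta>_pos by (simp add: field_simps)
      moreover have "r \<le> A / sqrt (1 + (Im \<zeta>)^2)" using A(2)[OF \<zeta>] le by simp
      then have "sqrt (1 + (Im \<zeta>)^2) \<le> A / r" using r by (simp add: field_simps add_pos_nonneg)
      then have "\<bar>Im \<zeta>\<bar> \<le> A / r"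
        using real_sqrt_le_mono[of "(Im \<zeta>)^2" "1 + (Im \<zeta>)^2"] by simp
      ultimately show "\<zeta> \<in> cbox (Complex 0 (- (A / r))) (Complex (A / r) (A / r))"
        using \<zeta> \<delta>_pos by (auto simp: in_cbox_complex_iff)
    qed
  qed
  ultimately have "compact X" by (simp add: compact_eq_bounded_closed)
  moreover have "\<zeta>0 \<in> X" using \<zeta>0 resp0 by (simp add: X_def T_def)
  moreover have "continuous_on X (\<lambda>\<zeta>. Re (response \<zeta>))"
    by (intro continuous_intros continuous_on_subset[OF cont]) (auto simp: X_def)
  ultimately obtain z where z: "z \<in> X" and max: "\<And>\<zeta>. \<zeta> \<in> X \<Longrightarrow> Re (response \<zeta>) \<le> Re (response z)"
    using continuous_attains_sup[of X "\<lambda>\<zeta>. Re (response \<zeta>)"] by blast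
  have zT: "Re z \<ge> 0" "Im (response z) = 0" "r \<le> Re (response z)" using z by (auto simp: X_def T_def)
  show False
  proof (cases "Re z = 0")
    case True
    then have z': "z = Complex 0 (Im z)" by (simp add: complex_eq_iff)
    then have "hilbert_transform g (Im z) = 0"
      using zT(2) hilbert_transform_response[of "Im z"] by simp
    then have "\<kappa> * (pi * g (Im z)) < 1" by (rule crit)
    moreover have "r \<le> pi * g (Im z)"
      using zT(3) z' Re_response_imaginary_axis[of "Im z"] by simp
    ultimately show False using \<kappa> by (simp add: r_def field_simps)
  next
    case False
    let ?S = "{\<zeta>. 0 < Re \<zeta>}"
    have "\<not> response constant_on ?S"
    proof
      assume "response constant_on ?S"
      then have "response (of_real (A / r + 1)) = response z"
        using False zT(1) A(1) r by (auto simp: constant_on_def add_pos_pos)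
      then have "r \<le> cmod (response (of_real (A / r + 1)))"
        using zT(3) complex_Re_le_cmod[of "response z"] by simp
      also have "\<dots> \<le> A / (A / r + 1 + \<delta>)"
        using A(3)[of "of_real (A / r + 1)"] A(1) r by simp
      also have "\<dots> < A / (A / r)"
      proof (rule divide_strict_left_mono)
        show "0 < (A / r + 1 + \<delta>) * (A / r)"
          using A(1) r \<delta>_pos by (intro mult_pos_pos add_pos_pos divide_pos_pos) auto
      qed (use A(1) \<delta>_pos in auto)
      also have "\<dots> = r" using A(1) by simp
      finally show False by simp
    qed
    then have "open (response ` ?S)"
    proof (intro open_mapping_thm[of response ?S])
      show "response holomorphic_on ?S"
        by (rule holomorphic_on_subset[OF response_holomorphic]) (use \<delta>_pos in auto)
      show "connected ?S" by (intro convex_connected convex_halfspace_Re_gt)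
    qed (auto simp: open_halfspace_Re_gt)
    moreover have "response z \<in> response ` ?S" using False zT(1) by auto
    ultimately obtain e where e: "e > 0" "ball (response z) e \<subseteq> response ` ?S"
      by (auto simp: open_contains_ball)
    \<comment> \<open>Openness of the image yields a real value of \<open>response\<close> above the maximum.\<close>
    have "response z + of_real (e / 2) \<in> ball (response z) e"
      using e(1) by (simp add: dist_norm)
    then obtain \<mu> where \<mu>: "\<mu> \<in> ?S" "response \<mu> = response z + of_real (e / 2)"
      using e(2) by force
    then have "\<mu> \<in> X" using zT e(1) by (simp add: X_def T_def)
    from max[OF this] \<mu>(2) e(1) show False by simp
  qed
qed

section \<open>Weak stability of the incoherent state\<close>

lemma H_plus_strip:
  assumes "\<phi> \<in> H_plus"
  obtains b where "\<phi> holomorphic_on strip \<delta>" "\<And>z. z \<in> strip \<delta> \<Longrightarrow> cmod (\<phi> z) \<le> b"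
    "(\<lambda>\<omega>. \<phi> (of_real \<omega>)) \<in> borel_measurable borel" "\<And>\<omega>. cmod (\<phi> (of_real \<omega>)) \<le> b"
proof -
  have hol: "\<phi> holomorphic_on {z. 0 \<le> Im z}"
    using assms by (auto simp: H_plus_def intro: analytic_imp_holomorphic)
  obtain b where b: "\<And>z. 0 \<le> Im z \<Longrightarrow> cmod (\<phi> z) \<le> b"
    using assms by (auto simp: H_plus_def bounded_iff)
  have "continuous_on UNIV (\<lambda>\<omega>. \<phi> (of_real \<omega>))"
    by (rule continuous_on_compose2[OF holomorphic_on_imp_continuous_on[OF hol]]) (auto intro!: continuous_intros)
  then show thesis
    using b by (intro that[of b] holomorphic_on_subset[OF hol] borel_measurable_continuous_onI)
      (auto simp: strip_def)
qed

text \<open>Complex conjugation in the inner product cancels the one in \<open>star\<close>, so the test function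
  enters as \<open>\<psi>\<close> itself and can be continued into the upper half-plane together with \<open>\<phi>\<close> and
  \<open>g\<close>.\<close>

lemma flow_weakly_to_zero:
  assumes nz: "\<And>\<zeta>. Re \<zeta> \<ge> 0 \<Longrightarrow> \<kappa> * response \<zeta> \<noteq> 1" and \<phi>: "\<phi> \<in> H_plus" and \<psi>: "\<psi> \<in> H_plus"
  shows "((\<lambda>t. L2_inner (weighted g) (flow (weighted g) \<kappa> t (\<lambda>\<omega>. \<phi> (of_real \<omega>))) (\<lambda>\<omega>. star \<psi> (of_real \<omega>)))
    \<longlongrightarrow> 0) at_top"
proof -
  let ?E1 = "upper_edge (\<lambda>z. 1)"
  let ?k\<psi> = "decaying_kernel \<delta> (upper_edge \<psi>)"
  let ?M = "weighted g" and ?\<phi> = "\<lambda>\<omega>::real. \<phi> (of_real \<omega>)" and ?\<psi> = "\<lambda>\<omega>::real. \<psi> (of_real \<omega>)"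
  let ?\<eta> = "order_parameter ?M \<kappa> ?\<phi>"
  obtain b where b: "\<phi> holomorphic_on strip \<delta>" "\<And>z. z \<in> strip \<delta> \<Longrightarrow> cmod (\<phi> z) \<le> b"
    "?\<phi> \<in> borel_measurable borel" "\<And>\<omega>. cmod (?\<phi> \<omega>) \<le> b" using H_plus_strip[OF \<phi>] by blast
  obtain b' where b': "\<psi> holomorphic_on strip \<delta>" "\<And>z. z \<in> strip \<delta> \<Longrightarrow> cmod (\<psi> z) \<le> b'"
    "?\<psi> \<in> borel_measurable borel" "\<And>\<omega>. cmod (?\<psi> \<omega>) \<le> b'" using H_plus_strip[OF \<psi>] by blast
  have L2: "?\<phi> \<in> L2 ?M" by (rule L2_bounded[OF _ b(4)]) (use b(3) in simp)
  define p where "p z = \<phi> z * \<psi> z" for z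
  have p: "p holomorphic_on strip \<delta>" "\<And>z. z \<in> strip \<delta> \<Longrightarrow> cmod (p z) \<le> b * b'"
    unfolding p_def using b b' order_trans[OF norm_ge_zero b(2)]
    by (auto intro!: holomorphic_intros mult_mono simp: norm_mult)
  note E = upper_edge_shift
  have inner: "L2_inner ?M (flow ?M \<kappa> t ?\<phi>) (\<lambda>\<omega>. star \<psi> (of_real \<omega>)) =
      decaying_kernel \<delta> (upper_edge p) t + \<kappa> * conv ?k\<psi> ?\<eta> t" if t: "t \<ge> 0" for t
  proof -
    have "L2_inner ?M (flow ?M \<kappa> t ?\<phi>) (\<lambda>\<omega>. star \<psi> (of_real \<omega>)) = (CLINT \<omega>|?M. flow ?M \<kappa> t ?\<phi> \<omega> * ?\<psi> \<omega>)"
      by (simp add: L2_inner_def star_def)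
    also have "\<dots> = fourier ?M (\<lambda>\<omega>. ?\<phi> \<omega> * ?\<psi> \<omega>) t + \<kappa> * conv (fourier ?M ?\<psi>) ?\<eta> t"
      by (rule integral_flow_mult[OF L2 _ b'(4) t]) (use b'(3) in simp)
    also have "fourier ?M (\<lambda>\<omega>. ?\<phi> \<omega> * ?\<psi> \<omega>) t = decaying_kernel \<delta> (upper_edge p) t"
      using fourier_eq_decaying_kernel[OF p t] unfolding p_def .
    also have "conv (fourier ?M ?\<psi>) ?\<eta> t = conv ?k\<psi> ?\<eta> t"
      by (rule conv_cong) (use fourier_eq_decaying_kernel[OF b'(1,2)] in auto)
    finally show ?thesis .
  qed
  have "((\<lambda>t. conv ?k\<psi> ?\<eta> t) \<longlongrightarrow> 0) at_top"
  proof (rule volterra_weak_decay[OF one_edge_integrable one_edge_bound E(1)[OF b(1,2)] E(2)[OF b(1,2)]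
        E(1)[OF b'(1,2)] E(2)[OF b'(1,2)] \<delta>_pos continuous_on_order_parameter[OF L2] order_parameter_bound[OF L2]])
    show "2 * cmod \<kappa> + 1 > 0" by (simp add: add_nonneg_pos)
    fix t :: real assume t: "t \<ge> 0"
    have "char ?M s = decaying_kernel \<delta> ?E1 s" if "s \<ge> 0" for s
      using fourier_eq_decaying_kernel[of "\<lambda>z. 1" 1, OF _ _ that] fun_cong[OF fourier_one, of s] by simp
    then have "conv (char ?M) ?\<eta> t = conv (decaying_kernel \<delta> ?E1) ?\<eta> t"
      by (intro conv_cong) auto
    then show "?\<eta> t = decaying_kernel \<delta> (upper_edge \<phi>) t + \<kappa> * conv (decaying_kernel \<delta> ?E1) ?\<eta> t"
      using order_parameter_volterra[OF L2 t, of \<kappa>] fourier_eq_decaying_kernel[OF b(1,2) t] by simp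
  next
    fix \<zeta> :: complex assume "Re \<zeta> \<ge> 0"
    from nz[OF this] show "1 - \<kappa> * cauchy_transform ?E1 (\<zeta> + of_real \<delta>) \<noteq> 0"
      by (simp add: response_def)
  qed
  moreover have "(decaying_kernel \<delta> (upper_edge p) \<longlongrightarrow> 0) at_top"
  proof (rule Lim_null_comparison)
    let ?I = "LINT x|lborel. cmod (upper_edge p x)"
    have "((\<lambda>t. exp (- (\<delta> * t))) \<longlongrightarrow> 0) at_top" using \<delta>_pos by real_asymp
    then show "((\<lambda>t. exp (- (\<delta> * t)) * ?I) \<longlongrightarrow> 0) at_top" by (rule tendsto_mult_left_zero)
    have "cmod (decaying_kernel \<delta> (upper_edge p) t) \<le> exp (- (\<delta> * t)) * ?I" for t
      using norm_fourier_le[OF sets_lborel E(1)[OF p], of t]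
      by (simp add: decaying_kernel_def norm_mult mult_left_mono)
    then show "\<forall>\<^sub>F t in at_top. norm (decaying_kernel \<delta> (upper_edge p) t) \<le> exp (- (\<delta> * t)) * ?I"
      by simp
  qed
  ultimately have "((\<lambda>t. decaying_kernel \<delta> (upper_edge p) t +
      \<kappa> * conv ?k\<psi> ?\<eta> t) \<longlongrightarrow> 0 + \<kappa> * 0) at_top"
    by (intro tendsto_intros)
  then have lim: "((\<lambda>t. decaying_kernel \<delta> (upper_edge p) t +
      \<kappa> * conv ?k\<psi> ?\<eta> t) \<longlongrightarrow> 0) at_top" by simp
  show ?thesis
    by (rule Lim_transform_eventually[OF lim])
       (use inner in \<open>auto intro!: eventually_mono[OF eventually_ge_at_top[of 0]]\<close>)
qed

text \<open>The stability criterion for a general coupling function with real gains \<open>i K f\<^sub>j\<close>. Only an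
  upper bound on the gains enters, because \<open>Re D \<ge> 0\<close> makes negative gains harmless.\<close>

lemma weakly_stable_below_threshold:
  assumes f: "\<And>j. j \<ge> 1 \<Longrightarrow> \<exists>\<kappa>\<le>\<kappa>0. \<i> * of_real K * fourier_coeff f (int j) = of_real \<kappa>"
    and crit: "\<And>y. hilbert_transform g y = 0 \<Longrightarrow> \<kappa>0 * (pi * g y) < 1"
  shows "incoherent_state_weakly_stable K f g"
  unfolding incoherent_state_weakly_stable_def
proof (intro allI impI)
  fix j :: nat assume j: "1 \<le> j"
  then have j0: "real j > 0" by simp
  obtain \<kappa> where \<kappa>: "\<kappa> \<le> \<kappa>0" "\<i> * of_real K * fourier_coeff f (int j) = of_real \<kappa>" using f[OF j] by blast
  let ?M = "weighted g" and ?S = "\<lambda>t. flow (weighted g) (of_real \<kappa>) (real j * t)"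
  have "lin_op_domain g = {\<phi> \<in> L2 ?M. (\<lambda>\<omega>. of_real \<omega> * \<phi> \<omega>) \<in> L2 ?M}"
    by (simp add: lin_op_domain_def)
  moreover have "lin_op K f g j = (\<lambda>\<phi> \<omega>. of_real (real j) * mean_field_op ?M (of_real \<kappa>) \<phi> \<omega>)"
    unfolding lin_op_def mean_field_op_def \<kappa>(2)[symmetric] by (intro ext) (simp add: algebra_simps)
  ultimately have gen: "generates ?M (lin_op_domain g) (lin_op K f g j) ?S"
    using generates_time_scaled[OF generates_flow j0, of "of_real \<kappa>"] by simp
  have nz: "of_real \<kappa> * response \<zeta> \<noteq> 1" if "Re \<zeta> \<ge> 0" for \<zeta>
  proof (rule no_eigenvalue_right_half_plane[OF _ that])
    fix y assume "hilbert_transform g y = 0"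
    then have "\<kappa>0 * (pi * g y) < 1" by (rule crit)
    moreover have "\<kappa> * (pi * g y) \<le> \<kappa>0 * (pi * g y)"
      using \<kappa>(1) g_nonneg[of y] by (intro mult_right_mono) auto
    ultimately show "\<kappa> * (pi * g y) < 1" by linarith
  qed
  have scale: "filterlim (\<lambda>t. real j * t) at_top at_top"
    using j0 by (intro filterlim_tendsto_pos_mult_at_top[OF tendsto_const] filterlim_ident)
  have "\<forall>\<phi>\<in>H_plus. weakly_to_zero g (\<lambda>t. ?S t (\<lambda>\<omega>. \<phi> (of_real \<omega>)))"
    unfolding weakly_to_zero_def
  proof (intro ballI)
    fix \<phi> \<psi> assume "\<phi> \<in> H_plus" "\<psi> \<in> H_plus"
    from filterlim_compose[OF flow_weakly_to_zero[OF nz this] scale]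
    show "((\<lambda>t. L2_inner ?M (?S t (\<lambda>\<omega>. \<phi> (of_real \<omega>))) (\<lambda>\<omega>. star \<psi> (of_real \<omega>))) \<longlongrightarrow> 0) at_top" .
  qed
  with gen show "\<exists>S. generates ?M (lin_op_domain g) (lin_op K f g j) S \<and>
      (\<forall>\<phi>\<in>H_plus. weakly_to_zero g (\<lambda>t. S t (\<lambda>\<omega>. \<phi> (of_real \<omega>))))"
    by blast
qed

end

text \<open>By \<open>h < 1\<close> the second harmonic never has a larger gain than the first, so the first mode
  sets the threshold.\<close>

lemma daido_mode_gain:
  assumes "h < 1" "0 < K"
  shows "\<exists>\<kappa>\<le>K / 2. \<i> * of_real K * fourier_coeff (daido_coupling h) (int j) = of_real \<kappa>"
proof -
  consider "j = 1" | "j = 2" | "j \<noteq> 1" "j \<noteq> 2" by blast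
  then show ?thesis
  proof cases
    case 1
    then show ?thesis by (intro exI[of _ "K / 2"]) (simp add: fourier_coeff_daido complex_eq_iff)
  next
    case 2
    have "h * K \<le> 1 * K" using assms by (intro mult_right_mono) auto
    with 2 show ?thesis by (intro exI[of _ "h * K / 2"]) (simp add: fourier_coeff_daido complex_eq_iff)
  next
    case 3
    then show ?thesis using assms by (intro exI[of _ 0]) (simp add: fourier_coeff_daido complex_eq_iff)
  qed
qed

theorem theorem1p2:
  fixes h K \<delta> C y_c :: real and g :: "real \<Rightarrow> real" and G :: "complex \<Rightarrow> complex"
  assumes "h < 1"
    and "prob_density g"
    and "\<delta> > 0"
    and "analytic_continuation g G (strip \<delta>)"
    and "C > 0"
    and "\<And>z. z \<in> strip \<delta> \<Longrightarrow> cmod (G z) \<le> C / (1 + (cmod z)\<^sup>2)"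
    and "hilbert_transform g y_c = 0"
    and "g y_c = (SUP y\<in>{y. hilbert_transform g y = 0}. g y)"
    and "0 < K" and "K < 2 / (pi * g y_c)"
  shows "incoherent_state_weakly_stable K (daido_coupling h) g"
proof -
  interpret strip_density g G \<delta> C
    by standard (use assms in auto)
  \<comment> \<open>If \<open>g(y\<^sub>c) = 0\<close>, then \<open>2 / (\<pi> g(y\<^sub>c)) = 0\<close>, which contradicts \<open>0 < K\<close>.\<close>
  have "g y_c \<noteq> 0" using assms(9,10) by auto
  then have yc: "g y_c > 0" using g_nonneg[of y_c] by simp
  show ?thesis
  proof (rule weakly_stable_below_threshold[OF daido_mode_gain[OF assms(1,9)]])
    fix y assume "hilbert_transform g y = 0"
    then have "g y \<le> g y_c"
      unfolding assms(8) by (intro cSUP_upper bdd_aboveI2[of _ _ C]) (use g_bound abs_le_D1 in auto)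
    then have "K / 2 * (pi * g y) \<le> K / 2 * (pi * g y_c)"
      using assms(9) by (intro mult_left_mono) auto
    also have "\<dots> < 1" using assms(10) yc by (simp add: field_simps)
    finally show "K / 2 * (pi * g y) < 1" .
  qed
qed

end
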